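(* There is an open and dense subset $\mathcal{U}$ of $\mathcal{E}^{1,1}(\mathbb{T})$ (with the $C^{1,1}$ topology) such that every $T\in\mathcal{U}$ has a unique Lyapunov minimizing measure, and this measure is supported on a periodic orbit of $T$.
   Context: $\mathbb{T}=\mathbb{R}/\mathbb{Z}$ is the circle with its standard metric $d$. A $C^1$ map $T:\mathbb{T}\to\mathbb{T}$ is expanding if there are $C>0$ and $\lambda>1$ with $|DT^n(x)|\ge C\lambda^n$ for all $x\in\mathbb{T}$, $n\ge1$. For $\chi\in(0,1]$, $\mathcal{E}^{1,\chi}(\mathbb{T})$ is the space of $C^1$ expanding self-maps of $\mathbb{T}$ whose derivative is $\chi$-Hölder (Lipschitz when $\chi=1$), with the $C^{1,\chi}$ distance $d_{C^{1,\chi}}(S,T)=d_{C^0}(S,T)+d_{C^0}(DS,DT)+\sup_{x\neq y}\frac{|(DS-DT)(x)-(DS-DT)(y)|}{d(x,y)^{\chi}}$. For a $T$-invariant Borel probability measure $\mu$, its Lyapunov exponent is $\lambda_T(\mu)=\int\log|DT|\,d\mu$; $\alpha(T)$ is the infimum of $\lambda_T(\nu)$ over all $T$-invariant Borel probability measures $\nu$, and $\mu$ is a Lyapunov minimizing measure if $\lambda_T(\mu)=\alpha(T)$. *)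

theory Defs
  imports "HOL-Probability.Probability"
begin

text \<open>The circle R/Z is modelled via lifts.  A point of the circle is represented by any
real number (its class mod 1), canonically by a number in [0,1).  A self-map T of the circle
is represented by its lift F : real => real with F(x+1) = F x + d for an integer d (the degree),
normalised by 0 <= F 0 < 1, which makes the correspondence map <-> lift bijective.\<close>

definition cdist :: "real \<Rightarrow> real \<Rightarrow> real" where
  "cdist x y = \<bar>(x - y) - of_int (round (x - y))\<bar>"

definition circ_map :: "(real \<Rightarrow> real) \<Rightarrow> real \<Rightarrow> real" where
  "circ_map F x = frac (F x)"

definition C1_lift :: "(real \<Rightarrow> real) \<Rightarrow> bool" where
  "C1_lift F \<longleftrightarrow> (\<forall>x. F differentiable (at x)) \<and> continuous_on UNIV (deriv F)
     \<and> (\<exists>d::int. \<forall>x. F (x + 1) = F x + of_int d) \<and> 0 \<le> F 0 \<and> F 0 < 1"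

definition expanding :: "(real \<Rightarrow> real) \<Rightarrow> bool" where
  "expanding F \<longleftrightarrow> (\<exists>C>0. \<exists>lam>1. \<forall>n\<ge>1. \<forall>x. \<bar>deriv (F ^^ n) x\<bar> \<ge> C * lam ^ n)"

definition E11 :: "(real \<Rightarrow> real) set" where
  "E11 = {F. C1_lift F \<and> expanding F \<and>
              (\<exists>L. \<forall>x y. \<bar>deriv F x - deriv F y\<bar> \<le> L * cdist x y)}"

definition dC11 :: "(real \<Rightarrow> real) \<Rightarrow> (real \<Rightarrow> real) \<Rightarrow> real" where
  "dC11 S T =
     (SUP x. cdist (S x) (T x))
   + (SUP x. \<bar>deriv S x - deriv T x\<bar>)
   + (SUP p\<in>{(x, y). cdist x y \<noteq> 0}.
        \<bar>(deriv S (fst p) - deriv T (fst p)) - (deriv S (snd p) - deriv T (snd p))\<bar>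
          / cdist (fst p) (snd p))"

definition open_E11 :: "(real \<Rightarrow> real) set \<Rightarrow> bool" where
  "open_E11 U \<longleftrightarrow> U \<subseteq> E11 \<and> (\<forall>T\<in>U. \<exists>e>0. \<forall>S\<in>E11. dC11 S T < e \<longrightarrow> S \<in> U)"

definition dense_E11 :: "(real \<Rightarrow> real) set \<Rightarrow> bool" where
  "dense_E11 U \<longleftrightarrow> U \<subseteq> E11 \<and> (\<forall>T\<in>E11. \<forall>e>0. \<exists>S\<in>U. dC11 S T < e)"

text \<open>Borel probability measures on the circle = Borel probability measures on real
concentrated on [0,1).  T-invariance: push-forward under the circle map equals the measure.\<close>
definition invariant_prob :: "(real \<Rightarrow> real) \<Rightarrow> real measure \<Rightarrow> bool" where
  "invariant_prob F M \<longleftrightarrow> sets M = sets borel \<and> prob_space M \<and> emeasure M {0..<1} = 1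
     \<and> distr M borel (circ_map F) = M"

definition lyap :: "(real \<Rightarrow> real) \<Rightarrow> real measure \<Rightarrow> real" where
  "lyap F M = (\<integral>x. ln \<bar>deriv F x\<bar> \<partial>M)"

definition alpha :: "(real \<Rightarrow> real) \<Rightarrow> real" where
  "alpha F = Inf {lyap F M | M. invariant_prob F M}"

definition lyap_minimizing :: "(real \<Rightarrow> real) \<Rightarrow> real measure \<Rightarrow> bool" where
  "lyap_minimizing F M \<longleftrightarrow> invariant_prob F M \<and> lyap F M = alpha F"

definition supported_on_periodic_orbit :: "(real \<Rightarrow> real) \<Rightarrow> real measure \<Rightarrow> bool" where
  "supported_on_periodic_orbit F M \<longleftrightarrow>
     (\<exists>x p. 0 \<le> x \<and> x < 1 \<and> p \<ge> 1 \<and> (circ_map F ^^ p) x = x \<and>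
        emeasure M {(circ_map F ^^ k) x | k. k < p} = 1)"

end

theory Submission
  imports Defs
begin

text \<open>Circle maps are handled through their lifts, and \<open>\<phi> = ln \<bar>F'\<bar>\<close>. There are a constant
  \<open>\<alpha>\<close> and a Lipschitz function \<open>u\<close> such that \<open>G = \<phi> - \<alpha> + u - u \<circ> F\<close> is nonnegative and vanishes
  along a whole orbit.

  Consider the graph whose vertices are the words of length \<open>n\<close> of orbits on which \<open>G\<close> vanishes. If it
  has no short closed walk, then a walk is determined by its set of vertices, which leaves fewer
  than \<open>V ^ k / k!\<close> walks of length \<open>k\<close>. Compared with the growth rate of the number of words,
  this gives closed walks whose length is subexponential in \<open>n\<close>, hence
  periodic orbits along which the sum of \<open>G\<close> is smaller than any given power of the inverse period.
  Repeatedly cutting such an orbit at two close points, which halves the period, ends with a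
  periodic orbit \<open>O\<close> that is \<open>D\<close>-separated and along which \<open>G\<close> sums to at most \<open>\<tau> D\<close>.

  The map is then perturbed so that \<open>\<phi>\<close> grows by about \<open>\<epsilon> min (d(x, O)) (D / 8)\<close>. As the degree is
  fixed, this has to be paid back; it is paid back in short intervals on which \<open>G \<circ> F ^ m\<close> is bounded
  away from 0, and these are so dense that the map itself moves by much less than \<open>\<epsilon>\<^sup>2 D\<close>.
  A second perturbation restores the value of \<open>\<phi>\<close> along the continuation of \<open>O\<close>.
  An orbit of the new map, or of any map close to it, that leaves a neighbourhood of \<open>O\<close> gains more
  than it can have lost while it was shadowing \<open>O\<close>, since full periods cancel. Integrating this bound
  on Birkhoff sums shows that the continuation of \<open>O\<close> carries the only minimizing measure.
  If \<open>G\<close> vanishes identically, the derivative at a fixed point is changed first.\<close>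

text \<open>Write \<open>a\<close> for the uniform size of the perturbation. Away from
  \<open>O\<close> a step gains about \<epsilon> times the distance to \<open>O\<close> and loses
  O(\<open>a\<close>), so it pays beyond a distance of order \<open>a\<close> / \<epsilon>. A
  stretch near \<open>O\<close> is compared with the continued orbit at a cost of the order of that
  distance, which has to be small against \<epsilon> \<open>D\<close>, the gain of one step at
  distance comparable to \<open>D\<close>. Hence the requirement that \<open>a\<close> be far below
  \<epsilon>^2 \<open>D\<close>. Separation bounds the period only by about 1 / \<open>D\<close>, so
  an error of order \<open>a\<close> in \<phi> at each point of \<open>O\<close> could add up to far
  more than \<epsilon> \<open>D\<close> within an incomplete period. The second perturbation removes
  it; what is left is proportional to the distance of the competing map and is made small once the
  period is known. The orbits on which \<open>G\<close> vanishes need not include a periodic one, so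
  a positive action is tolerated, but it must be small relative to \<open>D\<close>. Each cut may
  multiply the action by a constant, all cuts together by a power of the period; therefore the first
  orbit has to beat every such power.\<close>

lemma lipschitz_realI:
  fixes f :: "real \<Rightarrow> real"
  assumes "\<And>x y. \<bar>f x - f y\<bar> \<le> K * \<bar>x - y\<bar>" "0 \<le> K"
  shows "K-lipschitz_on UNIV f"
  using assms by (auto intro!: lipschitz_onI simp: dist_real_def)

lemma lipschitz_realD:
  fixes f :: "real \<Rightarrow> real"
  assumes "K-lipschitz_on UNIV f"
  shows "\<bar>f x - f y\<bar> \<le> K * \<bar>x - y\<bar>"
  using lipschitz_onD[OF assms, of x y] by (simp add: dist_real_def)

section \<open>Functions of period one and the distance on the circle\<close>

definition periodic1 :: "(real \<Rightarrow> 'a) \<Rightarrow> bool" where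
  "periodic1 f \<longleftrightarrow> (\<forall>x. f (x + 1) = f x)"

lemma periodic1_int:
  assumes "periodic1 f" shows "f (x + of_int k) = f x"
proof -
  have n: "f (y + of_nat n) = f y" for n y
  proof (induction n)
    case (Suc n)
    have "f (y + of_nat (Suc n)) = f ((y + of_nat n) + 1)" by (simp add: add_ac)
    then show ?case using Suc assms by (simp add: periodic1_def)
  qed simp
  show ?thesis
  proof (cases "k \<ge> 0")
    case True then show ?thesis using n[of x "nat k"] by simp
  next
    case False then show ?thesis using n[of "x + of_int k" "nat (-k)"] by simp
  qed
qed

lemma periodic1_diff_int:
  assumes "periodic1 f" "x - y \<in> \<int>" shows "f x = f y"
proof -
  from assms(2) obtain k where "x - y = of_int k" by (auto elim: Ints_cases)
  then have "x = y + of_int k" by simp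
  then show ?thesis using periodic1_int[OF assms(1)] by simp
qed

lemma periodic1_frac: "periodic1 f \<Longrightarrow> f (frac x) = f x"
  by (rule periodic1_diff_int) (auto simp: frac_def)

lemma periodic1_bounded:
  fixes f :: "real \<Rightarrow> real"
  assumes "periodic1 f" "continuous_on UNIV f"
  obtains B where "0 \<le> B" "\<And>x. \<bar>f x\<bar> \<le> B"
proof -
  have "compact (f ` {0..1})"
    by (intro compact_continuous_image continuous_on_subset[OF assms(2)]) auto
  then obtain B where B: "\<And>x. x \<in> {0..1} \<Longrightarrow> \<bar>f x\<bar> \<le> B"
    by (force dest: compact_imp_bounded simp: bounded_iff)
  show thesis
  proof
    show "\<bar>f x\<bar> \<le> B" for x
      using B[of "frac x"] periodic1_frac[OF assms(1), of x] frac_lt_1[of x] frac_ge_0[of x] by simp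
    then show "0 \<le> B" by (meson abs_ge_zero order_trans)
  qed
qed

lemma cdist_le: "cdist x y \<le> \<bar>x - y - of_int m\<bar>"
  unfolding cdist_def using round_diff_minimal[of "x - y" m] by simp

lemma cdist_commute_le: "cdist x y \<le> \<bar>y - x - of_int m\<bar>"
proof -
  have "cdist x y \<le> \<bar>x - y - of_int (- m)\<bar>" unfolding cdist_def using round_diff_minimal[of "x - y" "- m"] by simp
  also have "\<dots> = \<bar>y - x - of_int m\<bar>" by simp
  finally show ?thesis .
qed

lemma cdist_le_half: "cdist x y \<le> 1 / 2"
  unfolding cdist_def using of_int_round_abs_le[of "x - y"] by (simp add: abs_minus_commute)

lemma cdist_le_abs: "cdist x y \<le> \<bar>x - y\<bar>"
  unfolding cdist_def using round_diff_minimal[of "x - y" 0] by simp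

lemma cdist_nonneg: "0 \<le> cdist x y"
  by (simp add: cdist_def)

lemma cdist_pos: "x - y \<notin> \<int> \<Longrightarrow> 0 < cdist x y"
  unfolding cdist_def zero_less_abs_iff
proof
  assume xy: "x - y \<notin> \<int>" and "x - y - of_int (round (x - y)) = 0"
  then have "x - y = of_int (round (x - y))" by simp
  then show False using xy Ints_of_int by metis
qed

lemma funpow_apply: "(f ^^ m) ((f ^^ n) x) = (f ^^ (m + n)) x"
  by (simp add: funpow_add)

section \<open>Birkhoff sums, expanding lifts and shadowing\<close>

definition bsum :: "(real \<Rightarrow> real) \<Rightarrow> (real \<Rightarrow> real) \<Rightarrow> nat \<Rightarrow> real \<Rightarrow> real" where
  "bsum F f n x = (\<Sum>i<n. f ((F ^^ i) x))"

lemma bsum_0 [simp]: "bsum F f 0 x = 0"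
  by (simp add: bsum_def)

lemma bsum_Suc: "bsum F f (Suc n) x = bsum F f n x + f ((F ^^ n) x)"
  by (simp add: bsum_def)

lemma bsum_add: "bsum F f (m + n) x = bsum F f m x + bsum F f n ((F ^^ m) x)"
  by (induction n) (simp_all add: bsum_Suc funpow_add add.commute[of m])

lemma DERIV_funpow:
  fixes F F' :: "real \<Rightarrow> real"
  assumes "\<And>x. (F has_real_derivative F' x) (at x)"
  shows "((F ^^ n) has_real_derivative (\<Prod>i<n. F' ((F ^^ i) x))) (at x)"
proof (induction n)
  case 0 show ?case by (simp add: id_def)
next
  case (Suc n)
  have "((\<lambda>x. F ((F ^^ n) x)) has_real_derivative F' ((F ^^ n) x) * (\<Prod>i<n. F' ((F ^^ i) x))) (at x)"
    by (rule DERIV_chain2[OF assms Suc])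
  then show ?case by (simp add: o_def mult.commute)
qed

text \<open>The expansion is a product along orbits, which can be compared factor by factor with
  that of a nearby map; it includes n = 0, hence \<open>min C 1\<close> in
  \<open>E11_expanding_lift\<close>. The normalisation of \<open>F 0\<close> is left out so that
  perturbed and integer-shifted lifts stay in the locale.\<close>

locale expanding_lift =
  fixes F :: "real \<Rightarrow> real" and d :: int and L C lam :: real
  assumes diff: "F differentiable at x"
    and lip: "L-lipschitz_on UNIV (deriv F)"
    and deg: "F (x + 1) = F x + of_int d"
    and C_pos: "0 < C" and C_le: "C \<le> 1" and lam: "1 < lam"
    and exp_prod: "C * lam ^ n \<le> (\<Prod>i<n. \<bar>deriv F ((F ^^ i) x)\<bar>)"
begin

lemma DERIV: "(F has_real_derivative deriv F x) (at x)"
  using diff DERIV_deriv_iff_real_differentiable by blast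

lemma cont: "continuous_on S F"
  by (meson DERIV DERIV_isCont continuous_at_imp_continuous_on)

lemma cont_pow: "continuous_on S (F ^^ n)"
proof (induction n)
  case (Suc n) then show ?case
    using continuous_on_compose[of S "F ^^ n" F] cont by simp
qed (simp add: id_def[symmetric] continuous_on_id)

lemma deg_int: "F (x + of_int k) = F x + of_int (d * k)"
proof -
  have "periodic1 (\<lambda>x. F x - of_int d * x)"
    unfolding periodic1_def by (simp add: deg algebra_simps)
  from periodic1_int[OF this, of x k] show ?thesis by (simp add: algebra_simps)
qed

lemma deg_pow: "(F ^^ n) (x + of_int k) = (F ^^ n) x + of_int (d ^ n * k)"
proof (induction n)
  case (Suc n)
  have "(F ^^ Suc n) (x + of_int k) = F ((F ^^ n) x + of_int (d ^ n * k))" using Suc by simp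
  then show ?case unfolding deg_int by (simp add: mult.assoc)
qed simp

lemma deg_pow_diff: "x - y \<in> \<int> \<Longrightarrow> (F ^^ n) x - (F ^^ n) y \<in> \<int>"
  by (metis Ints_cases Ints_of_int add_diff_cancel_left' deg_pow diff_add_cancel add.commute)

lemma DERIV_pow: "((F ^^ n) has_real_derivative (\<Prod>i<n. deriv F ((F ^^ i) x))) (at x)"
  by (rule DERIV_funpow[OF DERIV])

lemma expand: "C * lam ^ n * \<bar>a - b\<bar> \<le> \<bar>(F ^^ n) a - (F ^^ n) b\<bar>"
proof -
  have *: "C * lam ^ n * (b - a) \<le> \<bar>(F ^^ n) a - (F ^^ n) b\<bar>" if ab: "a < b" for a b
  proof -
    obtain z where "(F ^^ n) b - (F ^^ n) a = (b - a) * (\<Prod>i<n. deriv F ((F ^^ i) z))"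
      using MVT2[OF ab DERIV_pow] by blast
    then have "\<bar>(F ^^ n) a - (F ^^ n) b\<bar> = (b - a) * (\<Prod>i<n. \<bar>deriv F ((F ^^ i) z)\<bar>)"
      using ab by (subst abs_minus_commute) (simp add: abs_mult abs_prod)
    also have "\<dots> \<ge> (b - a) * (C * lam ^ n)"
      using exp_prod ab by (intro mult_left_mono) auto
    finally show ?thesis by (simp add: mult.commute)
  qed
  consider "a < b" | "b < a" | "a = b" by linarith
  then show ?thesis
    using *[of a b] *[of b a] by cases (auto simp: abs_minus_commute)
qed

text \<open>\<open>ct n\<close> is a Lipschitz constant of the inverse of \<open>F ^^ n\<close>, and
  \<open>KK\<close> is the sum of the series. In \<open>KS\<close> the extra \<open>ct 1\<close>
  pulls the defect of a step back through that step. All three depend on \<open>C\<close> and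
  \<open>lam\<close> alone, so maps sharing these share the constants.\<close>

definition ct :: "nat \<Rightarrow> real" where "ct n = (1 / C) * (1 / lam) ^ n"
definition KK :: real where "KK = (1 / C) * (lam / (lam - 1))"
definition KS :: real where "KS = ct 1 * KK"

lemma ct_pos: "0 < ct n" using C_pos lam by (simp add: ct_def)

lemma ct_sums: "ct sums KK"
  unfolding ct_def KK_def
  using sums_mult[OF geometric_sums[of "1/lam"], of "1/C"] lam
  by (simp add: field_simps)

lemma sum_ct_le: "(\<Sum>k<n. ct k) \<le> KK"
  using sum_le_suminf[of ct "{..<n}"] ct_sums ct_pos
  by (simp add: sums_iff less_imp_le)

lemma KK_pos: "0 < KK" using C_pos lam by (simp add: KK_def)
lemma ct_le_KK: "ct n \<le> KK"
proof -
  have "ct n = sum ct {n}" by simp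
  also have "\<dots> \<le> sum ct {..<Suc n}" by (rule sum_mono2) (auto simp: ct_pos less_imp_le)
  finally show ?thesis using sum_ct_le[of "Suc n"] by linarith
qed
lemma KS_pos: "0 < KS" using KK_pos ct_pos by (simp add: KS_def)

lemma ct_tendsto: "ct \<longlonglongrightarrow> 0"
  using ct_sums sums_summable summable_LIMSEQ_zero by blast

lemma contract: "\<bar>a - b\<bar> \<le> ct n * \<bar>(F ^^ n) a - (F ^^ n) b\<bar>"
  using expand[of n a b] C_pos lam by (simp add: ct_def field_simps)

lemma contract_between:
  assumes "i \<le> n"
  shows "\<bar>(F ^^ i) a - (F ^^ i) b\<bar> \<le> ct (n - i) * \<bar>(F ^^ n) a - (F ^^ n) b\<bar>"
proof -
  have "(F ^^ n) x = (F ^^ (n - i)) ((F ^^ i) x)" for x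
    using assms by (metis funpow_add o_apply le_add_diff_inverse2)
  then show ?thesis using contract[of "(F ^^ i) a" "(F ^^ i) b" "n - i"] by simp
qed

lemma inj_pow: "inj (F ^^ n)"
  by (rule injI) (metis abs_le_zero_iff contract diff_self abs_zero mult_zero_right right_minus_eq)

lemma d_nz: "d \<noteq> 0"
  using inj_pow[of 1] deg[of 0] by (force simp: inj_def)

lemma surj: "surj F"
proof -
  have "\<exists>x. F x = y" for y
  proof -
    define k where "k = \<lceil>\<bar>y - F 0\<bar>\<rceil>"
    have k: "\<bar>y - F 0\<bar> \<le> of_int k" "0 \<le> k" unfolding k_def by (auto simp: le_of_int_ceiling)
    have dk: "of_int k \<le> real_of_int (\<bar>d\<bar> * k)"
      using d_nz k mult_right_mono[of 1 "\<bar>d\<bar>" k] by (simp del: of_int_mult)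
    have sg: "\<bar>d\<bar> = d * sgn d" by (simp add: abs_sgn)
    have hi: "F (of_int (sgn d * k)) \<ge> y" and lo: "F (of_int (- (sgn d * k))) \<le> y"
      using deg_int[of 0 "sgn d * k"] deg_int[of 0 "- (sgn d * k)"] dk k sg
      by (auto simp: mult.assoc[symmetric] simp del: of_int_mult)
    have "is_interval (range F)"
      by (simp add: is_interval_connected_1 connected_continuous_image cont)
    then have "y \<in> range F"
      using hi lo unfolding is_interval_1 by blast
    then show ?thesis by auto
  qed
  then show ?thesis by (metis surjI)
qed

lemma surj_pow: "surj (F ^^ n)"
proof (induction n)
  case (Suc n) then show ?case using comp_surj[OF Suc surj] by simp
qed simp

lemma expansive:
  assumes "\<And>i. \<bar>(F ^^ i) a - (F ^^ i) b\<bar> \<le> B"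
  shows "a = b"
proof -
  have "\<bar>a - b\<bar> \<le> ct n * B" for n
    using contract[of a b n] mult_left_mono[OF assms[of n], of "ct n"] ct_pos[of n] by linarith
  moreover have "(\<lambda>n. ct n * B) \<longlonglongrightarrow> 0"
    using tendsto_mult_right[OF ct_tendsto, of B] by simp
  ultimately have "\<bar>a - b\<bar> \<le> 0"
    by (intro LIMSEQ_le_const[of "\<lambda>n. ct n * B" 0]) auto
  then show ?thesis by simp
qed

text \<open>\<open>F\<close> is a bijection of the line, so each point of the pseudo-orbit has
  exactly one pullback \<open>a n\<close> to the starting time. Consecutive pullbacks differ by one
  defect, contracted by \<open>ct 1\<close> and then by \<open>ct k\<close>; telescoping gives the
  sum. The first term compares the given orbit with the last pullback.\<close>

lemma shadow_estimate:
  assumes "\<And>i. \<bar>F (Y i) - Y (Suc i)\<bar> \<le> e i"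
  shows "\<bar>(F ^^ i) x - Y i\<bar> \<le> ct n * \<bar>(F ^^ (i + n)) x - Y (i + n)\<bar> + (\<Sum>k<n. ct k * (ct 1 * e (i + k)))"
proof -
  have *: "\<bar>t - Z 0\<bar> \<le> ct n * \<bar>(F ^^ n) t - Z n\<bar> + (\<Sum>k<n. ct k * (ct 1 * h k))"
    if h: "\<And>i. \<bar>F (Z i) - Z (Suc i)\<bar> \<le> h i" for t n and Z h :: "nat \<Rightarrow> real"
  proof -
    have "\<exists>a. \<forall>n. (F ^^ n) (a n) = Z n"
      using surj_pow by (intro choice) (metis surjD)
    then obtain a where a: "\<And>n. (F ^^ n) (a n) = Z n" by blast
    have step: "\<bar>a (Suc k) - a k\<bar> \<le> ct k * (ct 1 * h k)" for k
    proof -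
      let ?w = "(F ^^ k) (a (Suc k))"
      have "\<bar>?w - Z k\<bar> \<le> ct 1 * \<bar>F ?w - F (Z k)\<bar>" using contract[of ?w "Z k" 1] by simp
      also have "F ?w = Z (Suc k)" using a[of "Suc k"] by simp
      also have "ct 1 * \<bar>Z (Suc k) - F (Z k)\<bar> \<le> ct 1 * h k"
        using h[of k] ct_pos[of 1] by (intro mult_left_mono) (auto simp: abs_minus_commute)
      finally have "ct k * \<bar>?w - Z k\<bar> \<le> ct k * (ct 1 * h k)"
        using ct_pos[of k] by (intro mult_left_mono) auto
      then show ?thesis using contract[of "a (Suc k)" "a k" k] a[of k] by simp
    qed
    have sum: "\<bar>a n - a 0\<bar> \<le> (\<Sum>k<n. ct k * (ct 1 * h k))" for n
    proof (induction n)
      case (Suc n) then show ?case using step[of n] by simp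
    qed simp
    have "\<bar>t - a n\<bar> \<le> ct n * \<bar>(F ^^ n) t - Z n\<bar>" using contract[of t "a n" n] a by simp
    moreover have "a 0 = Z 0" using a[of 0] by simp
    ultimately show ?thesis using sum[of n] by linarith
  qed
  have "(F ^^ (i + n)) x = (F ^^ n) ((F ^^ i) x)"
    by (subst add.commute) (simp add: funpow_add)
  moreover have "\<bar>(F ^^ i) x - Y (i + 0)\<bar> \<le> ct n * \<bar>(F ^^ n) ((F ^^ i) x) - Y (i + n)\<bar> + (\<Sum>k<n. ct k * (ct 1 * e (i + k)))"
    by (rule *) (use assms in simp)
  ultimately show ?thesis by simp
qed

lemma sum_ct_mult_le:
  assumes "\<And>k. e k \<le> B" "0 \<le> B"
  shows "(\<Sum>k<n. ct k * (ct 1 * e k)) \<le> KS * B"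
proof -
  have "(\<Sum>k<n. ct k * (ct 1 * e k)) \<le> (\<Sum>k<n. ct k * (ct 1 * B))"
    using ct_pos assms by (intro sum_mono mult_left_mono) (auto simp: less_imp_le)
  also have "\<dots> = (\<Sum>k<n. ct k) * (ct 1 * B)" by (simp add: sum_distrib_right)
  also have "\<dots> \<le> KK * (ct 1 * B)"
    using sum_ct_le[of n] ct_pos[of 1] assms by (intro mult_right_mono) auto
  finally show ?thesis by (simp add: KS_def mult_ac)
qed

text \<open>Each pullback \<open>a n\<close> shadows up to time \<open>n\<close>, and the pullbacks
  form a Cauchy sequence; its limit shadows forever.\<close>

lemma shadow_exists:
  assumes Y: "\<And>i. \<bar>F (Y i) - Y (Suc i)\<bar> \<le> B"
  shows "\<exists>x. \<forall>i. \<bar>(F ^^ i) x - Y i\<bar> \<le> KS * B"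
proof -
  have B: "0 \<le> B" using Y[of 0] by linarith
  have "\<exists>a. \<forall>n. (F ^^ n) (a n) = Y n"
    using surj_pow by (intro choice) (metis surjD)
  then obtain a where a: "\<And>n. (F ^^ n) (a n) = Y n" by blast
  have est: "\<bar>(F ^^ i) (a n) - Y i\<bar> \<le> KS * B" if "i \<le> n" for i n
  proof -
    have "\<bar>(F ^^ i) (a n) - Y i\<bar> \<le> ct (n - i) * \<bar>(F ^^ (i + (n - i))) (a n) - Y (i + (n - i))\<bar>
        + (\<Sum>k<n - i. ct k * (ct 1 * B))"
      by (rule shadow_estimate) (rule Y)
    also have "\<dots> \<le> KS * B"
      using that a[of n] sum_ct_mult_le[of "\<lambda>_. B" B "n - i"] B by simp
    finally show ?thesis .
  qed
  have bd: "\<bar>a n - a m\<bar> \<le> ct m * (KS * B)" if "m \<le> n" for m n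
  proof -
    have "\<bar>a n - a m\<bar> \<le> ct m * \<bar>(F ^^ m) (a n) - Y m\<bar>" using contract[of "a n" "a m" m] a by simp
    also have "\<dots> \<le> ct m * (KS * B)" using est[OF that] ct_pos[of m] by (intro mult_left_mono) auto
    finally show ?thesis .
  qed
  have "Cauchy a"
  proof (rule metric_CauchyI)
    fix e :: real assume "0 < e"
    have "(\<lambda>m. ct m * (KS * B)) \<longlonglongrightarrow> 0" using tendsto_mult_right[OF ct_tendsto, of "KS * B"] by simp
    then have "\<forall>\<^sub>F m in sequentially. ct m * (KS * B) < e" using \<open>0 < e\<close> by (rule order_tendstoD)
    then obtain M where M: "\<And>m. m \<ge> M \<Longrightarrow> ct m * (KS * B) < e"
      by (auto simp: eventually_sequentially)
    show "\<exists>M. \<forall>m\<ge>M. \<forall>n\<ge>M. dist (a m) (a n) < e"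
    proof (intro exI allI impI)
      fix m n assume "M \<le> m" "M \<le> n"
      then show "dist (a m) (a n) < e"
        using bd[of m n] bd[of n m] M[of m] M[of n] unfolding dist_real_def
        by (cases "m \<le> n") (auto simp: abs_minus_commute)
    qed
  qed
  then obtain x where x: "a \<longlonglongrightarrow> x" by (meson Cauchy_convergent convergentD)
  have "\<bar>(F ^^ i) x - Y i\<bar> \<le> KS * B" for i
  proof (rule LIMSEQ_le_const2)
    have "isCont (F ^^ i) x" using DERIV_pow DERIV_isCont by blast
    then have "(\<lambda>n. (F ^^ i) (a n)) \<longlonglongrightarrow> (F ^^ i) x"
      using x by (rule isCont_tendsto_compose)
    then show "(\<lambda>n. \<bar>(F ^^ i) (a n) - Y i\<bar>) \<longlonglongrightarrow> \<bar>(F ^^ i) x - Y i\<bar>"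
      by (intro tendsto_rabs tendsto_diff tendsto_const)
    show "\<exists>N. \<forall>n\<ge>N. \<bar>(F ^^ i) (a n) - Y i\<bar> \<le> KS * B" using est by blast
  qed
  then show ?thesis by blast
qed

text \<open>The gain over \<open>shadow_exists\<close> is that the action is controlled by the sum
  of the defects, not by the period times the largest one: summing the pointwise estimate over a
  period and exchanging sums, every defect gets total weight at most \<open>KS\<close>.\<close>

lemma periodic_shadow:
  fixes y e :: "nat \<Rightarrow> real" and s :: "nat \<Rightarrow> int"
  assumes q: "0 < q" and G: "periodic1 G" "LG-lipschitz_on UNIV G"
    and e: "\<And>l. l < q \<Longrightarrow> \<bar>F (y l) - of_int (s l) - y (Suc l mod q)\<bar> \<le> e l"
  shows "\<exists>x. (F ^^ q) x - x \<in> \<int> \<and> bsum F G q x \<le> (\<Sum>l<q. G (y l)) + LG * KS * (\<Sum>l<q. e l)"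
proof -
  \<comment> \<open>\<open>M\<close> collects the integers by which the closed pseudo-orbit on the
    circle unwinds to a pseudo-orbit \<open>Y\<close> on the line; since \<open>F\<close> has degree
    \<open>d\<close>, the shift after \<open>q\<close> more steps is
    \<open>d ^ i * M q\<close>.\<close>
  define M :: "nat \<Rightarrow> int" where "M = rec_nat 0 (\<lambda>i m. d * m + s (i mod q))"
  have M0: "M 0 = 0" and MS: "M (Suc i) = d * M i + s (i mod q)" for i by (simp_all add: M_def)
  have Mq: "M (i + q) = M i + d ^ i * M q" for i
    by (induction i) (simp_all add: M0 MS algebra_simps)
  define Y where "Y i = y (i mod q) + of_int (M i)" for i
  define E where "E i = e (i mod q)" for i
  have YE: "\<bar>F (Y i) - Y (Suc i)\<bar> \<le> E i" for i
  proof -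
    have "Y (Suc i) = y (Suc (i mod q) mod q) + of_int (d * M i + s (i mod q))"
      by (simp add: Y_def MS mod_Suc_eq)
    then show ?thesis using e[of "i mod q"] q deg_int[of "y (i mod q)" "M i"] by (simp add: Y_def E_def)
  qed
  have e0: "0 \<le> e l" if "l < q" for l using e[OF that] by linarith
  define B where "B = (\<Sum>l<q. e l)"
  have EB: "E i \<le> B" for i
    unfolding B_def E_def using q e0 by (intro member_le_sum) auto
  have YB: "\<bar>F (Y i) - Y (Suc i)\<bar> \<le> B" for i using YE[of i] EB[of i] by linarith
  have B0: "0 \<le> B" unfolding B_def using e0 by (intro sum_nonneg) auto
  obtain x where x: "\<And>i. \<bar>(F ^^ i) x - Y i\<bar> \<le> KS * B" using shadow_exists[where Y=Y, OF YB] by blast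
  \<comment> \<open>Both points have orbits within bounded distance of the same shifted
    pseudo-orbit, so expansivity identifies them.\<close>
  have "(F ^^ q) x = x + of_int (M q)"
  proof (rule expansive)
    fix i
    have 1: "(F ^^ i) ((F ^^ q) x) = (F ^^ (i + q)) x" by (simp add: funpow_add)
    have 2: "(F ^^ i) (x + of_int (M q)) = (F ^^ i) x + of_int (d ^ i * M q)" by (rule deg_pow)
    have "Y (i + q) = Y i + of_int (d ^ i * M q)" by (simp add: Y_def Mq)
    then show "\<bar>(F ^^ i) ((F ^^ q) x) - (F ^^ i) (x + of_int (M q))\<bar> \<le> 2 * (KS * B)"
      unfolding 1 2 using x[of "i + q"] x[of i] by linarith
  qed
  then have per: "(F ^^ q) x - x \<in> \<int>" by simp
  have shift: "(\<Sum>l<q. E (l + k)) = B" for k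
  proof (induction k)
    case 0 show ?case by (simp add: E_def B_def)
  next
    case (Suc k)
    have "(\<Sum>l<q. E (l + Suc k)) = (\<Sum>l<q. E (Suc l + k))" by simp
    also have "\<dots> = (\<Sum>l<Suc q. E (l + k)) - E k"
      by (simp add: sum.lessThan_Suc_shift del: sum.lessThan_Suc)
    also have "\<dots> = (\<Sum>l<q. E (l + k))" by (simp add: E_def)
    finally show ?case using Suc by simp
  qed
  \<comment> \<open>For every \<open>n\<close> the bound holds up to a term with the factor
    \<open>ct n\<close>; letting \<open>n\<close> grow removes it.\<close>
  have sumd: "(\<Sum>l<q. \<bar>(F ^^ l) x - Y l\<bar>) \<le> KS * B"
  proof (rule LIMSEQ_le_const)
    show "(\<lambda>n. ct n * (q * (KS * B)) + KS * B) \<longlonglongrightarrow> KS * B"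
      using tendsto_add[OF tendsto_mult_right[OF ct_tendsto, of "q * (KS * B)"] tendsto_const[of "KS * B"]] by simp
    have "(\<Sum>l<q. \<bar>(F ^^ l) x - Y l\<bar>) \<le> ct n * (q * (KS * B)) + KS * B" for n
    proof -
      have "(\<Sum>l<q. \<bar>(F ^^ l) x - Y l\<bar>) \<le> (\<Sum>l<q. ct n * (KS * B) + (\<Sum>k<n. ct k * (ct 1 * E (l + k))))"
      proof (rule sum_mono)
        fix l
        have "ct n * \<bar>(F ^^ (l + n)) x - Y (l + n)\<bar> \<le> ct n * (KS * B)"
          using x ct_pos[of n] by (intro mult_left_mono) auto
        then show "\<bar>(F ^^ l) x - Y l\<bar> \<le> ct n * (KS * B) + (\<Sum>k<n. ct k * (ct 1 * E (l + k)))"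
          using shadow_estimate[where Y=Y and e=E, OF YE, of l x n] by linarith
      qed
      also have "\<dots> = ct n * (q * (KS * B)) + (\<Sum>l<q. \<Sum>k<n. ct k * (ct 1 * E (l + k)))"
        by (simp add: sum.distrib)
      also have "(\<Sum>l<q. \<Sum>k<n. ct k * (ct 1 * E (l + k))) = (\<Sum>k<n. ct k * (ct 1 * (\<Sum>l<q. E (l + k))))"
        by (subst sum.swap) (simp add: sum_distrib_left)
      also have "\<dots> = (\<Sum>k<n. ct k * (ct 1 * B))" by (simp add: shift)
      also have "\<dots> \<le> KS * B" using sum_ct_mult_le[of "\<lambda>_. B" B n] B0 by simp
      finally show ?thesis by simp
    qed
    then show "\<exists>N. \<forall>n\<ge>N. (\<Sum>l<q. \<bar>(F ^^ l) x - Y l\<bar>) \<le> ct n * (q * (KS * B)) + KS * B" by blast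
  qed
  have LG0: "0 \<le> LG" using G(2) by (rule lipschitz_on_nonneg)
  have "bsum F G q x \<le> (\<Sum>l<q. G (y l) + LG * \<bar>(F ^^ l) x - Y l\<bar>)"
    unfolding bsum_def
  proof (rule sum_mono)
    fix l assume "l \<in> {..<q}"
    then have "G (Y l) = G (y l)" using periodic1_int[OF G(1)] by (simp add: Y_def)
    then show "G ((F ^^ l) x) \<le> G (y l) + LG * \<bar>(F ^^ l) x - Y l\<bar>"
      using lipschitz_realD[OF G(2), of "(F ^^ l) x" "Y l"] by linarith
  qed
  also have "\<dots> = (\<Sum>l<q. G (y l)) + LG * (\<Sum>l<q. \<bar>(F ^^ l) x - Y l\<bar>)"
    by (simp add: sum.distrib sum_distrib_left)
  also have "\<dots> \<le> (\<Sum>l<q. G (y l)) + LG * (KS * B)"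
    using sumd LG0 by (intro add_left_mono mult_left_mono)
  finally show ?thesis using per unfolding B_def by (auto simp: mult.assoc)
qed

lemma bsum_periodic1: "periodic1 f \<Longrightarrow> periodic1 (bsum F f n)"
  unfolding periodic1_def bsum_def
proof (intro allI sum.cong refl)
  fix x i assume "\<forall>x. f (x + 1) = f x"
  then have "periodic1 f" by (simp add: periodic1_def)
  then show "f ((F ^^ i) (x + 1)) = f ((F ^^ i) x)"
    using deg_pow[of i x 1] periodic1_int[of f "(F ^^ i) x" "d ^ i"] by simp
qed

text \<open>Seen backwards from time \<open>n\<close> the two orbits approach each other
  geometrically, so the differences sum to a multiple of the final distance, with a factor
  independent of \<open>n\<close>.\<close>

lemma distortion:
  assumes "K-lipschitz_on UNIV f"
  shows "\<bar>bsum F f n a - bsum F f n b\<bar> \<le> K * KK * \<bar>(F ^^ n) a - (F ^^ n) b\<bar>"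
proof -
  have K: "0 \<le> K" using assms by (rule lipschitz_on_nonneg)
  have r: "(\<Sum>i<n. ct (n - i)) \<le> KK"
  proof -
    have "(\<Sum>i<n. ct (n - i)) = (\<Sum>i<n. ct (Suc i))"
      by (rule sum.reindex_bij_witness[of _ "\<lambda>i. n - Suc i" "\<lambda>i. n - Suc i"]) (auto simp: Suc_diff_Suc)
    also have "\<dots> \<le> (\<Sum>i<Suc n. ct i)"
      by (subst sum.lessThan_Suc_shift) (simp add: ct_pos less_imp_le)
    finally show ?thesis using sum_ct_le[of "Suc n"] by linarith
  qed
  have "\<bar>bsum F f n a - bsum F f n b\<bar> \<le> (\<Sum>i<n. \<bar>f ((F ^^ i) a) - f ((F ^^ i) b)\<bar>)"
    unfolding bsum_def sum_subtractf[symmetric] by (rule sum_abs)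
  also have "\<dots> \<le> (\<Sum>i<n. K * (ct (n - i) * \<bar>(F ^^ n) a - (F ^^ n) b\<bar>))"
  proof (rule sum_mono)
    fix i assume "i \<in> {..<n}"
    then have "K * \<bar>(F ^^ i) a - (F ^^ i) b\<bar> \<le> K * (ct (n - i) * \<bar>(F ^^ n) a - (F ^^ n) b\<bar>)"
      using K contract_between[of i n a b] by (intro mult_left_mono) auto
    then show "\<bar>f ((F ^^ i) a) - f ((F ^^ i) b)\<bar> \<le> K * (ct (n - i) * \<bar>(F ^^ n) a - (F ^^ n) b\<bar>)"
      using lipschitz_realD[OF assms, of "(F ^^ i) a" "(F ^^ i) b"] by linarith
  qed
  also have "\<dots> = K * (\<Sum>i<n. ct (n - i)) * \<bar>(F ^^ n) a - (F ^^ n) b\<bar>"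
    by (simp add: sum_distrib_left sum_distrib_right mult_ac)
  also have "\<dots> \<le> K * KK * \<bar>(F ^^ n) a - (F ^^ n) b\<bar>"
    using r K by (intro mult_right_mono mult_left_mono) auto
  finally show ?thesis .
qed

end

section \<open>The potential \<open>phi\<close> of an expanding lift, minimal averages and
  subactions\<close>

lemma lipschitz_from_deriv:
  fixes f f' :: "real \<Rightarrow> real"
  assumes "\<And>x. (f has_real_derivative f' x) (at x)" "\<And>x. \<bar>f' x\<bar> \<le> K"
  shows "K-lipschitz_on UNIV f"
proof (rule lipschitz_realI)
  have *: "\<bar>f x - f y\<bar> \<le> K * \<bar>x - y\<bar>" if xy: "x < y" for x y
  proof -
    obtain z where "f y - f x = (y - x) * f' z" using MVT2[OF xy assms(1)] by blast
    then have "\<bar>f x - f y\<bar> = \<bar>f' z\<bar> * \<bar>x - y\<bar>" using xy by (subst abs_minus_commute) (simp add: abs_mult)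
    then show ?thesis using assms(2)[of z] by (simp add: mult_right_mono)
  qed
  show "\<bar>f x - f y\<bar> \<le> K * \<bar>x - y\<bar>" for x y
    using *[of x y] *[of y x] by (cases x y rule: linorder_cases) (auto simp: abs_minus_commute)
  show "0 \<le> K" using assms(2)[of 0] by linarith
qed

lemma ln_diff_le:
  fixes a b m :: real
  assumes "0 < m" "m \<le> a" "m \<le> b" shows "\<bar>ln a - ln b\<bar> \<le> \<bar>a - b\<bar> / m"
proof -
  have *: "ln x - ln y \<le> \<bar>x - y\<bar> / m" if "m \<le> x" "m \<le> y" for x y
  proof -
    have "ln x - ln y = ln (x / y)" using that assms by (simp add: ln_div)
    also have "\<dots> \<le> x / y - 1" using that assms by (intro ln_le_minus_one) auto
    also have "\<dots> = (x - y) / y" using that assms by (simp add: field_simps)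
    also have "\<dots> \<le> \<bar>x - y\<bar> / y" using that assms by (intro divide_right_mono) auto
    also have "\<dots> \<le> \<bar>x - y\<bar> / m" using that assms by (intro divide_left_mono) auto
    finally show ?thesis .
  qed
  show ?thesis using *[of a b] *[of b a] assms by (simp add: abs_minus_commute abs_le_iff)
qed

lemma periodic1_deriv:
  fixes g g' :: "real \<Rightarrow> real"
  assumes "\<And>x. (g has_real_derivative g' x) (at x)" "periodic1 g"
  shows "periodic1 g'"
  unfolding periodic1_def
proof
  fix x
  have "((\<lambda>x. g (x + 1)) has_real_derivative g' (x + 1)) (at x)"
    using assms(1)[of "x + 1"] by (simp add: DERIV_shift)
  then have "(g has_real_derivative g' (x + 1)) (at x)" using assms(2) by (simp add: periodic1_def)
  then show "g' (x + 1) = g' x" using assms(1)[of x] by (rule DERIV_unique)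
qed

context expanding_lift begin

definition phi :: "real \<Rightarrow> real" where "phi x = ln \<bar>deriv F x\<bar>"
definition MD :: real where "MD = \<bar>deriv F 0\<bar> + L"

lemma deriv_periodic: "periodic1 (deriv F)"
proof -
  have "((\<lambda>x. F x - of_int d * x) has_real_derivative (deriv F x - of_int d)) (at x)" for x
    using DERIV_diff[OF DERIV[of x] DERIV_cmult_Id[of "of_int d"]] by simp
  then have "periodic1 (\<lambda>x. deriv F x - of_int d)"
    by (rule periodic1_deriv) (simp add: periodic1_def deg algebra_simps)
  then show ?thesis by (simp add: periodic1_def)
qed

lemma L_nonneg: "0 \<le> L" using lip by (rule lipschitz_on_nonneg)

lemma deriv_lower: "C * lam \<le> \<bar>deriv F x\<bar>"
  using exp_prod[of 1 x] by simp

lemma Clam_pos: "0 < C * lam" using C_pos lam by simp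

lemma deriv_upper: "\<bar>deriv F x\<bar> \<le> MD"
proof -
  have "\<bar>deriv F (frac x) - deriv F 0\<bar> \<le> L * \<bar>frac x - 0\<bar>" by (rule lipschitz_realD[OF lip])
  also have "\<dots> \<le> L * 1" using L_nonneg frac_lt_1[of x] by (intro mult_left_mono) auto
  finally show ?thesis using periodic1_frac[OF deriv_periodic, of x] unfolding MD_def by simp
qed

lemma MD_pos: "0 < MD" using deriv_lower[of 0] deriv_upper[of 0] Clam_pos by linarith

lemma F_lip: "MD-lipschitz_on UNIV F"
  by (rule lipschitz_from_deriv[OF DERIV deriv_upper])

lemma F_pow_lip: "\<bar>(F ^^ n) x - (F ^^ n) y\<bar> \<le> MD ^ n * \<bar>x - y\<bar>"
proof (induction n)
  case (Suc n)
  have "\<bar>(F ^^ Suc n) x - (F ^^ Suc n) y\<bar> \<le> MD * \<bar>(F ^^ n) x - (F ^^ n) y\<bar>"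
    using lipschitz_realD[OF F_lip] by simp
  also have "\<dots> \<le> MD * (MD ^ n * \<bar>x - y\<bar>)" using Suc MD_pos by (intro mult_left_mono) auto
  finally show ?case by (simp add: mult.assoc)
qed simp

lemma phi_periodic: "periodic1 phi"
  using deriv_periodic by (simp add: periodic1_def phi_def)

definition Lphi :: real where "Lphi = L / (C * lam)"

lemma phi_lip: "Lphi-lipschitz_on UNIV phi"
proof (rule lipschitz_realI)
  fix x y
  have "\<bar>phi x - phi y\<bar> \<le> \<bar>\<bar>deriv F x\<bar> - \<bar>deriv F y\<bar>\<bar> / (C * lam)"
    unfolding phi_def by (rule ln_diff_le[OF Clam_pos deriv_lower deriv_lower])
  also have "\<dots> \<le> (L * \<bar>x - y\<bar>) / (C * lam)"
    using lipschitz_realD[OF lip, of x y] Clam_pos by (intro divide_right_mono) auto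
  finally show "\<bar>phi x - phi y\<bar> \<le> Lphi * \<bar>x - y\<bar>" by (simp add: Lphi_def)
next
  show "0 \<le> Lphi" using L_nonneg Clam_pos by (simp add: Lphi_def)
qed

lemma sgn_const: "(\<forall>x. 0 < deriv F x) \<or> (\<forall>x. deriv F x < 0)"
proof (rule ccontr)
  assume "\<not> ?thesis"
  then obtain x y where xy: "deriv F x \<le> 0" "0 \<le> deriv F y" by (force simp: not_less)
  have "is_interval (range (deriv F))"
    by (simp add: is_interval_connected_1 connected_continuous_image lipschitz_on_continuous_on[OF lip])
  then have "0 \<in> range (deriv F)" using xy unfolding is_interval_1 by blast
  then obtain z where "deriv F z = 0" by auto
  then show False using deriv_lower[of z] Clam_pos by simp
qed

text \<open>\<open>F ^^ n\<close> is onto the line, and an integer shift brings \<open>y\<close>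
  next to \<open>(F ^^ n) x\<close>. So an orbit segment of \<open>x\<close> can be continued by the
  orbit of \<open>y\<close> at the cost of bounded distortion.\<close>

lemma glue:
  shows "\<exists>w. (F ^^ n) w - y \<in> \<int> \<and> \<bar>(F ^^ n) w - (F ^^ n) x\<bar> \<le> 1"
proof -
  obtain w where "(F ^^ n) w = y + of_int \<lfloor>(F ^^ n) x - y\<rfloor>" using surj_pow surjD by metis
  then show ?thesis by (intro exI[of _ w]) (simp, linarith)
qed

text \<open>The infima \<open>m n\<close> of the Birkhoff sums are superadditive and, by gluing,
  subadditive up to the distortion constant. Hence \<open>m n\<close> stays within bounded distance
  of \<open>n * \<alpha>\<close>, which is stronger than convergence of the averages.\<close>

lemma ergodic_min:
  assumes "periodic1 f" "K-lipschitz_on UNIV f"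
  shows "\<exists>\<alpha> B. (\<forall>n x. n * \<alpha> - B \<le> bsum F f n x) \<and> (\<forall>n. \<exists>x. bsum F f n x \<le> n * \<alpha> + 1)"
proof -
  obtain Bf where Bf: "\<And>x. \<bar>f x\<bar> \<le> Bf"
    using periodic1_bounded[OF assms(1) lipschitz_on_continuous_on[OF assms(2)]] by blast
  define m where "m n = (INF x. bsum F f n x)" for n
  have lb: "- (n * Bf) \<le> bsum F f n x" for n x
  proof -
    have "(\<Sum>i<n. - Bf) \<le> bsum F f n x" unfolding bsum_def
      by (intro sum_mono) (use Bf in \<open>simp add: abs_le_iff minus_le_iff\<close>)
    then show ?thesis by simp
  qed
  have ub: "bsum F f n x \<le> n * Bf" for n x
  proof -
    have "bsum F f n x \<le> (\<Sum>i<n. Bf)" unfolding bsum_def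
      by (intro sum_mono) (use Bf in \<open>simp add: abs_le_iff\<close>)
    then show ?thesis by simp
  qed
  have bdd: "bdd_below (range (bsum F f n))" for n using lb by (auto intro!: bdd_belowI)
  have m_le: "m n \<le> bsum F f n x" for n x unfolding m_def by (rule cINF_lower[OF bdd]) auto
  have m_ge: "c \<le> m n" if "\<And>x. c \<le> bsum F f n x" for c n
    unfolding m_def by (rule cINF_greatest) (use that in auto)
  have m_near: "\<exists>x. bsum F f n x < m n + e" if "0 < e" for n e
    using m_ge[of "m n + e" n] that by (force simp: not_less)
  have sup: "m n + m k \<le> m (n + k)" for n k
    by (rule m_ge) (use m_le[of n] m_le[of k] in \<open>auto simp: bsum_add intro: add_mono\<close>)
  define D where "D = K * KK"
  have sub: "m (n + k) \<le> m n + m k + D" for n k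
  proof (rule field_le_epsilon)
    fix e :: real assume e: "0 < e"
    obtain x y where x: "bsum F f n x < m n + e / 2" and y: "bsum F f k y < m k + e / 2"
      using m_near[of "e/2"] e by (meson half_gt_zero)
    obtain w where w: "(F ^^ n) w - y \<in> \<int>" "\<bar>(F ^^ n) w - (F ^^ n) x\<bar> \<le> 1" using glue by blast
    have "bsum F f k ((F ^^ n) w) = bsum F f k y"
      by (rule periodic1_diff_int[OF bsum_periodic1[OF assms(1)] w(1)])
    moreover have "\<bar>bsum F f n w - bsum F f n x\<bar> \<le> D * \<bar>(F ^^ n) w - (F ^^ n) x\<bar>"
      unfolding D_def by (rule distortion[OF assms(2)])
    moreover have "D * \<bar>(F ^^ n) w - (F ^^ n) x\<bar> \<le> D * 1"
      unfolding D_def using w(2) lipschitz_on_nonneg[OF assms(2)] KK_pos by (intro mult_left_mono) auto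
    moreover have "m (n + k) \<le> bsum F f n w + bsum F f k ((F ^^ n) w)"
      using m_le[of "n + k" w] by (simp add: bsum_add)
    ultimately show "m (n + k) \<le> m n + m k + D + e" using x y by linarith
  qed
  have m0: "m 0 = 0" unfolding m_def by simp
  have mulsup: "j * m n \<le> m (j * n)" for j n :: nat
  proof (induction j)
    case (Suc j) then show ?case using sup[of n "j * n"] by (simp add: algebra_simps)
  qed (simp add: m0)
  have mulsub: "m (j * n) \<le> j * (m n + D)" for j n :: nat
  proof (induction j)
    case (Suc j) then show ?case using sub[of n "j * n"] by (simp add: algebra_simps)
  qed (simp add: m0)
  define \<alpha> where "\<alpha> = (SUP n. m (Suc n) / real (Suc n))"
  have cmp: "m (Suc N) / real (Suc N) \<le> (m (Suc n) + D) / real (Suc n)" for n N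
  proof -
    have "real (Suc n) * m (Suc N) \<le> m (Suc n * Suc N)" by (rule mulsup)
    also have "\<dots> \<le> real (Suc N) * (m (Suc n) + D)" using mulsub[of "Suc N" "Suc n"] by (simp only: mult.commute)
    finally show ?thesis by (simp add: field_simps del: of_nat_Suc)
  qed
  have bddA: "bdd_above (range (\<lambda>n. m (Suc n) / real (Suc n)))"
    using cmp[of _ 0] by (auto intro!: bdd_aboveI)
  have A1: "m (Suc n) \<le> Suc n * \<alpha>" for n
    using cSUP_upper[OF UNIV_I bddA, of n] unfolding \<alpha>_def by (simp add: field_simps del: of_nat_Suc)
  have A2: "Suc n * \<alpha> \<le> m (Suc n) + D" for n
  proof -
    have "\<alpha> \<le> (m (Suc n) + D) / real (Suc n)" unfolding \<alpha>_def by (rule cSUP_least) (use cmp in auto)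
    then show ?thesis by (simp add: field_simps del: of_nat_Suc)
  qed
  have D0: "0 \<le> D" unfolding D_def using lipschitz_on_nonneg[OF assms(2)] KK_pos by simp
  have "n * \<alpha> - D \<le> bsum F f n x" for n x
    using A2[of "n - 1"] m_le[of n x] D0 by (cases n) auto
  moreover have "\<exists>x. bsum F f n x \<le> n * \<alpha> + 1" for n
  proof -
    obtain x where x: "bsum F f n x < m n + 1" using m_near[of 1 n] by auto
    have "m n \<le> n * \<alpha>" using A1[of "n - 1"] m0 by (cases n) auto
    then show ?thesis using x by (intro exI[of _ x]) linarith
  qed
  ultimately show ?thesis by blast
qed

text \<open>\<open>u x\<close> is the cheapest normalised cost of arriving at \<open>x\<close>, over
  preimages of all orders. Going on by one step gives the inequality; pairing preimages of nearby
  points and applying \<open>distortion\<close> gives the Lipschitz bound.\<close>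

lemma subaction_exists:
  assumes f: "periodic1 f" "K-lipschitz_on UNIV f"
  shows "\<exists>\<alpha> u Lu. periodic1 u \<and> Lu-lipschitz_on UNIV u \<and> (\<forall>x. u (F x) \<le> u x + f x - \<alpha>)
    \<and> (\<forall>n. \<exists>x. bsum F f n x \<le> n * \<alpha> + 1)"
proof -
  obtain \<alpha> B where A: "\<And>n x. n * \<alpha> - B \<le> bsum F f n x" and A2: "\<And>n. \<exists>x. bsum F f n x \<le> n * \<alpha> + 1"
    using ergodic_min[OF f] by blast
  define S where "S x = {bsum F f n y - n * \<alpha> | n y. (F ^^ n) y - x \<in> \<int>}" for x
  define u where "u x = Inf (S x)" for x
  have bdd: "bdd_below (S x)" for x
  proof (rule bdd_belowI[of _ "- B"])
    fix t assume "t \<in> S x"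
    then obtain n y where "t = bsum F f n y - n * \<alpha>" by (auto simp: S_def)
    then show "- B \<le> t" using A[of n y] by simp
  qed
  have ne: "S x \<noteq> {}" for x
  proof -
    have "bsum F f 0 x - 0 * \<alpha> \<in> S x" unfolding S_def by (rule CollectI, rule exI[of _ 0], rule exI[of _ x]) auto
    then show ?thesis by blast
  qed
  have "S (x + 1) = S x" for x
  proof -
    have "t - (x + 1) \<in> \<int> \<longleftrightarrow> t - x \<in> \<int>" for t :: real
    proof -
      have "t - x = (t - (x + 1)) + 1" by simp
      then show ?thesis by (metis Ints_1 Ints_add Ints_diff add_diff_cancel_right')
    qed
    then show ?thesis by (simp add: S_def)
  qed
  then have per: "periodic1 u" by (simp add: periodic1_def u_def)
  have half: "u x \<le> u x' + K * KK * \<bar>x - x'\<bar>" for x x'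
  proof -
    have "u x - K * KK * \<bar>x - x'\<bar> \<le> u x'"
      unfolding u_def[of x']
    proof (rule cInf_greatest[OF ne])
      fix t assume "t \<in> S x'"
      then obtain n y where t: "t = bsum F f n y - n * \<alpha>" and y: "(F ^^ n) y - x' \<in> \<int>" by (auto simp: S_def)
      obtain w where w: "(F ^^ n) w = (F ^^ n) y - x' + x" using surj_pow surjD by metis
      have "bsum F f n w - n * \<alpha> \<in> S x" using w y unfolding S_def by (intro CollectI exI conjI) auto
      then have "u x \<le> bsum F f n w - n * \<alpha>" unfolding u_def by (rule cInf_lower[OF _ bdd])
      moreover have "\<bar>bsum F f n w - bsum F f n y\<bar> \<le> K * KK * \<bar>(F ^^ n) w - (F ^^ n) y\<bar>"
        by (rule distortion[OF f(2)])
      ultimately show "u x - K * KK * \<bar>x - x'\<bar> \<le> t" using t w by simp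
    qed
    then show ?thesis by simp
  qed
  have "(K * KK)-lipschitz_on UNIV u"
  proof (rule lipschitz_realI)
    show "\<bar>u x - u y\<bar> \<le> K * KK * \<bar>x - y\<bar>" for x y
      using half[of x y] half[of y x] by (simp add: abs_minus_commute abs_le_iff)
    show "0 \<le> K * KK" using lipschitz_on_nonneg[OF f(2)] KK_pos by simp
  qed
  moreover have "u (F x) \<le> u x + f x - \<alpha>" for x
  proof -
    have "u (F x) - f x + \<alpha> \<le> u x"
      unfolding u_def[of x]
    proof (rule cInf_greatest[OF ne])
      fix t assume "t \<in> S x"
      then obtain n y where t: "t = bsum F f n y - n * \<alpha>" and y: "(F ^^ n) y - x \<in> \<int>" by (auto simp: S_def)
      have "(F ^^ Suc n) y - F x \<in> \<int>" using deg_pow_diff[OF y, of 1] by simp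
      then have "bsum F f (Suc n) y - Suc n * \<alpha> \<in> S (F x)" unfolding S_def by blast
      then have "u (F x) \<le> bsum F f (Suc n) y - Suc n * \<alpha>" unfolding u_def by (rule cInf_lower[OF _ bdd])
      moreover have "f ((F ^^ n) y) = f x" by (rule periodic1_diff_int[OF f(1) y])
      ultimately show "u (F x) - f x + \<alpha> \<le> t" using t by (simp add: bsum_Suc algebra_simps)
    qed
    then show ?thesis by simp
  qed
  ultimately show ?thesis using per A2 by blast
qed

text \<open>If the minimum of some \<open>bsum F G n\<close> were positive, the sums over
  \<open>k * n\<close> steps would exceed \<open>B\<close> for large \<open>k\<close>. So the zero
  sets of these sums are nonempty; being nested and compact they share a point.\<close>

lemma zero_orbit_exists:
  assumes G: "periodic1 G" "continuous_on UNIV G" "\<And>x. 0 \<le> G x"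
    and B: "\<And>n. \<exists>x. bsum F G n x \<le> B"
  shows "\<exists>x\<in>{0..<1}. \<forall>i. G ((F ^^ i) x) = 0"
proof -
  have contb: "continuous_on S (bsum F G n)" for S n
    unfolding bsum_def
    by (intro continuous_intros continuous_on_compose2[OF G(2) cont_pow]) auto
  define Kn where "Kn n = {0..1} \<inter> bsum F G n -` {0}" for n
  have cmp: "compact (Kn n)" for n
    unfolding Kn_def by (intro compact_Int_closed compact_Icc closed_vimage contb closed_singleton)
  have nn: "0 \<le> bsum F G n x" for n x unfolding bsum_def using G(3) by (intro sum_nonneg) auto
  have ne: "Kn n \<noteq> {}" for n
  proof -
    obtain x where x: "x \<in> {0..1}" "\<And>y. y \<in> {0..1} \<Longrightarrow> bsum F G n x \<le> bsum F G n y"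
      using continuous_attains_inf[OF compact_Icc _ contb, of 0 1 n] by auto
    have mn: "bsum F G n x \<le> bsum F G n y" for y
      using x(2)[of "frac y"] periodic1_frac[OF bsum_periodic1[OF G(1)], of n y] frac_lt_1[of y] by simp
    have mul: "k * bsum F G n x \<le> bsum F G (k * n) y" for k :: nat and y
    proof (induction k)
      case (Suc k)
      have "bsum F G (Suc k * n) y = bsum F G (k * n) y + bsum F G n ((F ^^ (k * n)) y)"
        using bsum_add[of F G "k * n" n y] by (simp add: add.commute)
      then show ?case using Suc mn[of "(F ^^ (k * n)) y"] by (simp add: algebra_simps)
    qed simp
    have "bsum F G n x = 0"
    proof (rule ccontr)
      assume "\<not> ?thesis"
      then have pos: "0 < bsum F G n x" using nn[of n x] by simp
      obtain k :: nat where k: "B < k * bsum F G n x" using reals_Archimedean3[OF pos] by blast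
      show False using B[of "k * n"] mul[of k] k by (metis not_le order_trans)
    qed
    then show ?thesis using x(1) unfolding Kn_def by auto
  qed
  have dec: "Kn n \<subseteq> Kn m" if "m \<le> n" for m n
  proof
    fix x assume x: "x \<in> Kn n"
    have "bsum F G n x = bsum F G m x + bsum F G (n - m) ((F ^^ m) x)" using bsum_add[of F G m "n - m" x] that by simp
    then show "x \<in> Kn m" using x nn[of m x] nn[of "n - m" "(F ^^ m) x"] by (auto simp: Kn_def)
  qed
  have "(\<Inter>n. Kn n) \<noteq> {}"
    by (rule compact_nest[OF cmp ne]) (use dec in auto)
  then obtain x where x: "\<And>n. bsum F G n x = 0" by (auto simp: Kn_def)
  have "G ((F ^^ i) x) = 0" for i using x[of i] x[of "Suc i"] by (simp add: bsum_Suc)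
  moreover have "G ((F ^^ i) (frac x)) = G ((F ^^ i) x)" for i
    by (rule periodic1_diff_int[OF G(1) deg_pow_diff]) (simp add: frac_def)
  ultimately show ?thesis using frac_lt_1[of x] frac_ge_0[of x] by (intro bexI[of _ "frac x"]) auto
qed

end

subsection \<open>Periodic orbits with small action\<close>

definition closed_walk :: "('a \<Rightarrow> 'a \<Rightarrow> bool) \<Rightarrow> 'a set \<Rightarrow> nat \<Rightarrow> (nat \<Rightarrow> 'a) \<Rightarrow> bool" where
  "closed_walk E V l c \<longleftrightarrow> 0 < l \<and> (\<forall>i<l. c i \<in> V \<and> E (c i) (c (Suc i mod l)))"

definition walks :: "('a \<Rightarrow> 'a \<Rightarrow> bool) \<Rightarrow> 'a set \<Rightarrow> nat \<Rightarrow> 'a list set" where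
  "walks E V k = {xs. set xs \<subseteq> V \<and> length xs = k \<and> (\<forall>i. Suc i < k \<longrightarrow> E (xs ! i) (xs ! Suc i))}"

text \<open>The piece of a walk between two visits to a vertex is a closed walk shorter than
  \<open>k\<close>; the bound \<open>2 * k\<close> is the one suited to the next lemma, where two
  such pieces are joined.\<close>

lemma walks_distinct:
  assumes no: "\<And>l c. l \<le> 2 * k \<Longrightarrow> \<not> closed_walk E V l c" and xs: "xs \<in> walks E V k"
  shows "distinct xs"
proof (rule ccontr)
  have len: "length xs = k" and V: "set xs \<subseteq> V" and E: "\<And>i. Suc i < k \<Longrightarrow> E (xs ! i) (xs ! Suc i)"
    using xs by (auto simp: walks_def)
  assume "\<not> distinct xs"
  then obtain i j where ij: "i < j" "j < k" "xs ! i = xs ! j"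
    by (metis len distinct_conv_nth linorder_neqE_nat)
  have "closed_walk E V (j - i) (\<lambda>t. xs ! (i + t))"
    unfolding closed_walk_def
  proof (intro conjI allI impI)
    fix t assume t: "t < j - i"
    show "xs ! (i + t) \<in> V" using V len t ij by (auto intro!: subsetD[OF V])
    show "E (xs ! (i + t)) (xs ! (i + Suc t mod (j - i)))"
    proof (cases "Suc t = j - i")
      case True
      then have "Suc (i + t) = j" using ij by simp
      then show ?thesis using True E[of "i + t"] ij by auto
    next
      case False
      then show ?thesis using t E[of "i + t"] ij by auto
    qed
  qed (use ij in auto)
  then show False using no[of "j - i"] ij by auto
qed

text \<open>Two different walks with the same vertices pass some pair of vertices in opposite orders;
  the piece of the first walk from one vertex to the other followed by the piece of the second walk
  back is a closed walk.\<close>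

lemma walks_determined_by_set:
  assumes no: "\<And>l c. l \<le> 2 * k \<Longrightarrow> \<not> closed_walk E V l c"
  shows "inj_on set (walks E V k)"
proof (rule inj_onI)
  fix xs ys assume xs: "xs \<in> walks E V k" and ys: "ys \<in> walks E V k" and eq: "set xs = set ys"
  have len: "length xs = k" "length ys = k" and V: "set xs \<subseteq> V"
    and Ex: "\<And>i. Suc i < k \<Longrightarrow> E (xs ! i) (xs ! Suc i)" and Ey: "\<And>i. Suc i < k \<Longrightarrow> E (ys ! i) (ys ! Suc i)"
    using xs ys by (auto simp: walks_def)
  have dx: "distinct xs" and dy: "distinct ys" using walks_distinct[OF no] xs ys by auto
  \<comment> \<open>At the first disagreement \<open>bs ! i\<close> cannot occur earlier in
    \<open>as\<close>, since there \<open>as\<close> agrees with the distinct list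
    \<open>bs\<close>.\<close>
  have later: "\<exists>j>i. j < k \<and> as ! j = bs ! i"
    if as: "i < k" "\<And>t. t < i \<Longrightarrow> as ! t = bs ! t" "as ! i \<noteq> bs ! i" "set as = set bs" "distinct bs"
      "length as = k" "length bs = k" for as bs :: "'a list" and i
  proof -
    have "bs ! i \<in> set as" using that by simp
    then obtain j where j: "j < k" "as ! j = bs ! i" using as(6) unfolding in_set_conv_nth by blast
    have "\<not> j < i" using j that by (metis nth_eq_iff_index_eq nat_neq_iff order_less_trans)
    moreover have "j \<noteq> i" using j that by auto
    ultimately show ?thesis using j by (intro exI[of _ j]) simp
  qed
  show "xs = ys"
  proof (rule nth_equalityI)
    show "length xs = length ys" using len by simp
    fix i assume "i < length xs"
    then show "xs ! i = ys ! i"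
    proof (induction i rule: less_induct)
      case (less i)
      show ?case
      proof (rule ccontr)
        assume ne: "xs ! i \<noteq> ys ! i"
        obtain j where j: "j > i" "j < k" "xs ! j = ys ! i"
          using later[of i xs ys] less ne eq dy len by auto
        obtain j' where j': "j' > i" "j' < k" "ys ! j' = xs ! i"
          using later[of i ys xs] less ne eq dx len by force
        define c where "c t = (if t < j - i then xs ! (i + t) else ys ! (i + (t - (j - i))))" for t
        define l where "l = (j - i) + (j' - i)"
        have "closed_walk E V l c"
          unfolding closed_walk_def
        proof (intro conjI allI impI)
          show "0 < l" using j by (simp add: l_def)
          fix t assume t: "t < l"
          show "c t \<in> V"
            using V eq len j j' t by (auto simp: c_def l_def intro!: subsetD[OF V])
          consider "Suc t < j - i" | "Suc t = j - i" | "j - i \<le> t" "Suc t < l" | "Suc t = l" "j - i \<le> t"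
            using t by linarith
          then show "E (c t) (c (Suc t mod l))"
          proof cases
            case 1 then show ?thesis using Ex[of "i + t"] j t by (simp add: c_def l_def)
          next
            case 2
            then have "Suc (i + t) = j" using j by simp
            then have "E (c t) (ys ! i)" using Ex[of "i + t"] j 2 by (simp add: c_def)
            moreover have "Suc t mod l = j - i" using 2 j' by (simp add: l_def)
            ultimately show ?thesis by (simp add: c_def)
          next
            case 3
            then have "E (ys ! (i + (t - (j - i)))) (ys ! Suc (i + (t - (j - i))))"
              using j j' by (intro Ey) (simp add: l_def)
            then show ?thesis using 3 by (simp add: c_def Suc_diff_le)
          next
            case 4
            then have s: "Suc (i + (t - (j - i))) = j'" using j j' by (simp add: l_def)
            then have "E (ys ! (i + (t - (j - i)))) (ys ! j')" using Ey[of "i + (t - (j - i))"] j' by simp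
            then show ?thesis using 4 j j' by (simp add: c_def)
          qed
        qed
        moreover have "l \<le> 2 * k" using j j' by (simp add: l_def)
        ultimately show False using no by blast
      qed
    qed
  qed
qed

lemma card_walks_le:
  assumes "finite V" and no: "\<And>l c. l \<le> 2 * k \<Longrightarrow> \<not> closed_walk E V l c"
  shows "card (walks E V k) * fact k \<le> card V ^ k"
proof -
  have "set ` walks E V k \<subseteq> {S. S \<subseteq> V \<and> card S = k}"
    using walks_distinct[OF no] by (auto simp: walks_def distinct_card)
  then have "card (set ` walks E V k) \<le> card {S. S \<subseteq> V \<and> card S = k}"
    using assms(1) by (intro card_mono) auto
  then have "card (walks E V k) \<le> card V choose k"
    using card_image[OF walks_determined_by_set[OF no]] n_subsets[OF assms(1)] by simp
  then have "card (walks E V k) * fact k \<le> (card V choose k) * fact k" by simp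
  also have "\<dots> \<le> card V ^ k" by (rule binomial_fact_pow)
  finally show ?thesis .
qed

text \<open>\<open>k ^ k / fact k\<close> is a single term of the exponential series at
  \<open>k\<close>.\<close>

lemma fact_lower: "(real k / exp 1) ^ k \<le> fact k"
proof -
  have "(\<Sum>n\<in>{k}. real k ^ n /\<^sub>R fact n) \<le> (\<Sum>n. real k ^ n /\<^sub>R fact n)"
    by (rule sum_le_suminf[OF summable_exp_generic]) auto
  then have "real k ^ k / fact k \<le> exp (real k)" by (simp add: exp_def divide_inverse mult.commute)
  then have "real k ^ k \<le> exp 1 ^ k * fact k" by (simp add: field_simps exp_of_nat_mult[symmetric])
  then show ?thesis by (simp add: power_divide field_simps)
qed

text \<open>Fekete's lemma in multiplicative form: ln h is the infimum of ln (a n) / n over n \<ge>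
  1. The upper bound is claimed only along arbitrarily large indices, which the multiples of one
  good index provide.\<close>

lemma submultiplicative_growth:
  fixes a :: "nat \<Rightarrow> real"
  assumes a1: "\<And>n. 1 \<le> a n" and sm: "\<And>m n. a (m + n) \<le> a m * a n"
  shows "\<exists>h>0. (\<forall>n. h ^ n \<le> a n) \<and> (\<forall>\<sigma>>1. \<forall>N. \<exists>n\<ge>N. 1 \<le> n \<and> a n \<le> (h * \<sigma>) ^ n)"
proof -
  define b where "b n = ln (a (Suc n)) / Suc n" for n
  define h where "h = exp (INF n. b n)"
  have b0: "0 \<le> b n" for n using a1[of "Suc n"] by (simp add: b_def)
  have bdd: "bdd_below (range b)" using b0 by (auto intro!: bdd_belowI)
  have apos: "0 < a n" for n using a1[of n] by linarith
  have pw: "h ^ n \<le> a n" for n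
  proof (cases n)
    case 0 then show ?thesis using a1[of 0] by simp
  next
    case (Suc k)
    have "(INF n. b n) \<le> b k" by (rule cINF_lower[OF bdd]) auto
    then have "Suc k * (INF n. b n) \<le> ln (a (Suc k))" by (simp add: b_def field_simps)
    then have "exp (Suc k * (INF n. b n)) \<le> a (Suc k)" using apos[of "Suc k"] by (simp add: ln_ge_iff del: of_nat_Suc)
    then show ?thesis unfolding h_def Suc by (simp only: exp_of_nat_mult)
  qed
  have mul: "a (j * n) \<le> a n ^ j" if "1 \<le> j" for j n
    using that
  proof (induction j rule: dec_induct)
    case (step j)
    have "a (n + j * n) \<le> a n * a (j * n)" by (rule sm)
    also have "\<dots> \<le> a n * a n ^ j" using step apos[of n] by (intro mult_left_mono) auto
    finally show ?case by simp
  qed simp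
  have "\<exists>n\<ge>N. 1 \<le> n \<and> a n \<le> (h * \<sigma>) ^ n" if \<sigma>: "1 < \<sigma>" for \<sigma> N
  proof -
    have "\<exists>n. b n < (INF n. b n) + ln \<sigma>"
      using cINF_greatest[of UNIV "(INF n. b n) + ln \<sigma>" b] \<sigma> by (force simp: not_less)
    then obtain n where n: "b n < (INF n. b n) + ln \<sigma>" by blast
    have "ln (a (Suc n)) \<le> Suc n * ((INF n. b n) + ln \<sigma>)" using n by (simp add: b_def field_simps)
    then have "a (Suc n) \<le> exp (Suc n * ((INF n. b n) + ln \<sigma>))" using apos[of "Suc n"]
      by (metis exp_ln exp_le_cancel_iff)
    also have "\<dots> = (h * \<sigma>) ^ Suc n" using \<sigma> by (simp only: exp_of_nat_mult exp_add h_def exp_ln)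
    finally have le: "a (Suc n) \<le> (h * \<sigma>) ^ Suc n" .
    have "a (Suc N * Suc n) \<le> a (Suc n) ^ Suc N" by (rule mul) simp
    also have "\<dots> \<le> ((h * \<sigma>) ^ Suc n) ^ Suc N" using le apos[of "Suc n"] by (intro power_mono) auto
    also have "\<dots> = (h * \<sigma>) ^ (Suc N * Suc n)" by (metis power_mult mult.commute)
    finally show ?thesis by (intro exI[of _ "Suc N * Suc n"]) auto
  qed
  then show ?thesis using pw by (intro exI[of _ h]) (auto simp: h_def)
qed

section \<open>Coding by words, closing of pseudo-orbits and separated periodic orbits\<close>

context expanding_lift begin

text \<open>The integer parts name the inverse branches that lead back along the orbit, so the word
  and the endpoint of an orbit segment in the unit interval determine its start.\<close>

definition word :: "nat \<Rightarrow> real \<Rightarrow> int list" where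
  "word n t = map (\<lambda>i. \<lfloor>F ((circ_map F ^^ i) t)\<rfloor>) [0..<n]"

lemma length_word [simp]: "length (word n t) = n"
  by (simp add: word_def)

lemma word_add: "word (m + n) t = word m t @ word n ((circ_map F ^^ m) t)"
proof (rule nth_equalityI)
  fix i assume "i < length (word (m + n) t)"
  then show "word (m + n) t ! i = (word m t @ word n ((circ_map F ^^ m) t)) ! i"
    by (cases "i < m") (simp_all add: word_def nth_append less_diff_conv2
      funpow_apply)
qed simp

lemma circ_step: "F t = circ_map F t + of_int \<lfloor>F t\<rfloor>"
  by (simp add: circ_map_def frac_def)

lemma circ_pow: "\<exists>k. (F ^^ n) t = (circ_map F ^^ n) t + of_int k"
proof (induction n)
  case (Suc n)
  then obtain k where k: "(F ^^ n) t = (circ_map F ^^ n) t + of_int k" by blast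
  have "(F ^^ Suc n) t = circ_map F ((circ_map F ^^ n) t) + of_int (\<lfloor>F ((circ_map F ^^ n) t)\<rfloor> + d * k)"
    using circ_step[of "(circ_map F ^^ n) t"] by (simp add: k deg_int)
  then show ?case by (metis funpow.simps(2) o_apply)
qed auto

lemma circ_pow_Ints: "(F ^^ n) t - (circ_map F ^^ n) t \<in> \<int>"
  using circ_pow[of n t] by auto

text \<open>The integer separating \<open>F ^^ n\<close> from the circle orbit is computed from the
  word alone, so it cancels in the difference.\<close>

lemma word_eq_diff:
  assumes "word n a = word n b"
  shows "(F ^^ n) a - (F ^^ n) b = (circ_map F ^^ n) a - (circ_map F ^^ n) b"
proof -
  have "\<exists>k. (F ^^ n) a = (circ_map F ^^ n) a + of_int k \<and> (F ^^ n) b = (circ_map F ^^ n) b + of_int k"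
    using assms
  proof (induction n)
    case (Suc n)
    have w: "word n a = word n b" "\<lfloor>F ((circ_map F ^^ n) a)\<rfloor> = \<lfloor>F ((circ_map F ^^ n) b)\<rfloor>"
      using Suc.prems by (simp_all add: word_def)
    then obtain k where k: "(F ^^ n) a = (circ_map F ^^ n) a + of_int k" "(F ^^ n) b = (circ_map F ^^ n) b + of_int k"
      using Suc.IH by blast
    show ?case
      using circ_step[of "(circ_map F ^^ n) a"] circ_step[of "(circ_map F ^^ n) b"] w
      by (intro exI[of _ "\<lfloor>F ((circ_map F ^^ n) a)\<rfloor> + d * k"]) (simp add: k deg_int)
  qed auto
  then show ?thesis by auto
qed

lemma circ_range: "(circ_map F ^^ n) t \<in> {0..<1}" if "t \<in> {0..<1}"
  using that by (induction n) (auto simp: circ_map_def frac_lt_1)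

lemma word_eq_dist:
  assumes "word n a = word n b" "a \<in> {0..<1}" "b \<in> {0..<1}"
  shows "\<bar>a - b\<bar> \<le> ct n"
proof -
  have "\<bar>a - b\<bar> \<le> ct n * \<bar>(circ_map F ^^ n) a - (circ_map F ^^ n) b\<bar>"
    using contract[of a b n] word_eq_diff[OF assms(1)] by simp
  also have "\<dots> \<le> ct n * 1"
    using circ_range[OF assms(2), of n] circ_range[OF assms(3), of n] ct_pos[of n]
    by (intro mult_left_mono) auto
  finally show ?thesis by simp
qed

lemma finite_words: "finite (word n ` {0..<1})"
proof -
  have "compact (F ` {0..1})" by (intro compact_continuous_image cont compact_Icc)
  then obtain B where B: "\<And>x. x \<in> {0..1} \<Longrightarrow> \<bar>F x\<bar> \<le> B"
    by (force dest: compact_imp_bounded simp: bounded_iff)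
  have "word n ` {0..<1} \<subseteq> {xs. set xs \<subseteq> {\<lfloor>-B\<rfloor>..\<lfloor>B\<rfloor>} \<and> length xs = n}"
  proof
    fix w assume "w \<in> word n ` {0..<1}"
    then obtain t where t: "t \<in> {0..<1}" "w = word n t" by auto
    have "\<lfloor>F ((circ_map F ^^ i) t)\<rfloor> \<in> {\<lfloor>-B\<rfloor>..\<lfloor>B\<rfloor>}" for i
      using B[of "(circ_map F ^^ i) t"] circ_range[OF t(1), of i] by (auto intro!: floor_mono)
    then show "w \<in> {xs. set xs \<subseteq> {\<lfloor>-B\<rfloor>..\<lfloor>B\<rfloor>} \<and> length xs = n}" unfolding t(2) by (auto simp: word_def)
  qed
  then show ?thesis by (rule finite_subset) (rule finite_lists_length_eq, simp)
qed

text \<open>Without closed walks of length at most \<open>2 * k\<close>, the words of length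
  \<open>k * n\<close>, read as walks of \<open>k\<close> blocks, number at most
  \<open>a n ^ k / fact k\<close>. They number at least \<open>h ^ (k * n)\<close>, and
  \<open>a n\<close> is at most \<open>(h * \<sigma>) ^ n\<close>, so \<open>fact k\<close> would be
  at most \<open>(\<sigma> ^ n) ^ k\<close>. This fails once \<open>k\<close> exceeds
  \<open>exp 1 * \<sigma> ^ n\<close>.\<close>

lemma short_closed_walk:
  assumes Z: "Z \<subseteq> {0..<1}" "Z \<noteq> {}" "\<And>t. t \<in> Z \<Longrightarrow> circ_map F t \<in> Z" and \<sigma>: "1 < \<sigma>"
  shows "\<exists>n\<ge>N. 1 \<le> n \<and> (\<exists>l c. real l \<le> 10 * \<sigma> ^ n
    \<and> closed_walk (\<lambda>v w. v @ w \<in> word (2 * n) ` Z) (word n ` Z) l c)"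
proof -
  have Zn: "(circ_map F ^^ n) t \<in> Z" if "t \<in> Z" for n t
    using that by (induction n) (auto intro: Z(3))
  have fin: "finite (word n ` Z)" for n
    using finite_subset[OF image_mono[OF Z(1)] finite_words] .
  define a where "a n = card (word n ` Z)" for n
  have a1: "1 \<le> a n" for n using fin[of n] Z(2) by (simp add: a_def Suc_le_eq card_gt_0_iff)
  have sm: "a (m + n) \<le> a m * a n" for m n
  proof -
    have "word (m + n) ` Z \<subseteq> (\<lambda>(v, w). v @ w) ` (word m ` Z \<times> word n ` Z)"
      using Zn by (auto simp: word_add image_iff)
    then have "a (m + n) \<le> card ((\<lambda>(v, w). v @ w) ` (word m ` Z \<times> word n ` Z))"
      unfolding a_def using fin by (intro card_mono) auto
    also have "\<dots> \<le> card (word m ` Z \<times> word n ` Z)" using fin by (intro card_image_le) auto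
    finally show ?thesis by (simp add: a_def card_cartesian_product)
  qed
  obtain h where h: "0 < h" "\<And>n. h ^ n \<le> real (a n)" "\<And>\<sigma> N. 1 < \<sigma> \<Longrightarrow> \<exists>n\<ge>N. 1 \<le> n \<and> real (a n) \<le> (h * \<sigma>) ^ n"
    using submultiplicative_growth[of "\<lambda>n. real (a n)"] a1 sm
    by (metis of_nat_1 of_nat_le_iff of_nat_mult)
  obtain n where n: "N \<le> n" "1 \<le> n" "real (a n) \<le> (h * \<sigma>) ^ n" using h(3)[OF \<sigma>] by blast
  define E where "E = (\<lambda>v w. v @ w \<in> word (2 * n) ` Z)"
  define k where "k = nat \<lceil>exp 1 * \<sigma> ^ n\<rceil> + 1"
  have kgt: "exp 1 * \<sigma> ^ n < real k" unfolding k_def by linarith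
  have "\<exists>l\<le>2 * k. \<exists>c. closed_walk E (word n ` Z) l c"
  proof (rule ccontr)
    assume "\<not> ?thesis"
    then have no: "\<And>l c. l \<le> 2 * k \<Longrightarrow> \<not> closed_walk E (word n ` Z) l c" by blast
    have "word (k * n) ` Z \<subseteq> concat ` walks E (word n ` Z) k"
    proof
      fix w assume "w \<in> word (k * n) ` Z"
      then obtain t where t: "t \<in> Z" "w = word (k * n) t" by auto
      define bl where "bl j = word n ((circ_map F ^^ (j * n)) t)" for j
      have "concat (map bl [0..<j]) = word (j * n) t" for j
      proof (induction j)
        case (Suc j)
        have "word (Suc j * n) t = word (j * n + n) t" by (simp add: add.commute)
        then show ?case using Suc by (simp add: word_add bl_def)
      qed (simp add: word_def)
      moreover have "map bl [0..<k] \<in> walks E (word n ` Z) k"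
      proof -
        have "E (bl i) (bl (Suc i))" for i
        proof -
          have "bl i @ bl (Suc i) = word (n + n) ((circ_map F ^^ (i * n)) t)"
            unfolding word_add bl_def by (simp add: funpow_add)
          then show ?thesis unfolding E_def using Zn[OF t(1)] by (simp add: mult_2)
        qed
        then show ?thesis using Zn[OF t(1)] by (auto simp: walks_def bl_def)
      qed
      ultimately show "w \<in> concat ` walks E (word n ` Z) k" using t(2) by (metis imageI)
    qed
    moreover have finw: "finite (walks E (word n ` Z) k)"
      by (rule finite_subset[OF _ finite_lists_length_eq[OF fin[of n], of k]]) (auto simp: walks_def)
    ultimately have "a (k * n) \<le> card (concat ` walks E (word n ` Z) k)"
      unfolding a_def by (intro card_mono) auto
    also have "\<dots> \<le> card (walks E (word n ` Z) k)" by (rule card_image_le[OF finw])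
    finally have "a (k * n) * fact k \<le> card (walks E (word n ` Z) k) * fact k" by simp
    also have "\<dots> \<le> a n ^ k" unfolding a_def by (rule card_walks_le[OF fin no])
    finally have "real (a (k * n) * fact k) \<le> real (a n ^ k)" by (rule of_nat_mono)
    then have "real (a (k * n)) * fact k \<le> real (a n) ^ k" by simp
    also have "\<dots> \<le> ((h * \<sigma>) ^ n) ^ k" using n(3) by (intro power_mono) auto
    also have "\<dots> = h ^ (k * n) * (\<sigma> ^ n) ^ k" by (simp add: power_mult_distrib power_mult[symmetric] mult.commute)
    finally have "h ^ (k * n) * fact k \<le> h ^ (k * n) * (\<sigma> ^ n) ^ k"
      using mult_right_mono[OF h(2)[of "k * n"], of "fact k"] by (meson fact_ge_zero order_trans)
    then have "fact k \<le> (\<sigma> ^ n) ^ k" using h(1) by simp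
    moreover have "(\<sigma> ^ n) ^ k < (real k / exp 1) ^ k"
      using kgt \<sigma> by (intro power_strict_mono) (auto simp: field_simps k_def)
    ultimately show False using fact_lower[of k] by linarith
  qed
  then obtain l c where lc: "l \<le> 2 * k" "closed_walk E (word n ` Z) l c" by blast
  have "real l \<le> 2 * real k" using lc(1) by linarith
  also have "real k \<le> exp 1 * \<sigma> ^ n + 2"
    unfolding k_def using \<sigma> by (simp add: of_nat_nat) linarith
  also have "exp 1 * \<sigma> ^ n + 2 \<le> 3 * \<sigma> ^ n + 2 * \<sigma> ^ n"
    using exp_le \<sigma> one_le_power[of \<sigma> n] by (intro add_mono mult_right_mono) auto
  finally have "real l \<le> 10 * \<sigma> ^ n" by simp
  then show ?thesis using n lc(2) unfolding E_def by blast
qed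

text \<open>Follow an orbit in \<open>Z\<close> for \<open>n\<close> steps, then jump to the
  representative of the next edge, whose first \<open>n\<close> letters are those still ahead of the
  orbit. Equality of words bounds each jump by \<open>ct n\<close>; there are \<open>l\<close>
  jumps, and \<open>G\<close> vanishes at all points of the pseudo-orbit.\<close>

lemma closed_walk_periodic_orbit:
  assumes Z: "Z \<subseteq> {0..<1}" and G: "periodic1 G" "LG-lipschitz_on UNIV G"
    and G0: "\<And>t i. t \<in> Z \<Longrightarrow> G ((circ_map F ^^ i) t) = 0"
    and n: "1 \<le> n" and c: "closed_walk (\<lambda>v w. v @ w \<in> word (2 * n) ` Z) (word n ` Z) l c"
  shows "\<exists>x. (F ^^ (n * l)) x - x \<in> \<int> \<and> bsum F G (n * l) x \<le> LG * KS * (l * ct n)"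
proof -
  have l: "0 < l" using c by (simp add: closed_walk_def)
  have "\<exists>z. \<forall>j. j < l \<longrightarrow> z j \<in> Z \<and> word (2 * n) (z j) = c j @ c (Suc j mod l)"
    by (intro choice) (use c in \<open>force simp: closed_walk_def\<close>)
  then obtain z where z: "\<And>j. j < l \<Longrightarrow> z j \<in> Z" "\<And>j. j < l \<Longrightarrow> word (2 * n) (z j) = c j @ c (Suc j mod l)"
    by blast
  have len: "length (c j) = n" if "j < l" for j using c that by (auto simp: closed_walk_def)
  have w: "word n (z j) = c j" "word n ((circ_map F ^^ n) (z j)) = c (Suc j mod l)" if "j < l" for j
    using z(2)[OF that] len[OF that] word_add[of n n "z j"] by (simp_all add: mult_2)
  \<comment> \<open>\<open>m div n\<close> is the block and \<open>m mod n\<close> the position in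
    it; a defect occurs only on leaving a block, the last one included, which leads back to block
    0.\<close>
  define y where "y m = (circ_map F ^^ (m mod n)) (z (m div n))" for m
  define e where "e m = (if Suc m mod n = 0 then ct n else 0)" for m
  have "\<bar>F (y m) - of_int \<lfloor>F (y m)\<rfloor> - y (Suc m mod (n * l))\<bar> \<le> e m" if m: "m < n * l" for m
  proof -
    have j: "m div n < l" using m by (simp add: less_mult_imp_div_less mult.commute)
    have Fy: "F (y m) - of_int \<lfloor>F (y m)\<rfloor> = (circ_map F ^^ Suc (m mod n)) (z (m div n))"
      using circ_step[of "y m"] by (simp add: y_def)
    show ?thesis
    proof (cases "Suc m mod n = 0")
      case False
      then have 1: "Suc m mod n = Suc (m mod n)" "Suc m div n = m div n"
        by (simp_all add: mod_Suc div_Suc split: if_splits)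
      have "Suc m \<noteq> n * l" using False by auto
      then have "Suc m mod (n * l) = Suc m" using m by simp
      then show ?thesis unfolding Fy using 1 False by (simp add: y_def e_def)
    next
      case True
      then have 1: "Suc (m mod n) = n" "Suc m div n = Suc (m div n)"
        using n by (auto simp: mod_Suc div_Suc split: if_splits)
      have "Suc m = n * Suc (m div n)" using True 1(2) by (metis add_0_right mult_div_mod_eq)
      then have "Suc m mod (n * l) = n * (Suc (m div n) mod l)" by (metis mod_mult_mult1)
      then have "y (Suc m mod (n * l)) = z (Suc (m div n) mod l)" using n by (simp add: y_def)
      moreover have "\<bar>(circ_map F ^^ n) (z (m div n)) - z (Suc (m div n) mod l)\<bar> \<le> ct n"
      proof (rule word_eq_dist)
        have j': "Suc (m div n) mod l < l" using l by simp
        show "word n ((circ_map F ^^ n) (z (m div n))) = word n (z (Suc (m div n) mod l))"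
          using w(2)[OF j] w(1)[OF j'] by simp
        show "(circ_map F ^^ n) (z (m div n)) \<in> {0..<1}" using Z z(1)[OF j] by (intro circ_range) auto
        show "z (Suc (m div n) mod l) \<in> {0..<1}" using Z z(1)[OF j'] by auto
      qed
      ultimately show ?thesis unfolding Fy 1(1) using True by (simp add: e_def)
    qed
  qed
  then obtain x where x: "(F ^^ (n * l)) x - x \<in> \<int>"
      "bsum F G (n * l) x \<le> (\<Sum>m<n * l. G (y m)) + LG * KS * (\<Sum>m<n * l. e m)"
    using periodic_shadow[of "n * l" G LG y "\<lambda>m. \<lfloor>F (y m)\<rfloor>" e] n l G by (metis nat_0_less_mult_iff not_one_le_zero not_gr_zero)
  have "(\<Sum>m<n * l. G (y m)) = 0"
  proof (rule sum.neutral, rule ballI)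
    fix m assume "m \<in> {..<n * l}"
    then have "m div n < l" by (simp add: less_mult_imp_div_less mult.commute)
    then show "G (y m) = 0" unfolding y_def using z(1) G0 by simp
  qed
  moreover have "(\<Sum>m<n * l. e m) = l * ct n"
  proof -
    have "(\<Sum>m<n * k. e m) = k * ct n" for k
    proof (induction k)
      case (Suc k)
      have "(\<Sum>m<n * Suc k. e m) = (\<Sum>m<n * k. e m) + (\<Sum>i<n. e (n * k + i))"
      proof -
        have "(\<Sum>m<n * k + r. e m) = (\<Sum>m<n * k. e m) + (\<Sum>i<r. e (n * k + i))" for r
          by (induction r) auto
        from this[of n] show ?thesis by (simp add: add.commute)
      qed
      also have "(\<Sum>i<n. e (n * k + i)) = (\<Sum>i<n. if i = n - 1 then ct n else 0)"
      proof (rule sum.cong)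
        fix i assume "i \<in> {..<n}"
        then show "e (n * k + i) = (if i = n - 1 then ct n else 0)"
          using n by (auto simp: e_def mod_Suc split: if_splits)
      qed simp
      also have "\<dots> = ct n" using n by simp
      finally show ?case using Suc by (simp add: algebra_simps)
    qed simp
    then show ?thesis .
  qed
  ultimately show ?thesis using x by auto
qed

lemma fast_periodic_approximation:
  assumes G: "periodic1 G" "LG-lipschitz_on UNIV G" and z: "z \<in> {0..<1}" "\<And>i. G ((F ^^ i) z) = 0" and e: "0 < e"
  shows "\<exists>P\<ge>1. \<exists>x. (F ^^ P) x - x \<in> \<int> \<and> real P ^ K * bsum F G P x \<le> e"
proof -
  define Z where "Z = {t \<in> {0..<1}. \<forall>i. G ((circ_map F ^^ i) t) = 0}"
  have Z1: "Z \<subseteq> {0..<1}" by (auto simp: Z_def)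
  have "G ((circ_map F ^^ i) z) = 0" for i
    using periodic1_diff_int[OF G(1) circ_pow_Ints[of i z]] z(2) by simp
  then have Z2: "Z \<noteq> {}" using z(1) by (auto simp: Z_def)
  have Z3: "circ_map F t \<in> Z" if "t \<in> Z" for t
  proof -
    have "(circ_map F ^^ i) (circ_map F t) = (circ_map F ^^ Suc i) t" for i by (simp add: funpow_swap1)
    then have "G ((circ_map F ^^ i) (circ_map F t)) = 0" for i using that unfolding Z_def by (metis (mono_tags, lifting) mem_Collect_eq)
    then show ?thesis using that circ_range[of t 1] by (auto simp: Z_def)
  qed
  \<comment> \<open>The period \<open>n * l\<close> turns out O(\<sigma>^(2n)), using n \<le>
    \<sigma>^n / (\<sigma> - 1), and the action O(\<sigma>^n lam^(-n)). With lam = \<sigma>^(2K+2)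
    the product of the action and the K-th power of the period is O(\<sigma>^(-n)).\<close>
  define \<sigma> where "\<sigma> = root (2 * K + 2) lam"
  have \<sigma>: "1 < \<sigma>" "\<sigma> ^ (2 * K + 2) = lam" using lam real_root_pow_pos2[of "2 * K + 2" lam] unfolding \<sigma>_def by auto
  define A where "A = (10 / (\<sigma> - 1)) ^ K * (LG * KS * (10 / C))"
  have LG: "0 \<le> LG" using G(2) by (rule lipschitz_on_nonneg)
  have A0: "0 \<le> A" using \<sigma> LG KS_pos C_pos by (simp add: A_def)
  have "(\<lambda>n. A * (1 / \<sigma>) ^ n) \<longlonglongrightarrow> 0"
    using tendsto_mult_left[OF LIMSEQ_realpow_zero[of "1 / \<sigma>"], of A] \<sigma> by simp
  then have "\<forall>\<^sub>F n in sequentially. A * (1 / \<sigma>) ^ n < e" using e by (rule order_tendstoD)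
  then obtain N where N: "\<And>n. N \<le> n \<Longrightarrow> A * (1 / \<sigma>) ^ n < e" by (auto simp: eventually_sequentially)
  obtain n l c where n: "N \<le> n" "1 \<le> n" and l: "real l \<le> 10 * \<sigma> ^ n"
    and c: "closed_walk (\<lambda>v w. v @ w \<in> word (2 * n) ` Z) (word n ` Z) l c"
    using short_closed_walk[OF Z1 Z2 Z3 \<sigma>(1), of N] by blast
  obtain x where x: "(F ^^ (n * l)) x - x \<in> \<int>" "bsum F G (n * l) x \<le> LG * KS * (l * ct n)"
    using closed_walk_periodic_orbit[OF Z1 G _ n(2) c] by (auto simp: Z_def)
  have l0: "0 < l" using c by (simp add: closed_walk_def)
  have "real n \<le> \<sigma> ^ n / (\<sigma> - 1)"
    using Bernoulli_inequality[of "\<sigma> - 1" n] \<sigma> by (simp add: field_simps)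
  then have "real (n * l) \<le> (\<sigma> ^ n / (\<sigma> - 1)) * (10 * \<sigma> ^ n)"
    unfolding of_nat_mult using l \<sigma> by (intro mult_mono) auto
  also have "\<dots> = 10 / (\<sigma> - 1) * \<sigma> ^ (2 * n)"
    by (simp add: mult_2 power_add)
  finally have "real (n * l) \<le> 10 / (\<sigma> - 1) * \<sigma> ^ (2 * n)" .
  then have P: "real (n * l) ^ K \<le> (10 / (\<sigma> - 1) * \<sigma> ^ (2 * n)) ^ K" by (intro power_mono) auto
  have "LG * KS * (l * ct n) \<le> LG * KS * (10 * \<sigma> ^ n * ct n)"
    using LG KS_pos ct_pos[of n] l by (intro mult_left_mono mult_right_mono) auto
  also have "\<dots> = LG * KS * (10 / C) * (\<sigma> ^ n * (1 / lam) ^ n)" by (simp add: ct_def)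
  finally have S: "LG * KS * (l * ct n) \<le> LG * KS * (10 / C) * (\<sigma> ^ n * (1 / lam) ^ n)" .
  have "real (n * l) ^ K * bsum F G (n * l) x \<le> real (n * l) ^ K * (LG * KS * (l * ct n))"
    using x(2) by (intro mult_left_mono) auto
  also have "\<dots> \<le> (10 / (\<sigma> - 1) * \<sigma> ^ (2 * n)) ^ K * (LG * KS * (10 / C) * (\<sigma> ^ n * (1 / lam) ^ n))"
    using LG KS_pos ct_pos[of n] \<sigma>(1) by (intro mult_mono[OF P S]) (auto simp: less_imp_le)
  also have "\<dots> = A * ((\<sigma> ^ (2 * n)) ^ K * (\<sigma> ^ n * (1 / lam) ^ n))"
    unfolding A_def power_mult_distrib[of "10 / (\<sigma> - 1)"] by (simp only: mult_ac)
  also have "(\<sigma> ^ (2 * n)) ^ K * (\<sigma> ^ n * (1 / lam) ^ n) = (1 / \<sigma>) ^ n"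
  proof -
    have "(\<sigma> ^ (2 * n)) ^ K * \<sigma> ^ n * \<sigma> ^ n = lam ^ n"
      unfolding \<sigma>(2)[symmetric] power_mult[symmetric] power_add[symmetric] by (simp add: algebra_simps)
    then show ?thesis using lam \<sigma> by (simp add: field_simps)
  qed
  finally have "real (n * l) ^ K * bsum F G (n * l) x \<le> e" using N[OF n(1)] by linarith
  then show ?thesis using x(1) n(2) l0 by (intro exI[of _ "n * l"]) auto
qed

text \<open>Two points cut the orbit into two arcs, each of which closes up with a single defect,
  their distance. The shorter arc has at most half the period, and as \<open>G\<close> is
  nonnegative its action does not exceed the whole.\<close>

lemma halve_periodic_orbit:
  assumes G: "periodic1 G" "LG-lipschitz_on UNIV G" "\<And>x. 0 \<le> G x"
    and x: "(F ^^ P) x - x \<in> \<int>" and ij: "i < j" "j < P"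
  shows "\<exists>P' x'. 1 \<le> P' \<and> 2 * P' \<le> P \<and> (F ^^ P') x' - x' \<in> \<int>
    \<and> bsum F G P' x' \<le> bsum F G P x + LG * KS * cdist ((F ^^ i) x) ((F ^^ j) x)"
proof -
  let ?D = "cdist ((F ^^ i) x) ((F ^^ j) x)"
  have nn: "0 \<le> bsum F G n t" for n t unfolding bsum_def using G(3) by (intro sum_nonneg) auto
  have close: "\<exists>x'. (F ^^ q) x' - x' \<in> \<int> \<and> bsum F G q x' \<le> bsum F G q t + LG * KS * \<bar>(F ^^ q) t - t - of_int m\<bar>"
    if q: "1 \<le> q" for q t m
  proof -
    define y where "y l = (F ^^ l) t" for l
    define s where "s l = (if Suc l = q then m else 0)" for l
    define e where "e l = (if l = q - 1 then \<bar>(F ^^ q) t - t - of_int m\<bar> else 0)" for l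
    have "\<bar>F (y l) - of_int (s l) - y (Suc l mod q)\<bar> \<le> e l" if "l < q" for l
    proof (cases "Suc l = q")
      case True
      then have "F (y l) = (F ^^ q) t" by (auto simp: y_def)
      then show ?thesis using True by (auto simp: y_def s_def e_def)
    next
      case False
      then show ?thesis using that by (auto simp: y_def s_def e_def)
    qed
    then obtain x' where "(F ^^ q) x' - x' \<in> \<int>" "bsum F G q x' \<le> (\<Sum>l<q. G (y l)) + LG * KS * (\<Sum>l<q. e l)"
      using periodic_shadow[of q G LG y s e] q G by auto
    moreover have "(\<Sum>l<q. e l) = \<bar>(F ^^ q) t - t - of_int m\<bar>" using q by (simp add: e_def)
    ultimately show ?thesis by (auto simp: bsum_def y_def)
  qed
  define q where "q = j - i"
  define m where "m = round ((F ^^ j) x - (F ^^ i) x)"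
  have q: "1 \<le> q" "(F ^^ q) ((F ^^ i) x) = (F ^^ j) x"
    using ij by (auto simp: q_def funpow_apply)
  \<comment> \<open>\<open>round\<close> is not odd at half-integers, so the two orders of
    subtraction are compared by two inequalities.\<close>
  have D: "?D = \<bar>(F ^^ j) x - (F ^^ i) x - of_int m\<bar>"
  proof -
    have "\<bar>(F ^^ i) x - (F ^^ j) x - of_int (- m)\<bar> = \<bar>(F ^^ j) x - (F ^^ i) x - of_int m\<bar>" by simp
    then have "?D \<le> \<bar>(F ^^ j) x - (F ^^ i) x - of_int m\<bar>" using cdist_le by metis
    moreover have "\<bar>(F ^^ j) x - (F ^^ i) x - of_int m\<bar> \<le> ?D"
    proof -
      let ?r = "round ((F ^^ i) x - (F ^^ j) x)"
      have "\<bar>(F ^^ j) x - (F ^^ i) x - of_int m\<bar> \<le> \<bar>(F ^^ j) x - (F ^^ i) x - of_int (- ?r)\<bar>"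
        unfolding m_def using round_diff_minimal[of "(F ^^ j) x - (F ^^ i) x" "- ?r"] by linarith
      also have "\<dots> = ?D" unfolding cdist_def by simp
      finally show ?thesis .
    qed
    ultimately show ?thesis by linarith
  qed
  show ?thesis
  proof (cases "2 * q \<le> P")
    case True
    have "bsum F G q ((F ^^ i) x) \<le> bsum F G P x"
    proof -
      have "bsum F G P x = bsum F G i x + (bsum F G q ((F ^^ i) x) + bsum F G (P - j) ((F ^^ j) x))"
        using bsum_add[of F G i "q + (P - j)" x] bsum_add[of F G q "P - j" "(F ^^ i) x"] ij q(2)
        by (simp add: q_def)
      then show ?thesis using nn[of i x] nn[of "P - j" "(F ^^ j) x"] by linarith
    qed
    moreover obtain x' where "(F ^^ q) x' - x' \<in> \<int>"
      "bsum F G q x' \<le> bsum F G q ((F ^^ i) x) + LG * KS * \<bar>(F ^^ q) ((F ^^ i) x) - (F ^^ i) x - of_int m\<bar>"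
      using close[OF q(1)] by blast
    ultimately show ?thesis using q True D by (intro exI[of _ q] exI[of _ x']) simp
  next
    case False
    define q' where "q' = P - q"
    have q': "1 \<le> q'" "2 * q' \<le> P" using False ij by (auto simp: q'_def q_def)
    have "q' = (P - j) + i" using ij by (simp add: q'_def q_def)
    then have "(F ^^ q') ((F ^^ j) x) = (F ^^ i) ((F ^^ P) x)"
      using ij by (simp add: funpow_apply add.commute)
    then have "(F ^^ q') ((F ^^ j) x) - (F ^^ i) x \<in> \<int>" using deg_pow_diff[OF x, of i] by simp
    then obtain r where r: "(F ^^ q') ((F ^^ j) x) - (F ^^ i) x = of_int r" by (auto elim: Ints_cases)
    have "bsum F G q' ((F ^^ j) x) \<le> bsum F G P x"
    proof -
      have "bsum F G q' ((F ^^ j) x) = bsum F G (P - j) ((F ^^ j) x) + bsum F G i ((F ^^ P) x)"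
        using bsum_add[of F G "P - j" i "(F ^^ j) x"] ij \<open>q' = (P - j) + i\<close>
        by (simp add: funpow_apply)
      moreover have "bsum F G i ((F ^^ P) x) = bsum F G i x"
        by (rule periodic1_diff_int[OF bsum_periodic1[OF G(1)] x])
      moreover have "bsum F G P x = bsum F G i x + (bsum F G q ((F ^^ i) x) + bsum F G (P - j) ((F ^^ j) x))"
        using bsum_add[of F G i "q + (P - j)" x] bsum_add[of F G q "P - j" "(F ^^ i) x"] ij q(2)
        by (simp add: q_def)
      ultimately show ?thesis using nn[of q "(F ^^ i) x"] by linarith
    qed
    moreover obtain x' where "(F ^^ q') x' - x' \<in> \<int>"
      "bsum F G q' x' \<le> bsum F G q' ((F ^^ j) x) + LG * KS * \<bar>(F ^^ q') ((F ^^ j) x) - (F ^^ j) x - of_int (r - m)\<bar>"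
      using close[OF q'(1)] by blast
    moreover have "\<bar>(F ^^ q') ((F ^^ j) x) - (F ^^ j) x - of_int (r - m)\<bar> = ?D" unfolding D using r by simp
    ultimately show ?thesis using q' by (intro exI[of _ q'] exI[of _ x']) simp
  qed
qed

text \<open>As long as two points are at distance at most action / \<tau>, cut there: the period is
  at least halved and the action grows by at most the factor \<open>Q\<close>. The number of cuts is
  logarithmic in the period, so with \<open>Q < 2 ^ K\<close> the total factor is at most
  \<open>2 ^ K\<close> times the \<open>K\<close>-th power of the period, which the initial orbit is
  chosen to beat.\<close>

lemma separated_periodic_orbit:
  assumes G: "periodic1 G" "LG-lipschitz_on UNIV G" "\<And>x. 0 \<le> G x"
    and z: "z \<in> {0..<1}" "\<And>i. G ((F ^^ i) z) = 0" and \<tau>: "0 < \<tau>" and D0: "0 < D0"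
  shows "\<exists>P x D. 1 \<le> P \<and> 0 < D \<and> D \<le> D0 \<and> (F ^^ P) x - x \<in> \<int>
    \<and> (\<forall>i j. i < j \<longrightarrow> j < P \<longrightarrow> D \<le> cdist ((F ^^ i) x) ((F ^^ j) x)) \<and> bsum F G P x \<le> \<tau> * D"
proof -
  have nn: "0 \<le> bsum F G n t" for n t unfolding bsum_def using G(3) by (intro sum_nonneg) auto
  define Q where "Q = 1 + LG * KS / \<tau>"
  have Q1: "1 \<le> Q" unfolding Q_def using lipschitz_on_nonneg[OF G(2)] KS_pos \<tau> by simp
  have step: "\<exists>P' x'. 1 \<le> P' \<and> (F ^^ P') x' - x' \<in> \<int> \<and> bsum F G P' x' \<le> Q ^ k * bsum F G P x
      \<and> (\<forall>i j. i < j \<longrightarrow> j < P' \<longrightarrow> bsum F G P' x' < \<tau> * cdist ((F ^^ i) x') ((F ^^ j) x'))"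
    if "1 \<le> P" "P < 2 ^ k" "(F ^^ P) x - x \<in> \<int>" for k P x
    using that
  proof (induction k arbitrary: P x)
    case (Suc k)
    show ?case
    proof (cases "\<forall>i j. i < j \<longrightarrow> j < P \<longrightarrow> bsum F G P x < \<tau> * cdist ((F ^^ i) x) ((F ^^ j) x)")
      case True
      have "1 * bsum F G P x \<le> Q ^ Suc k * bsum F G P x"
        using one_le_power[OF Q1, of "Suc k"] nn[of P x] by (intro mult_right_mono) auto
      then show ?thesis using True Suc.prems by (intro exI[of _ P] exI[of _ x]) simp
    next
      case False
      then obtain i j where ij: "i < j" "j < P" "\<tau> * cdist ((F ^^ i) x) ((F ^^ j) x) \<le> bsum F G P x"
        by (force simp: not_less)
      obtain P1 x1 where P1: "1 \<le> P1" "2 * P1 \<le> P" "(F ^^ P1) x1 - x1 \<in> \<int>"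
        "bsum F G P1 x1 \<le> bsum F G P x + LG * KS * cdist ((F ^^ i) x) ((F ^^ j) x)"
        using halve_periodic_orbit[OF G Suc.prems(3) ij(1,2)] by blast
      have "cdist ((F ^^ i) x) ((F ^^ j) x) \<le> bsum F G P x / \<tau>" using ij(3) \<tau> by (simp add: field_simps)
      then have "LG * KS * cdist ((F ^^ i) x) ((F ^^ j) x) \<le> LG * KS * (bsum F G P x / \<tau>)"
        using lipschitz_on_nonneg[OF G(2)] KS_pos by (intro mult_left_mono) auto
      then have b1: "bsum F G P1 x1 \<le> Q * bsum F G P x" using P1(4) by (simp add: Q_def algebra_simps)
      have "P1 < 2 ^ k" using P1 Suc.prems by simp
      then obtain P' x' where *: "1 \<le> P'" "(F ^^ P') x' - x' \<in> \<int>" "bsum F G P' x' \<le> Q ^ k * bsum F G P1 x1"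
        "\<forall>i j. i < j \<longrightarrow> j < P' \<longrightarrow> bsum F G P' x' < \<tau> * cdist ((F ^^ i) x') ((F ^^ j) x')"
        using Suc.IH[OF P1(1) _ P1(3)] by blast
      have "Q ^ k * bsum F G P1 x1 \<le> Q ^ k * (Q * bsum F G P x)" using b1 Q1 by (intro mult_left_mono) auto
      then have "bsum F G P' x' \<le> Q ^ Suc k * bsum F G P x" using *(3) by (simp add: mult_ac)
      then show ?thesis using * by blast
    qed
  qed simp
  obtain K where K: "Q < 2 ^ K" using real_arch_pow[of 2 Q] by auto
  obtain P x where P: "1 \<le> P" "(F ^^ P) x - x \<in> \<int>" "real P ^ K * bsum F G P x \<le> \<tau> * D0 / 2 ^ K"
    using fast_periodic_approximation[OF G(1,2) z, of "\<tau> * D0 / 2 ^ K" K] \<tau> D0 by auto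
  obtain k where k: "2 ^ k \<le> P" "P < 2 ^ Suc k" using ex_power_ivl1[of 2 P] P(1) by auto
  obtain P' x' where *: "1 \<le> P'" "(F ^^ P') x' - x' \<in> \<int>" "bsum F G P' x' \<le> Q ^ Suc k * bsum F G P x"
    "\<And>i j. i < j \<Longrightarrow> j < P' \<Longrightarrow> bsum F G P' x' < \<tau> * cdist ((F ^^ i) x') ((F ^^ j) x')"
    using step[OF P(1) k(2) P(2)] by blast
  have "Q ^ Suc k \<le> (2 ^ K) ^ Suc k" using K Q1 by (intro power_mono) auto
  also have "\<dots> = 2 ^ K * (2 ^ k) ^ K" by (simp add: power_mult[symmetric] mult.commute)
  also have "\<dots> \<le> 2 ^ K * real P ^ K"
    using k(1) by (intro mult_left_mono power_mono) (auto simp flip: of_nat_power_le_of_nat_cancel_iff)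
  finally have "Q ^ Suc k * bsum F G P x \<le> 2 ^ K * real P ^ K * bsum F G P x"
    using nn[of P x] by (rule mult_right_mono)
  also have "\<dots> \<le> \<tau> * D0" using P(3) by (simp add: field_simps)
  finally have x0: "bsum F G P' x' \<le> \<tau> * D0" using *(3) by linarith
  define S where "S = (\<lambda>(i, j). cdist ((F ^^ i) x') ((F ^^ j) x')) ` {(i, j). i < j \<and> j < P'}"
  have "finite {(i, j). i < j \<and> j < P'}"
    by (rule finite_subset[of _ "{..<P'} \<times> {..<P'}"]) auto
  then have fin: "finite S" by (simp add: S_def)
  \<comment> \<open>\<open>D0\<close> is inserted both to cap \<open>D\<close> and to cover period
    1, where there are no pairs.\<close>
  define D where "D = Min (insert D0 S)"
  have "D \<in> insert D0 S" unfolding D_def using fin by (intro Min_in) auto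
  moreover have "bsum F G P' x' < \<tau> * s" if "s \<in> S" for s using that *(4) by (auto simp: S_def)
  moreover have "0 < s" if "s \<in> S" for s
    using \<open>s \<in> S \<Longrightarrow> bsum F G P' x' < \<tau> * s\<close>[OF that] nn[of P' x'] \<tau>
    by (smt (verit) zero_less_mult_pos)
  ultimately have "0 < D" "bsum F G P' x' \<le> \<tau> * D" using x0 D0 by (auto simp: less_imp_le)
  moreover have "D \<le> D0" unfolding D_def using fin by simp
  moreover have "D \<le> cdist ((F ^^ i) x') ((F ^^ j) x')" if "i < j" "j < P'" for i j
    unfolding D_def using fin that by (intro Min_le) (auto simp: S_def)
  ultimately show ?thesis using *(1,2) by blast
qed

end

subsection \<open>The locking argument\<close>

text \<open>Read backwards from \<open>n\<close>: a run outside \<open>A\<close> costs at most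
  \<open>\<gamma> / 2\<close>, and the index in \<open>A\<close> just before it earns \<gamma>, half
  of which pays for the run. Only a run at the very beginning is unpaid.\<close>

lemma run_decomposition_bound:
  fixes E :: "nat \<Rightarrow> real"
  assumes big: "\<And>i. i \<in> A \<Longrightarrow> \<gamma> \<le> E i" and \<gamma>: "0 \<le> \<gamma>"
    and small: "\<And>s t. s \<le> t \<Longrightarrow> (\<And>i. s \<le> i \<Longrightarrow> i < t \<Longrightarrow> i \<notin> A) \<Longrightarrow> - (\<gamma> / 2) \<le> sum E {s..<t}"
  shows "\<gamma> / 2 * card {i. i < n \<and> i \<in> A} - \<gamma> / 2 \<le> (\<Sum>i<n. E i)"
proof (induction n rule: less_induct)
  case (less n)
  define s where "s = (LEAST s. s \<le> n \<and> (\<forall>i. s \<le> i \<longrightarrow> i < n \<longrightarrow> i \<notin> A))"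
  have s: "s \<le> n \<and> (\<forall>i. s \<le> i \<longrightarrow> i < n \<longrightarrow> i \<notin> A)"
    unfolding s_def by (rule LeastI[of _ n]) auto
  have sm: "- (\<gamma> / 2) \<le> sum E {s..<n}" using s by (intro small) auto
  have cardn: "{i. i < n \<and> i \<in> A} = {i. i < s \<and> i \<in> A}" using s by (auto simp: not_less[symmetric])
  have split: "(\<Sum>i<n. E i) = (\<Sum>i<s. E i) + sum E {s..<n}"
    using s by (simp add: lessThan_atLeast0 sum.atLeastLessThan_concat)
  show ?case
  proof (cases s)
    case 0
    then have "{i. i < n \<and> i \<in> A} = {}" using cardn by auto
    then have c0: "card {i. i < n \<and> i \<in> A} = 0" by (simp only: card.empty)
    show ?thesis unfolding c0 using sm split 0 by simp
  next
    case (Suc r)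
    have r: "r \<in> A"
    proof (rule ccontr)
      assume "r \<notin> A"
      then have "r \<le> n \<and> (\<forall>i. r \<le> i \<longrightarrow> i < n \<longrightarrow> i \<notin> A)" using s Suc by (metis Suc_leD Suc_leI le_neq_implies_less)
      then have "s \<le> r" unfolding s_def by (rule Least_le)
      then show False using Suc by simp
    qed
    have "{i. i < s \<and> i \<in> A} = insert r {i. i < r \<and> i \<in> A}" using r Suc by auto
    then have "card {i. i < s \<and> i \<in> A} = Suc (card {i. i < r \<and> i \<in> A})" by simp
    moreover have "\<gamma> / 2 * card {i. i < r \<and> i \<in> A} - \<gamma> / 2 \<le> (\<Sum>i<r. E i)" using Suc s by (intro less) auto
    moreover have "(\<Sum>i<s. E i) = (\<Sum>i<r. E i) + E r" using Suc by simp
    ultimately show ?thesis using sm split cardn big[OF r] by (simp add: algebra_simps)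
  qed
qed

lemma infdist_lessD:
  assumes "infdist x A < r" "A \<noteq> {}"
  shows "\<exists>a\<in>A. \<bar>x - a\<bar> < (r::real)"
proof (rule ccontr)
  assume "\<not> ?thesis"
  then have "r \<le> infdist x A" using assms(2) unfolding infdist_def
    by (auto intro!: cINF_greatest simp: dist_real_def not_less)
  then show False using assms by simp
qed

context expanding_lift begin

text \<open>All integer translates are included, so that \<open>infdist\<close> to this set measures
  distance on the circle.\<close>

definition orbit_set :: "real \<Rightarrow> real set" where
  "orbit_set y = {(F ^^ i) y + of_int k | i k. True}"

lemma orbit_set_pow: "p \<in> orbit_set y \<Longrightarrow> (F ^^ l) p \<in> orbit_set y"
proof -
  assume "p \<in> orbit_set y"
  then obtain i k where "p = (F ^^ i) y + of_int k" by (auto simp: orbit_set_def)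
  then have "(F ^^ l) p = (F ^^ (l + i)) y + of_int (d ^ l * k)" by (simp only: deg_pow funpow_add o_apply)
  then show ?thesis unfolding orbit_set_def by blast
qed

lemma orbit_set_ne: "orbit_set y \<noteq> {}"
  unfolding orbit_set_def by blast

lemma periodic_orbit_mult:
  assumes "(F ^^ P) y - y \<in> \<int>"
  shows "(F ^^ (r + P * k)) y - (F ^^ r) y \<in> \<int>"
proof (induction k)
  case (Suc k)
  have "(F ^^ (r + P * Suc k)) y = (F ^^ (r + P * k)) ((F ^^ P) y)"
    by (simp add: funpow_apply add_ac)
  then have "(F ^^ (r + P * Suc k)) y - (F ^^ (r + P * k)) y \<in> \<int>" using deg_pow_diff[OF assms] by simp
  from Ints_add[OF this Suc] show ?case by simp
qed simp

lemma orbit_G_le: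
  assumes "(F ^^ P) y - y \<in> \<int>" "1 \<le> P" "periodic1 G" "\<And>x. 0 \<le> G x" "p \<in> orbit_set y"
  shows "G p \<le> bsum F G P y"
proof -
  obtain i k where p: "p = (F ^^ i) y + of_int k" using assms(5) by (auto simp: orbit_set_def)
  have "(F ^^ i) y - (F ^^ (i mod P)) y \<in> \<int>" using periodic_orbit_mult[OF assms(1), of "i mod P" "i div P"] by simp
  then have "G p = G ((F ^^ (i mod P)) y)" unfolding p periodic1_int[OF assms(3)] by (rule periodic1_diff_int[OF assms(3)])
  also have "\<dots> \<le> bsum F G P y" unfolding bsum_def using assms by (intro member_le_sum) auto
  finally show ?thesis .
qed

lemma bsum_coboundary:
  assumes "\<And>x. G x = f x - \<alpha> + u x - u (F x)"
  shows "bsum F f n x = n * \<alpha> + bsum F G n x + u ((F ^^ n) x) - u x"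
  by (induction n) (simp_all add: bsum_Suc assms algebra_simps)

end

text \<open>Closeness is left to the lemmas; the common degree \<open>d\<close> makes the iterates
  of both maps respond to an integer shift in the same way.\<close>

locale nearby_lifts = F: expanding_lift F d L C lam + H: expanding_lift H d LH CH lamH
  for F H d L C lam LH CH lamH
begin

text \<open>\<open>(H ^^ P) q\<close> and the shift of \<open>q\<close> by the winding integer of
  \<open>y\<close> have \<open>H\<close>-orbits within \<open>B\<close> of the same orbit of
  \<open>F\<close>; expansivity of \<open>H\<close> makes them equal.\<close>

lemma continued_orbit_periodic:
  assumes y: "(F ^^ P) y - y \<in> \<int>" and q: "\<And>i. \<bar>(H ^^ i) q - (F ^^ i) y\<bar> \<le> B"
  shows "(H ^^ P) q - q \<in> \<int>"
proof -
  obtain k where k: "(F ^^ P) y = y + of_int k" using y by (metis Ints_cases add.commute diff_add_cancel)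
  have "(H ^^ P) q = q + of_int k"
  proof (rule H.expansive)
    fix i
    have "(F ^^ (i + P)) y = (F ^^ i) y + of_int (d ^ i * k)"
      unfolding funpow_add o_apply k F.deg_pow ..
    then show "\<bar>(H ^^ i) ((H ^^ P) q) - (H ^^ i) (q + of_int k)\<bar> \<le> 2 * B"
      using q[of "i + P"] q[of i] unfolding H.deg_pow by (simp add: funpow_add)
  qed
  then show ?thesis by simp
qed

text \<open>The image of the orbit point being followed lies within \<open>D\<close> of the orbit
  point that is near at the next time, so by separation it is that point. A stretch near the orbit
  thus follows a single orbit point.\<close>

lemma tracking:
  assumes sep: "\<And>o1 o2. o1 \<in> F.orbit_set y \<Longrightarrow> o2 \<in> F.orbit_set y \<Longrightarrow> o1 \<noteq> o2 \<Longrightarrow> D \<le> \<bar>o1 - o2\<bar>"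
    and a: "\<And>x. \<bar>H x - F x\<bar> \<le> a" and \<rho>: "a + F.MD * \<rho> + \<rho> < D"
    and close: "\<And>l. l < N \<Longrightarrow> infdist ((H ^^ l) t) (F.orbit_set y) < \<rho>"
    and p: "p \<in> F.orbit_set y" "\<bar>t - p\<bar> < \<rho>" and l: "l < N"
  shows "\<bar>(H ^^ l) t - (F ^^ l) p\<bar> < \<rho>"
  using l
proof (induction l)
  case 0 then show ?case using p by simp
next
  case (Suc l)
  obtain p' where p': "p' \<in> F.orbit_set y" "\<bar>(H ^^ Suc l) t - p'\<bar> < \<rho>"
    using infdist_lessD[OF close[OF Suc.prems] F.orbit_set_ne] by blast
  have "\<bar>F ((H ^^ l) t) - F ((F ^^ l) p)\<bar> \<le> F.MD * \<bar>(H ^^ l) t - (F ^^ l) p\<bar>"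
    by (rule lipschitz_realD[OF F.F_lip])
  also have "\<dots> \<le> F.MD * \<rho>" using Suc F.MD_pos by (intro mult_left_mono) auto
  finally have "\<bar>(H ^^ Suc l) t - (F ^^ Suc l) p\<bar> \<le> a + F.MD * \<rho>" using a[of "(H ^^ l) t"] by simp
  then have "\<bar>p' - (F ^^ Suc l) p\<bar> < D" using p'(2) \<rho> by linarith
  then have "p' = (F ^^ Suc l) p" using sep[OF p'(1) F.orbit_set_pow[OF p(1), of "Suc l"]] by force
  then show ?case using p' by simp
qed

text \<open>The terms \<open>E\<close> of the proof differ from \<open>H.phi - \<Lambda>\<close> by
  a coboundary and by deferred payments, at a cost bounded in \<open>n\<close>. Off \<open>J\<close>
  they are at least \<open>b\<close> times the truncated distance to the orbit minus
  \<open>c2 * a\<close>: nonnegative from \<theta> on, at least \<gamma> from \<open>D / K1\<close>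
  on. Stretches closer than \<open>D / K1\<close> are summed as a whole, and
  \<open>run_decomposition_bound\<close> combines both.\<close>

lemma locking:
  assumes u: "periodic1 u" "Lu-lipschitz_on UNIV u"
    and Gdef: "\<And>x. G x = F.phi x - \<alpha> + u x - u (F x)"
    and G: "periodic1 G" "LG-lipschitz_on UNIV G" "\<And>x. 0 \<le> G x"
    and P: "1 \<le> P" and y: "(F ^^ P) y - y \<in> \<int>" and D: "0 < D"
    and sep: "\<And>o1 o2. o1 \<in> F.orbit_set y \<Longrightarrow> o2 \<in> F.orbit_set y \<Longrightarrow> o1 \<noteq> o2 \<Longrightarrow> D \<le> \<bar>o1 - o2\<bar>"
    and a: "\<And>x. \<bar>H x - F x\<bar> \<le> a"
    and q: "\<And>i. \<bar>(H ^^ i) q - (F ^^ i) y\<bar> \<le> aq"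
    and \<delta>: "\<And>i. \<bar>H.phi ((H ^^ i) q) - F.phi ((F ^^ i) y)\<bar> \<le> \<delta>"
    and J: "\<And>z x. z \<in> J \<Longrightarrow> \<bar>x - z\<bar> \<le> F.KS * a \<Longrightarrow> \<eta> \<le> G ((F ^^ m) x)"
    and off: "\<And>z. z \<notin> J \<Longrightarrow> b * min (infdist z (F.orbit_set y)) (D / 8) - c1 * a \<le> H.phi z - F.phi z"
    and on: "\<And>z. z \<in> J \<Longrightarrow> - (\<eta> / 4) \<le> H.phi z - F.phi z"
    and far: "\<And>z. infdist z (F.orbit_set y) < D / 8 \<Longrightarrow> z \<notin> J"
    and b: "0 < b" and K1: "8 \<le> K1" "a + F.MD * D / K1 + D / K1 < D"
    and c2: "c2 = c1 + F.Lphi * F.KS + 1" "0 \<le> c1"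
    and \<xi>: "\<xi> = bsum F G P y" "\<xi> + \<delta> \<le> a"
    and \<gamma>: "\<gamma> = b * D / (2 * K1)" "c2 * a \<le> \<gamma>" "\<gamma> \<le> \<eta> / 4 - c2 * a"
    and n2: "\<xi> + LG * (F.KS * a + D / K1) < \<eta>"
    and \<theta>: "\<theta> = c2 * a / b" "\<theta>2 = H.MD * (\<theta> + aq)"
    and n3: "H.Lphi * H.KK * \<theta>2 + \<xi> + 2 * P * \<delta> + Lu * (F.KS * a + a + F.MD * \<theta>)
      + Lu * (F.KS * a + H.KK * \<theta>2 + aq) \<le> \<gamma> / 2"
    and \<Lambda>: "\<Lambda> = bsum H H.phi P q / P"
  shows "\<exists>B. \<forall>n z. \<gamma> / 2 * card {i. i < n \<and> D / K1 \<le> infdist ((H ^^ i) z) (F.orbit_set y)} - B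
    \<le> bsum H H.phi n z - n * \<Lambda>"
proof -
  let ?Os = "F.orbit_set y"
  have a0: "0 \<le> a" using a[of 0] by linarith
  have \<delta>0: "0 \<le> \<delta>" using \<delta>[of 0] by linarith
  have aq0: "0 \<le> aq" using q[of 0] by linarith
  have nnG: "0 \<le> bsum F G n x" for n x unfolding bsum_def using G(3) by (intro sum_nonneg) auto
  have \<xi>0: "0 \<le> \<xi>" using nnG \<xi> by simp
  have Lu0: "0 \<le> Lu" using u(2) by (rule lipschitz_on_nonneg)
  have LG0: "0 \<le> LG" using G(2) by (rule lipschitz_on_nonneg)
  have Lphi0: "0 \<le> F.Lphi" using F.phi_lip by (rule lipschitz_on_nonneg)
  have \<gamma>0: "0 < \<gamma>" unfolding \<gamma>(1) using b D K1 by simp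
  have "0 \<le> c2 * a" using c2 a0 Lphi0 F.KS_pos by simp
  then have \<eta>0: "0 < \<eta>" using \<gamma>(3) \<gamma>0 by linarith
  have qper: "(H ^^ P) q - q \<in> \<int>" by (rule continued_orbit_periodic[OF y q])
  have cob: "bsum F F.phi n x = n * \<alpha> + bsum F G n x + u ((F ^^ n) x) - u x" for n x
    by (rule F.bsum_coboundary) (rule Gdef)
  have cmp: "\<bar>bsum H H.phi n ((H ^^ j) q) - bsum F F.phi n ((F ^^ j) y)\<bar> \<le> n * \<delta>" for n j
  proof -
    have "\<bar>bsum H H.phi n ((H ^^ j) q) - bsum F F.phi n ((F ^^ j) y)\<bar>
      \<le> (\<Sum>i<n. \<bar>H.phi ((H ^^ i) ((H ^^ j) q)) - F.phi ((F ^^ i) ((F ^^ j) y))\<bar>)"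
      unfolding bsum_def sum_subtractf[symmetric] by (rule sum_abs)
    also have "\<dots> \<le> (\<Sum>i<n. \<delta>)"
      by (rule sum_mono) (use \<delta> in \<open>simp add: funpow_apply\<close>)
    finally show ?thesis by simp
  qed
  have \<Lambda>_le: "\<Lambda> \<le> \<alpha> + \<xi> / P + \<delta>"
  proof -
    have "u ((F ^^ P) y) = u y" by (rule periodic1_diff_int[OF u(1) y])
    then have "bsum F F.phi P y = P * \<alpha> + \<xi>" using cob[of P y] \<xi> by simp
    then have "bsum H H.phi P q \<le> P * \<alpha> + \<xi> + P * \<delta>" using cmp[of P 0] by simp
    then show ?thesis unfolding \<Lambda> using P by (simp add: field_simps)
  qed
  have \<xi>P: "\<xi> / P \<le> \<xi>" using \<xi>0 P by (simp add: divide_le_eq mult_le_cancel_left1)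
  define w where "w x = H.phi x - \<Lambda>" for x
  have bw: "bsum H w n x = bsum H H.phi n x - n * \<Lambda>" for n x
    by (simp add: bsum_def w_def sum_subtractf)
  have wper: "periodic1 w" using H.phi_periodic by (simp add: w_def periodic1_def)
  have full: "bsum H w P ((H ^^ c) q) = 0" for c
  proof (induction c)
    case 0 show ?case using P by (simp add: bw \<Lambda>)
  next
    case (Suc c)
    have "bsum H w (Suc P) ((H ^^ c) q) = bsum H w P ((H ^^ c) q) + w ((H ^^ P) ((H ^^ c) q))" by (rule bsum_Suc)
    moreover have "bsum H w (1 + P) ((H ^^ c) q) = w ((H ^^ c) q) + bsum H w P ((H ^^ Suc c) q)"
      unfolding bsum_add by (simp add: bsum_def)
    moreover have "w ((H ^^ P) ((H ^^ c) q)) = w ((H ^^ c) q)"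
    proof (rule periodic1_diff_int[OF wper])
      show "(H ^^ P) ((H ^^ c) q) - (H ^^ c) q \<in> \<int>"
        using H.periodic_orbit_mult[OF qper, of c 1] by (simp add: funpow_apply add.commute)
    qed
    ultimately show ?case using Suc by simp
  qed
  have fulls: "bsum H w (P * k) ((H ^^ c) q) = 0" for k c
  proof (induction k)
    case (Suc k)
    have "bsum H w (P * k + P) ((H ^^ c) q) = 0"
      unfolding bsum_add using Suc full[of "P * k + c"] by (simp add: funpow_add)
    then show ?case by (simp add: add.commute)
  qed simp
  \<comment> \<open>Full periods contribute 0 by the choice of \<Lambda>, so only the remainder
    \<open>r < P\<close> counts and the loss does not depend on \<open>N\<close>. This is the origin
    of \<open>2 * P * \<delta>\<close>.\<close>
  have orbit_phase: "u ((F ^^ (j + N)) y) - u ((F ^^ j) y) - \<xi> - 2 * P * \<delta> \<le> bsum H w N ((H ^^ j) q)" for N j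
  proof -
    define r where "r = N mod P"
    define k where "k = N div P"
    have N: "N = r + P * k" by (simp add: r_def k_def)
    have rP: "real r \<le> P" unfolding r_def using P by simp
    have "bsum H w N ((H ^^ j) q) = bsum H w r ((H ^^ j) q)"
      unfolding N bsum_add using fulls[of k "r + j"] by (simp add: funpow_add)
    also have "\<dots> \<ge> bsum F F.phi r ((F ^^ j) y) - r * \<delta> - r * \<Lambda>" unfolding bw using cmp[of r j] by linarith
    finally have 1: "bsum F F.phi r ((F ^^ j) y) - r * \<delta> - r * \<Lambda> \<le> bsum H w N ((H ^^ j) q)" .
    have "(F ^^ r) ((F ^^ j) y) = (F ^^ (j + r)) y" by (simp add: funpow_apply add.commute)
    moreover have "u ((F ^^ (j + N)) y) = u ((F ^^ (j + r)) y)"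
      using periodic1_diff_int[OF u(1) F.periodic_orbit_mult[OF y, of "j + r" k]] by (simp add: N add.assoc)
    ultimately have 2: "bsum F F.phi r ((F ^^ j) y) \<ge> r * \<alpha> + u ((F ^^ (j + N)) y) - u ((F ^^ j) y)"
      using cob[of r "(F ^^ j) y"] nnG[of r "(F ^^ j) y"] by simp
    have "r * \<Lambda> \<le> r * (\<alpha> + \<xi> / P + \<delta>)" using \<Lambda>_le by (intro mult_left_mono) auto
    also have "\<dots> = r * \<alpha> + r * (\<xi> / P) + r * \<delta>" by (simp add: algebra_simps)
    also have "r * (\<xi> / P) \<le> P * (\<xi> / P)" using rP \<xi>0 by (intro mult_right_mono) auto
    also have "P * (\<xi> / P) = \<xi>" using P by simp
    finally have 3: "r * \<Lambda> \<le> r * \<alpha> + \<xi> + r * \<delta>" by simp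
    have "r * \<delta> \<le> P * \<delta>" using rP \<delta>0 by (intro mult_right_mono) auto
    then show ?thesis using 1 2 3 by linarith
  qed
  have \<theta>0: "0 \<le> \<theta>" unfolding \<theta> using c2 a0 b Lphi0 F.KS_pos by simp
  have c2a: "c2 * a = b * \<theta>" unfolding \<theta> using b by simp
  have \<theta>D: "\<theta> \<le> D / (2 * K1)" 
  proof -
    have "b * \<theta> \<le> b * (D / (2 * K1))" using \<gamma>(1,2) c2a by simp
    then show ?thesis using b by (rule mult_left_le_imp_le)
  qed
  have DK: "D / K1 \<le> D / 8" "0 < D / K1" using K1 D by (auto simp: field_simps)
  have \<theta>20: "0 \<le> \<theta>2" unfolding \<theta>(2) using H.MD_pos \<theta>0 aq0 by simp
  obtain Bu where Bu: "\<And>x. \<bar>u x\<bar> \<le> Bu"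
    using periodic1_bounded[OF u(1) lipschitz_on_continuous_on[OF u(2)]] by blast
  define B where "B = 2 * Bu + m * (\<eta> / 2) + \<gamma> / 2"
  have "\<gamma> / 2 * card {i. i < n \<and> D / K1 \<le> infdist ((H ^^ i) z0) ?Os} - B \<le> bsum H H.phi n z0 - n * \<Lambda>" for n z0
  proof -
    define z where "z i = (H ^^ i) z0" for i
    have zS: "z (s + l) = (H ^^ l) (z s)" for s l
      unfolding z_def by (subst add.commute) (simp add: funpow_add)
    \<comment> \<open>\<open>u\<close> and \<open>G\<close> are evaluated along a true orbit
      \<open>x\<close> of \<open>F\<close> that shadows the orbit of \<open>H\<close>, so that the
      coboundary telescopes exactly.\<close>
    have "\<bar>F (z i) - z (Suc i)\<bar> \<le> a" for i using a[of "z i"] by (simp add: z_def abs_minus_commute)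
    then obtain x0 where x0: "\<And>i. \<bar>(F ^^ i) x0 - z i\<bar> \<le> F.KS * a" using F.shadow_exists[of z a] by blast
    define x where "x i = (F ^^ i) x0" for i
    have x: "\<bar>x i - z i\<bar> \<le> F.KS * a" for i using x0 by (simp add: x_def)
    have xS: "x (s + l) = (F ^^ l) (x s)" for s l
      unfolding x_def by (subst add.commute) (simp add: funpow_add)
    \<comment> \<open>On \<open>J\<close> the perturbation may cost \<open>\<eta> / 4\<close>. An
      advance \<open>v\<close> of \<open>\<eta> / 2\<close> is credited there and charged as
      \<open>vp\<close> after \<open>m\<close> steps, when \<open>G\<close> along \<open>x\<close>
      is at least \<eta>.\<close>
    define v where "v i = (if z i \<in> J then \<eta> / 2 else 0)" for i
    define vp where "vp i = (if i < m then 0 else v (i - m))" for i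
    have v0: "0 \<le> v i" "v i \<le> \<eta> / 2" for i using \<eta>0 by (auto simp: v_def)
    have vpG: "vp i \<le> G (x i) \<and> (vp i \<noteq> 0 \<longrightarrow> \<eta> \<le> G (x i))" for i
    proof (cases "i < m \<or> z (i - m) \<notin> J")
      case True then show ?thesis using G(3) by (auto simp: vp_def v_def)
    next
      case False
      then have "\<eta> \<le> G ((F ^^ m) (x (i - m)))" using J[OF _ x] by blast
      then have "\<eta> \<le> G (x i)" using xS[of "i - m" m] False by simp
      then show ?thesis using \<eta>0 v0(2)[of "i - m"] False by (auto simp: vp_def)
    qed
    define E where "E i = H.phi (z i) - \<Lambda> - (u (x (Suc i)) - u (x i)) - (vp i - v i)" for i
    \<comment> \<open>The loss \<open>F.Lphi * F.KS * a\<close> comes from replacing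
      \<open>z i\<close> by \<open>x i\<close>, the further \<open>a\<close> from \<Lambda>
      exceeding \<alpha> by at most \<xi> + \<delta>.\<close>
    have base: "H.phi (z i) - F.phi (z i) + (G (x i) - vp i) + v i - (F.Lphi * F.KS + 1) * a \<le> E i" for i
    proof -
      have "F.Lphi * \<bar>x i - z i\<bar> \<le> F.Lphi * (F.KS * a)" using x Lphi0 by (intro mult_left_mono) auto
      then have "F.phi (x i) - F.Lphi * F.KS * a \<le> F.phi (z i)"
        using lipschitz_realD[OF F.phi_lip, of "x i" "z i"] by (simp add: mult.assoc) 
      moreover have "F.phi (x i) = G (x i) + \<alpha> + u (x (Suc i)) - u (x i)"
        using Gdef[of "x i"] xS[of i 1] by simp
      ultimately show ?thesis using \<Lambda>_le \<xi>P \<xi>(2) unfolding E_def by (simp add: algebra_simps)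
    qed
    have Eoff: "b * min (infdist (z i) ?Os) (D / 8) - c2 * a \<le> E i" if "z i \<notin> J" for i
    proof -
      have "vp i \<le> G (x i)" using vpG by blast
      then show ?thesis using base[of i] off[OF that] that unfolding c2(1) by (simp add: v_def algebra_simps)
    qed
    have Eon: "\<eta> / 4 - c2 * a \<le> E i" if "z i \<in> J" for i
    proof -
      have "vp i \<le> G (x i)" using vpG by blast
      moreover have "0 \<le> c1 * a" using c2 a0 by simp
      ultimately show ?thesis using base[of i] on[OF that] that unfolding c2(1) by (simp add: v_def algebra_simps)
    qed
    have Epos: "0 \<le> E i" if "\<theta> \<le> infdist (z i) ?Os" for i
    proof (cases "z i \<in> J")
      case True then show ?thesis using Eon[OF True] \<gamma> \<gamma>0 by linarith
    next
      case False
      have "D / (2 * K1) \<le> D / K1" using D K1 by (simp add: field_simps)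
      then have "\<theta> \<le> D / 8" using \<theta>D DK by linarith
      then have "b * \<theta> \<le> b * min (infdist (z i) ?Os) (D / 8)" using that b by (intro mult_left_mono) auto
      then show ?thesis using Eoff[OF False] c2a by linarith
    qed
    have Ebig: "\<gamma> \<le> E i" if "D / K1 \<le> infdist (z i) ?Os" for i
    proof (cases "z i \<in> J")
      case True then show ?thesis using Eon[OF True] \<gamma> by linarith
    next
      case False
      have "b * (D / K1) \<le> b * min (infdist (z i) ?Os) (D / 8)" using that b DK by (intro mult_left_mono) auto
      moreover have "b * (D / K1) = 2 * \<gamma>" unfolding \<gamma>(1) by simp
      ultimately show ?thesis using Eoff[OF False] \<gamma>(2) by linarith
    qed
    have Erun: "- (\<gamma> / 2) \<le> sum E {s..<t}"
      if st: "s \<le> t" "\<And>i. s \<le> i \<Longrightarrow> i < t \<Longrightarrow> infdist (z i) ?Os < D / K1" for s t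
    proof (cases "\<exists>i. s \<le> i \<and> i < t \<and> infdist (z i) ?Os < \<theta>")
      case False
      then have "0 \<le> sum E {s..<t}" by (intro sum_nonneg Epos) (auto simp: not_less)
      then show ?thesis using \<gamma>0 by linarith
    next
      case True
      define I where "I = {i. s \<le> i \<and> i < t \<and> infdist (z i) ?Os < \<theta>}"
      have finI: "finite I" unfolding I_def by (rule finite_subset[of _ "{..<t}"]) auto
      \<comment> \<open>After \<open>e\<close>, the last time closer than \<theta>, all terms are
        nonnegative. Up to \<open>e\<close> the run is compared with the continued orbit: the
        distance at its end is controlled by \<theta>, the distance at its start then by contraction
        of the inverse branches of \<open>H\<close>.\<close>
      define e where "e = Max I"
      have "e \<in> I" unfolding e_def using True finI by (intro Max_in) (auto simp: I_def)
      then have e: "s \<le> e" "e < t" "infdist (z e) ?Os < \<theta>" by (auto simp: I_def)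
      have after: "\<theta> \<le> infdist (z i) ?Os" if "e < i" "i < t" for i
      proof (rule ccontr)
        assume "\<not> ?thesis"
        then have "i \<in> I" using that e by (auto simp: I_def)
        then have "i \<le> e" unfolding e_def using finI by simp
        then show False using that by simp
      qed
      define N where "N = Suc e - s"
      have N: "s + N = Suc e" "s + (N - 1) = e" "1 \<le> N" using e by (auto simp: N_def)
      obtain p where p: "p \<in> ?Os" "\<bar>z s - p\<bar> < D / K1"
        using infdist_lessD[OF st(2)[of s] F.orbit_set_ne] e by auto
      have track: "\<bar>z (s + l) - (F ^^ l) p\<bar> < D / K1" if "l < N" for l
        unfolding zS
      proof (rule tracking[where D=D and a=a and y=y and N=N])
        show "a + F.MD * (D / K1) + D / K1 < D" using K1(2) by simp
        show "infdist ((H ^^ l) (z s)) ?Os < D / K1" if "l < N" for l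
          unfolding zS[symmetric] using that e by (intro st(2)) (auto simp: N_def)
      qed (fact sep a p that)+
      have last: "\<bar>z e - (F ^^ (N - 1)) p\<bar> < \<theta>"
      proof -
        obtain p' where p': "p' \<in> ?Os" "\<bar>z e - p'\<bar> < \<theta>" using infdist_lessD[OF e(3) F.orbit_set_ne] by blast
        have "D / (2 * K1) \<le> D / K1" using D K1 by (simp add: field_simps)
        then have "\<bar>p' - (F ^^ (N - 1)) p\<bar> < 2 * (D / K1)" using p'(2) track[of "N - 1"] N \<theta>D by auto
        also have "\<dots> < D" using K1 D by (simp add: field_simps)
        finally have "p' = (F ^^ (N - 1)) p" using sep[OF p'(1) F.orbit_set_pow[OF p(1), of "N - 1"]] by force
        then show ?thesis using p' by simp
      qed
      obtain j k where jk: "p = (F ^^ j) y + of_int k" using p(1) by (auto simp: F.orbit_set_def)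
      define qo where "qo = (H ^^ j) q + of_int k"
      have qo: "\<bar>(H ^^ l) qo - (F ^^ l) p\<bar> \<le> aq" for l
        using q[of "l + j"] unfolding qo_def jk H.deg_pow F.deg_pow by (simp add: funpow_add)
      have zN: "z (s + N) = H (z e)" using N zS[of e 1] by simp
      have end1: "\<bar>(H ^^ N) (z s) - (H ^^ N) qo\<bar> \<le> \<theta>2"
      proof -
        have N': "N = Suc (N - 1)" using N by simp
        have "(H ^^ N) t = H ((H ^^ (N - 1)) t)" for t by (subst N') simp
        then have "\<bar>(H ^^ N) (z s) - (H ^^ N) qo\<bar> \<le> H.MD * \<bar>(H ^^ (N - 1)) (z s) - (H ^^ (N - 1)) qo\<bar>"
          using lipschitz_realD[OF H.F_lip] by simp
        also have "\<dots> \<le> \<theta>2" unfolding \<theta>(2)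
        proof (intro mult_left_mono)
          have "(H ^^ (N - 1)) (z s) = z e" using zS[of s "N - 1"] N(2) by simp
          then show "\<bar>(H ^^ (N - 1)) (z s) - (H ^^ (N - 1)) qo\<bar> \<le> \<theta> + aq"
            using last qo[of "N - 1"] by linarith
        qed (simp add: H.MD_pos less_imp_le)
        finally show ?thesis .
      qed
      have S1: "bsum H w N qo - H.Lphi * H.KK * \<theta>2 \<le> bsum H w N (z s)"
      proof -
        have HL: "0 \<le> H.Lphi * H.KK" using H.KK_pos lipschitz_on_nonneg[OF H.phi_lip] by simp
        have "\<bar>bsum H H.phi N (z s) - bsum H H.phi N qo\<bar> \<le> H.Lphi * H.KK * \<bar>(H ^^ N) (z s) - (H ^^ N) qo\<bar>"
          by (rule H.distortion[OF H.phi_lip])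
        also have "\<dots> \<le> H.Lphi * H.KK * \<theta>2" using end1 HL by (rule mult_left_mono)
        finally show ?thesis unfolding bw by linarith
      qed
      have S2: "bsum H w N qo = bsum H w N ((H ^^ j) q)"
        unfolding qo_def by (rule periodic1_int[OF H.bsum_periodic1[OF wper]])
      have uo: "u ((F ^^ (j + N)) y) = u ((F ^^ N) p)" "u ((F ^^ j) y) = u p"
        unfolding jk F.deg_pow periodic1_int[OF u(1)] by (simp_all add: funpow_add add.commute[of j])
      have m1: "\<bar>u (x (s + N)) - u ((F ^^ N) p)\<bar> \<le> Lu * (F.KS * a + a + F.MD * \<theta>)"
      proof -
        have "(F ^^ N) p = F ((F ^^ (N - 1)) p)" using N(3) by (cases N) auto
        moreover have "\<bar>F (z e) - F ((F ^^ (N - 1)) p)\<bar> \<le> F.MD * \<bar>z e - (F ^^ (N - 1)) p\<bar>"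
          by (rule lipschitz_realD[OF F.F_lip])
        moreover have "F.MD * \<bar>z e - (F ^^ (N - 1)) p\<bar> \<le> F.MD * \<theta>" using last F.MD_pos by (intro mult_left_mono) auto
        ultimately have "\<bar>x (s + N) - (F ^^ N) p\<bar> \<le> F.KS * a + a + F.MD * \<theta>"
          using x[of "s + N"] a[of "z e"] zN by linarith
        then have "Lu * \<bar>x (s + N) - (F ^^ N) p\<bar> \<le> Lu * (F.KS * a + a + F.MD * \<theta>)" using Lu0 by (rule mult_left_mono)
        then show ?thesis using lipschitz_realD[OF u(2), of "x (s + N)" "(F ^^ N) p"] by linarith
      qed
      have m2: "\<bar>u (x s) - u p\<bar> \<le> Lu * (F.KS * a + H.KK * \<theta>2 + aq)"
      proof -
        have "\<bar>z s - qo\<bar> \<le> H.ct N * \<bar>(H ^^ N) (z s) - (H ^^ N) qo\<bar>" by (rule H.contract)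
        also have "\<dots> \<le> H.KK * \<theta>2" using end1 H.ct_le_KK H.ct_pos[of N] \<theta>20 by (intro mult_mono) (auto simp: H.KK_pos less_imp_le)
        finally have "\<bar>x s - p\<bar> \<le> F.KS * a + H.KK * \<theta>2 + aq" using x[of s] qo[of 0] by simp
        then have "Lu * \<bar>x s - p\<bar> \<le> Lu * (F.KS * a + H.KK * \<theta>2 + aq)" using Lu0 by (rule mult_left_mono)
        then show ?thesis using lipschitz_realD[OF u(2), of "x s" p] by linarith
      qed
      \<comment> \<open>Near the orbit \<open>J\<close> is absent and \<open>G\<close> along
        \<open>x\<close> is below \<eta>, so the run receives neither advances nor charges.\<close>
      have vz: "v i = 0 \<and> vp i = 0" if i: "s \<le> i" "i \<le> e" for i
      proof -
        have "infdist (z i) ?Os < D / 8" using st(2)[of i] i e DK by linarith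
        then have 1: "v i = 0" using far by (simp add: v_def)
        have "vp i = 0"
        proof (rule ccontr)
          assume "vp i \<noteq> 0"
          then have "\<eta> \<le> G (x i)" using vpG by blast
          moreover have "\<bar>G (x i) - G ((F ^^ (i - s)) p)\<bar> \<le> LG * \<bar>x i - (F ^^ (i - s)) p\<bar>"
            by (rule lipschitz_realD[OF G(2)])
          moreover have "LG * \<bar>x i - (F ^^ (i - s)) p\<bar> \<le> LG * (F.KS * a + D / K1)"
          proof (intro mult_left_mono LG0)
            have "i - s < N" "s + (i - s) = i" using i e by (auto simp: N_def)
            then show "\<bar>x i - (F ^^ (i - s)) p\<bar> \<le> F.KS * a + D / K1"
              using x[of i] track[of "i - s"] by simp
          qed
          moreover have "G ((F ^^ (i - s)) p) \<le> \<xi>"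
            unfolding \<xi>(1) by (rule F.orbit_G_le[OF y P G(1,3) F.orbit_set_pow[OF p(1)]])
          ultimately show False using n2 by linarith
        qed
        then show ?thesis using 1 by simp
      qed
      have "sum E {s..<s + N} = (\<Sum>l<N. E (s + l))"
        by (rule sum.reindex_bij_witness[of _ "\<lambda>l. s + l" "\<lambda>i. i - s"]) auto
      also have "\<dots> = (\<Sum>l<N. w (z (s + l)) - (u (x (s + Suc l)) - u (x (s + l))))"
      proof (rule sum.cong)
        fix l assume "l \<in> {..<N}"
        then have "v (s + l) = 0 \<and> vp (s + l) = 0" using N by (intro vz) auto
        then show "E (s + l) = w (z (s + l)) - (u (x (s + Suc l)) - u (x (s + l)))" by (simp add: E_def w_def)
      qed simp
      also have "\<dots> = bsum H w N (z s) - (\<Sum>l<N. u (x (s + Suc l)) - u (x (s + l)))"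
        unfolding sum_subtractf bsum_def zS by simp
      also have "(\<Sum>l<N. u (x (s + Suc l)) - u (x (s + l))) = u (x (s + N)) - u (x s)"
        using sum_lessThan_telescope[of "\<lambda>l. u (x (s + l))" N] by simp
      finally have "- (\<gamma> / 2) \<le> sum E {s..<s + N}"
        using S1 S2 orbit_phase[where j=j and N=N] uo m1 m2 n3 by linarith
      moreover have "sum E {s..<t} = sum E {s..<s + N} + sum E {s + N..<t}"
        by (rule sum.atLeastLessThan_concat[symmetric]) (use N(1) e(2) in linarith)+
      moreover have "0 \<le> sum E {s + N..<t}" using N after by (intro sum_nonneg Epos) auto
      ultimately show ?thesis by linarith
    qed
    have lower: "\<gamma> / 2 * card {i. i < n \<and> i \<in> {i. D / K1 \<le> infdist (z i) ?Os}} - \<gamma> / 2 \<le> (\<Sum>i<n. E i)"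
    proof (rule run_decomposition_bound)
      show "\<gamma> \<le> E i" if "i \<in> {i. D / K1 \<le> infdist (z i) ?Os}" for i using that Ebig by simp
      show "0 \<le> \<gamma>" using \<gamma>0 by simp
      show "- (\<gamma> / 2) \<le> sum E {s..<t}"
        if "s \<le> t" "\<And>i. s \<le> i \<Longrightarrow> i < t \<Longrightarrow> i \<notin> {i. D / K1 \<le> infdist (z i) ?Os}" for s t
        by (rule Erun[OF that(1)]) (use that(2) in \<open>simp add: not_le\<close>)
    qed
    have "(\<Sum>i<n. E i) = bsum H w n z0 - (\<Sum>i<n. u (x (Suc i)) - u (x i)) - ((\<Sum>i<n. vp i) - (\<Sum>i<n. v i))"
      unfolding E_def bsum_def w_def z_def by (simp add: sum_subtractf)
    also have "(\<Sum>i<n. u (x (Suc i)) - u (x i)) = u (x n) - u (x 0)"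
      by (rule sum_lessThan_telescope)
    finally have Esum: "(\<Sum>i<n. E i) = bsum H w n z0 - (u (x n) - u (x 0)) - ((\<Sum>i<n. vp i) - (\<Sum>i<n. v i))" .
    \<comment> \<open>Charges are advances shifted by \<open>m\<close>; only the advances of the
      last \<open>m\<close> steps are still uncharged at time \<open>n\<close>.\<close>
    have "(\<Sum>i<n. v i) \<le> (\<Sum>i<n. vp i) + m * (\<eta> / 2)"
    proof -
      have vs: "(\<Sum>i<n. vp i) = (\<Sum>i<n - m. v i)"
      proof (cases "m \<le> n")
        case True
        have "(\<Sum>i<n. vp i) = (\<Sum>i<m. vp i) + (\<Sum>i = m..<n. vp i)"
          using True by (simp add: lessThan_atLeast0 sum.atLeastLessThan_concat)
        also have "(\<Sum>i<m. vp i) = 0" by (simp add: vp_def)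
        also have "(\<Sum>i = m..<n. vp i) = (\<Sum>i<n - m. v i)"
          by (rule sum.reindex_bij_witness[of _ "\<lambda>i. i + m" "\<lambda>i. i - m"]) (auto simp: vp_def)
        finally show ?thesis by simp
      qed (simp add: vp_def)
      have "(\<Sum>i<n. v i) = (\<Sum>i<n - m. v i) + (\<Sum>i = n - m..<n. v i)"
        by (simp add: lessThan_atLeast0 sum.atLeastLessThan_concat)
      also have "(\<Sum>i = n - m..<n. v i) \<le> (\<Sum>i = n - m..<n. \<eta> / 2)" by (intro sum_mono v0)
      also have "\<dots> = real (n - (n - m)) * (\<eta> / 2)" by simp
      also have "\<dots> \<le> m * (\<eta> / 2)" using \<eta>0 by (intro mult_right_mono) auto
      finally show ?thesis using vs by simp
    qed
    then have "bsum H w n z0 \<ge> (\<Sum>i<n. E i) - 2 * Bu - m * (\<eta> / 2)"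
      using Esum Bu[of "x n"] Bu[of "x 0"] by linarith
    then show ?thesis using lower unfolding B_def bw z_def by simp
  qed
  then show ?thesis by blast
qed

end

subsection \<open>From Birkhoff sums to invariant measures\<close>

lemma unit_interval_diff_int:
  fixes a b :: real
  assumes "a \<in> {0..<1}" "b \<in> {0..<1}" "a - b \<in> \<int>" shows "a = b"
proof -
  obtain k where "a - b = of_int k" using assms(3) by (auto elim: Ints_cases)
  moreover from this have "k = 0" using assms(1,2) by auto
  ultimately show ?thesis by simp
qed

definition uniquely_locked :: "(real \<Rightarrow> real) \<Rightarrow> bool" where
  "uniquely_locked F \<longleftrightarrow> (\<exists>!M. lyap_minimizing F M) \<and>
     (\<forall>M. lyap_minimizing F M \<longrightarrow> supported_on_periodic_orbit F M)"

context expanding_lift begin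

lemma circ_measurable: "circ_map F \<in> borel_measurable borel"
proof -
  have "F \<in> borel_measurable borel" by (rule borel_measurable_continuous_onI[OF cont])
  then have "(\<lambda>x. F x - real_of_int \<lfloor>F x\<rfloor>) \<in> borel_measurable borel"
    by (intro borel_measurable_diff measurable_compose[OF _ borel_measurable_real_floor])
  then show ?thesis unfolding circ_map_def[abs_def] frac_def .
qed

lemma circ_pow_measurable: "circ_map F ^^ n \<in> borel_measurable borel"
proof (induction n)
  case (Suc n) show ?case using measurable_comp[OF Suc circ_measurable] by (simp add: comp_def)
qed (simp add: id_def)

lemma invariant_pow:
  assumes "invariant_prob F M" shows "distr M borel (circ_map F ^^ n) = M"
proof (induction n)
  case 0
  have "sets borel = sets M" using assms by (simp add: invariant_prob_def)
  then show ?case by (simp add: id_def distr_id2)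
next
  case (Suc n)
  have sM: "sets M = sets borel" using assms by (simp add: invariant_prob_def)
  have "distr M borel (circ_map F ^^ Suc n) = distr (distr M borel (circ_map F ^^ n)) borel (circ_map F)"
    using circ_measurable circ_pow_measurable[of n] sM
    by (simp add: distr_distr measurable_cong_sets[OF sM refl])
  then show ?case unfolding Suc using assms by (simp only: invariant_prob_def)
qed

lemma invariant_integral:
  fixes f :: "real \<Rightarrow> real"
  assumes "invariant_prob F M" "f \<in> borel_measurable borel"
  shows "(\<integral>x. f ((circ_map F ^^ n) x) \<partial>M) = (\<integral>x. f x \<partial>M)"
proof -
  have sM: "sets M = sets borel" using assms by (simp add: invariant_prob_def)
  have "(\<integral>x. f x \<partial>distr M borel (circ_map F ^^ n)) = (\<integral>x. f ((circ_map F ^^ n) x) \<partial>M)"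
    by (rule integral_distr) (use assms circ_pow_measurable[of n] in \<open>auto simp: measurable_cong_sets[OF sM refl]\<close>)
  then show ?thesis using invariant_pow[OF assms(1)] by simp
qed

lemma phi_measurable: "phi \<in> borel_measurable borel"
  by (rule borel_measurable_continuous_onI[OF lipschitz_on_continuous_on[OF phi_lip]])

lemma bsum_circ:
  assumes "periodic1 f"
  shows "(\<Sum>i<n. f ((circ_map F ^^ i) z)) = bsum F f n z"
  unfolding bsum_def
  by (intro sum.cong refl periodic1_diff_int[OF assms, symmetric] circ_pow_Ints)

text \<open>Against an invariant measure each of the \<open>n\<close> terms of a Birkhoff sum has
  the same integral, so the constant \<open>B\<close> becomes negligible as \<open>n\<close>
  grows.\<close>

lemma lyap_lower_bound:
  fixes c B \<Lambda> :: real
  assumes M: "invariant_prob F M" and W: "W \<in> sets borel" "periodic1 (\<lambda>z. z \<in> W)"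
    and bd: "\<And>n z. c * card {i. i < n \<and> (F ^^ i) z \<in> W} - B \<le> bsum F phi n z - n * \<Lambda>"
  shows "c * measure M W \<le> lyap F M - \<Lambda>"
proof -
  interpret prob_space M using M by (simp add: invariant_prob_def)
  have sM: "sets M = sets borel" using M by (simp add: invariant_prob_def)
  have [measurable]: "circ_map F ^^ n \<in> M \<rightarrow>\<^sub>M borel" for n
    using circ_pow_measurable[of n] by (simp add: measurable_cong_sets[OF sM refl])
  have [measurable]: "phi \<in> borel_measurable borel" "W \<in> sets borel" by (fact phi_measurable W)+
  obtain Bp where Bp: "\<And>x. \<bar>phi x\<bar> \<le> Bp"
    using periodic1_bounded[OF phi_periodic lipschitz_on_continuous_on[OF phi_lip]] by blast
  have int1: "integrable M (\<lambda>x. phi ((circ_map F ^^ i) x))" for i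
    by (rule integrable_const_bound[of _ Bp]) (use Bp in auto)
  have int2: "integrable M (\<lambda>x. indicator W ((circ_map F ^^ i) x) :: real)" for i
    by (rule integrable_const_bound[of _ 1]) auto
  have pt: "c * (\<Sum>i<n. indicator W ((circ_map F ^^ i) z)) - B \<le> (\<Sum>i<n. phi ((circ_map F ^^ i) z)) - n * \<Lambda>" for n z
  proof -
    have "(indicator W ((circ_map F ^^ i) z) :: real) = (if (F ^^ i) z \<in> W then 1 else 0)" for i
      using periodic1_diff_int[OF W(2) circ_pow_Ints[of i z]] by (simp add: indicator_def)
    then have "(\<Sum>i<n. indicator W ((circ_map F ^^ i) z) :: real) = (\<Sum>i<n. if (F ^^ i) z \<in> W then 1 else 0)" by simp
    also have "\<dots> = (\<Sum>i\<in>{i. i < n \<and> (F ^^ i) z \<in> W}. 1)"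
      by (rule sum.mono_neutral_cong_right) auto
    finally show ?thesis using bd[of n z] bsum_circ[OF phi_periodic, of z n] by simp
  qed
  have ineq: "n * (c * measure M W - (lyap F M - \<Lambda>)) \<le> B" for n :: nat
  proof -
    have "(\<integral>x. c * (\<Sum>i<n. indicator W ((circ_map F ^^ i) x)) - B \<partial>M)
        \<le> (\<integral>x. (\<Sum>i<n. phi ((circ_map F ^^ i) x)) - n * \<Lambda> \<partial>M)"
      by (rule integral_mono) (use int1 int2 pt in auto)
    moreover have "(\<integral>x. c * (\<Sum>i<n. indicator W ((circ_map F ^^ i) x)) - B \<partial>M) = c * (n * measure M W) - B"
    proof -
      have "(\<integral>x. indicator W ((circ_map F ^^ i) x) \<partial>M) = measure M W" for i
        using invariant_integral[OF M, of "indicator W" i] sM by (simp add: Int_absorb1 sets.sets_into_space)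
      then show ?thesis using int2 prob_space by (simp add: Bochner_Integration.integral_diff)
    qed
    moreover have "(\<integral>x. (\<Sum>i<n. phi ((circ_map F ^^ i) x)) - n * \<Lambda> \<partial>M) = n * lyap F M - n * \<Lambda>"
    proof -
      have "(\<integral>x. phi ((circ_map F ^^ i) x) \<partial>M) = lyap F M" for i
        using invariant_integral[OF M phi_measurable, of i] by (simp add: lyap_def phi_def)
      then show ?thesis using int1 prob_space by (simp add: Bochner_Integration.integral_diff)
    qed
    ultimately show ?thesis by (simp add: algebra_simps)
  qed
  show ?thesis
  proof (rule ccontr)
    assume "\<not> ?thesis"
    then have "0 < c * measure M W - (lyap F M - \<Lambda>)" by simp
    then obtain n :: nat where "B < n * (c * measure M W - (lyap F M - \<Lambda>))" using reals_Archimedean3 by blast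
    then show False using ineq[of n] by linarith
  qed
qed

text \<open>The lower bound makes the orbit average \<Lambda> the minimum, attained by
  equidistribution on the orbit, and forces a minimizing measure to vanish on \<open>W\<close>. By
  invariance almost every point then avoids \<open>W\<close> forever, so it lies on the
  orbit.\<close>

lemma uniquely_lockedI:
  fixes c B :: real
  assumes P: "1 \<le> P" and q: "(F ^^ P) q - q \<in> \<int>"
    and dist: "\<And>i j. i < j \<Longrightarrow> j < P \<Longrightarrow> (F ^^ i) q - (F ^^ j) q \<notin> \<int>"
    and W: "W \<in> sets borel" "periodic1 (\<lambda>z. z \<in> W)" and c: "0 < c"
    and bd: "\<And>n z. c * card {i. i < n \<and> (F ^^ i) z \<in> W} - B \<le> bsum F phi n z - n * (bsum F phi P q / P)"
    and stay: "\<And>z. (\<And>i. (F ^^ i) z \<notin> W) \<Longrightarrow> \<exists>j. z - (F ^^ j) q \<in> \<int>"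
  shows "uniquely_locked F"
proof -
  let ?f = "circ_map F"
  define \<Lambda> where "\<Lambda> = bsum F phi P q / P"
  define Q where "Q i = (?f ^^ i) (frac q)" for i
  have Q01: "Q i \<in> {0..<1}" for i unfolding Q_def by (rule circ_range) (simp add: frac_lt_1)
  have QF: "Q i - (F ^^ i) q \<in> \<int>" for i
  proof -
    have "(F ^^ i) (frac q) - Q i \<in> \<int>" unfolding Q_def by (rule circ_pow_Ints)
    moreover have "(F ^^ i) (frac q) - (F ^^ i) q \<in> \<int>" by (rule deg_pow_diff) (simp add: frac_def)
    ultimately have "((F ^^ i) (frac q) - (F ^^ i) q) - ((F ^^ i) (frac q) - Q i) \<in> \<int>" by (rule Ints_diff[rotated])
    then show ?thesis by simp
  qed
  have QS: "Q (Suc i) = ?f (Q i)" for i by (simp add: Q_def)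
  have Qper: "Q P = Q 0"
  proof (rule unit_interval_diff_int[OF Q01 Q01])
    have "(Q P - (F ^^ P) q) + ((F ^^ P) q - q) - (Q 0 - (F ^^ 0) q) \<in> \<int>"
      by (intro Ints_diff Ints_add QF q)
    then show "Q P - Q 0 \<in> \<int>" by simp
  qed
  have Qmod: "Q (i mod P) = Q i" for i
  proof -
    have "Q (r + P * k) = Q r" for r k
    proof (induction k)
      case (Suc k)
      have "Q (r + P * Suc k) = (?f ^^ (r + P * k)) (Q P)"
        unfolding Q_def by (simp add: funpow_apply add_ac)
      then show ?case using Suc unfolding Qper by (simp add: Q_def)
    qed simp
    from this[of "i mod P" "i div P"] show ?thesis by simp
  qed
  have Qinj: "inj_on Q {..<P}"
  proof (rule linorder_inj_onI)
    fix i j assume ij: "i < j" "i \<in> {..<P}" "j \<in> {..<P}"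
    show "Q i \<noteq> Q j"
    proof
      assume "Q i = Q j"
      then have "(Q j - (F ^^ j) q) - (Q i - (F ^^ i) q) = (F ^^ i) q - (F ^^ j) q" by simp
      then show False using Ints_diff[OF QF[of j] QF[of i]] dist[of i j] ij by simp
    qed
  qed auto
  have lower: "c * measure M W \<le> lyap F M - \<Lambda>" if "invariant_prob F M" for M
    unfolding \<Lambda>_def by (rule lyap_lower_bound[OF that W bd])
  define M0 where "M0 = distr (uniform_count_measure {..<P}) borel Q"
  have Pne: "{..<P} \<noteq> {}" using P by (simp add: lessThan_empty_iff)
  have Qm: "h \<in> uniform_count_measure {..<P} \<rightarrow>\<^sub>M borel" for h :: "nat \<Rightarrow> real"
    by (simp add: measurable_def space_uniform_count_measure sets_uniform_count_measure)
  have e0: "emeasure M0 A = ennreal (card {i. i < P \<and> Q i \<in> A} / P)" if "A \<in> sets borel" for A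
  proof -
    have "emeasure M0 A = emeasure (uniform_count_measure {..<P}) (Q -` A \<inter> {..<P})"
      unfolding M0_def using that Qm by (simp add: emeasure_distr space_uniform_count_measure)
    also have "Q -` A \<inter> {..<P} = {i. i < P \<and> Q i \<in> A}" by auto
    finally show ?thesis by (simp add: emeasure_uniform_count_measure subset_eq)
  qed
  have shift: "card {i. i < P \<and> Q (Suc i) \<in> A} = card {i. i < P \<and> Q i \<in> A}" for A
  proof (rule bij_betw_same_card[of "\<lambda>i. Suc i mod P"], rule bij_betwI')
    fix i j assume "i \<in> {i. i < P \<and> Q (Suc i) \<in> A}" "j \<in> {i. i < P \<and> Q (Suc i) \<in> A}"
    then show "(Suc i mod P = Suc j mod P) = (i = j)" by (auto simp: mod_Suc split: if_splits)
  next
    fix i assume "i \<in> {i. i < P \<and> Q (Suc i) \<in> A}"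
    then show "Suc i mod P \<in> {i. i < P \<and> Q i \<in> A}" using P Qmod[of "Suc i"] by simp
  next
    fix j assume j: "j \<in> {i. i < P \<and> Q i \<in> A}"
    define i where "i = (if j = 0 then P - 1 else j - 1)"
    have i: "i < P" "Suc i mod P = j" using j P by (auto simp: i_def)
    then have "Q (Suc i) = Q j" using Qmod[of "Suc i"] by simp
    then show "\<exists>i\<in>{i. i < P \<and> Q (Suc i) \<in> A}. j = Suc i mod P" using i j by auto
  qed
  have inv0: "invariant_prob F M0"
    unfolding invariant_prob_def
  proof (intro conjI)
    show s0: "sets M0 = sets borel" by (simp add: M0_def)
    show "prob_space M0" unfolding M0_def
      by (rule prob_space.prob_space_distr[OF prob_space_uniform_count_measure[OF _ Pne] Qm]) simp
    have "{i. i < P \<and> Q i \<in> {0..<1}} = {..<P}" using Q01 by auto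
    then show "emeasure M0 {0..<1} = 1" using e0[of "{0..<1}"] P by simp
    have eq: "distr M0 borel ?f = distr (uniform_count_measure {..<P}) borel (\<lambda>i. Q (Suc i))"
      unfolding M0_def using Qm circ_measurable by (subst distr_distr) (auto simp: comp_def QS)
    show "distr M0 borel ?f = M0"
    proof (rule measure_eqI)
      show "sets (distr M0 borel ?f) = sets M0" by (simp add: s0)
      fix A assume "A \<in> sets (distr M0 borel ?f)"
      then have A: "A \<in> sets borel" by simp
      have "emeasure (distr M0 borel ?f) A = emeasure (uniform_count_measure {..<P}) ((\<lambda>i. Q (Suc i)) -` A \<inter> {..<P})"
        unfolding eq using A Qm by (simp add: emeasure_distr space_uniform_count_measure)
      also have "(\<lambda>i. Q (Suc i)) -` A \<inter> {..<P} = {i. i < P \<and> Q (Suc i) \<in> A}" by auto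
      finally show "emeasure (distr M0 borel ?f) A = emeasure M0 A"
        unfolding e0[OF A] shift[symmetric] by (simp add: emeasure_uniform_count_measure subset_eq)
    qed
  qed
  have lyap0: "lyap F M0 = \<Lambda>"
  proof -
    have "lyap F M0 = (\<integral>x. phi x \<partial>M0)" by (simp add: lyap_def phi_def)
    also have "\<dots> = (\<integral>i. phi (Q i) \<partial>uniform_count_measure {..<P})"
      unfolding M0_def by (rule integral_distr[OF Qm phi_measurable])
    also have "\<dots> = (\<Sum>i<P. phi (Q i)) / P" by (simp add: integral_uniform_count_measure)
    also have "(\<Sum>i<P. phi (Q i)) = bsum F phi P q"
      unfolding bsum_def by (intro sum.cong refl periodic1_diff_int[OF phi_periodic] QF)
    finally show ?thesis by (simp add: \<Lambda>_def)
  qed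
  have alpha: "alpha F = \<Lambda>"
    unfolding alpha_def
  proof (rule cInf_eq_minimum)
    show "\<Lambda> \<in> {lyap F M | M. invariant_prob F M}" using inv0 lyap0 by blast
    fix x assume "x \<in> {lyap F M | M. invariant_prob F M}"
    then obtain M where M: "invariant_prob F M" "x = lyap F M" by blast
    have "0 \<le> c * measure M W" using c by simp
    then show "\<Lambda> \<le> x" using lower[OF M(1)] M(2) by linarith
  qed
  have form: "emeasure M (Q ` {..<P}) = 1 \<and> (\<forall>A\<in>sets borel. emeasure M A = ennreal (card {i. i < P \<and> Q i \<in> A} / P))"
    if min: "lyap_minimizing F M" for M
  proof -
    have inv: "invariant_prob F M" and ly: "lyap F M = \<Lambda>" using min alpha by (auto simp: lyap_minimizing_def)
    interpret prob_space M using inv by (simp add: invariant_prob_def)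
    have sM: "sets M = sets borel" using inv by (simp add: invariant_prob_def)
    have spM: "space M = UNIV" using sets_eq_imp_space_eq[OF sM] by simp
    have fm: "(?f ^^ n) \<in> M \<rightarrow>\<^sub>M borel" for n
      using circ_pow_measurable[of n] by (simp add: measurable_cong_sets[OF sM refl])
    have "c * measure M W \<le> 0" using lower[OF inv] ly by simp
    then have W0: "emeasure M W = 0" using c by (simp add: emeasure_eq_measure mult_le_0_iff measure_le_0_iff)
    have "emeasure M ((?f ^^ i) -` W) = 0" for i
      using emeasure_distr[OF fm[of i] W(1)] invariant_pow[OF inv, of i] W0 spM by simp
    then have "AE x in M. (?f ^^ i) x \<notin> W" for i
      using fm[of i] W(1) spM sM by (intro AE_I[of _ _ "(?f ^^ i) -` W"]) (auto simp: measurable_def)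
    then have AE1: "AE x in M. \<forall>i. (?f ^^ i) x \<notin> W" by (simp add: AE_all_countable)
    have AE2: "AE x in M. x \<in> {0..<1}"
      using inv sM by (intro AE_prob_1) (auto simp: invariant_prob_def emeasure_eq_measure)
    have inQ: "AE x in M. x \<in> Q ` {..<P}"
      using AE1 AE2
    proof eventually_elim
      case (elim x)
      have "(F ^^ i) x \<notin> W" for i
        using elim(1) periodic1_diff_int[OF W(2) circ_pow_Ints[of i x]] by simp
      then obtain j where j: "x - (F ^^ j) q \<in> \<int>" using stay by blast
      have "x - Q j \<in> \<int>" using Ints_diff[OF j QF[of j]] by simp
      then have "x = Q j" by (rule unit_interval_diff_int[OF elim(2) Q01])
      then show ?case using Qmod[of j] P by (intro image_eqI[of _ _ "j mod P"]) auto
    qed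
    have fin: "finite (Q ` {..<P})" by simp
    have sQ: "S \<in> sets M" if "finite S" for S :: "real set" using that sM by (simp add: borel_closed finite_imp_closed)
    have Q1: "emeasure M (Q ` {..<P}) = 1"
      using inQ sQ[OF fin] by (simp add: emeasure_eq_measure prob_eq_1)
    define \<mu> where "\<mu> i = measure M {Q i}" for i
    \<comment> \<open>The preimage of \<open>Q (Suc i)\<close> contains \<open>Q i\<close>, so by
      invariance masses cannot decrease along the cycle; as it closes up they are equal.\<close>
    have mono: "\<mu> i \<le> \<mu> (Suc i)" for i
    proof -
      have "emeasure M {Q (Suc i)} = emeasure M (?f -` {Q (Suc i)})"
        using emeasure_distr[OF fm[of 1], of "{Q (Suc i)}"] invariant_pow[OF inv, of 1] spM by simp
      then have "\<mu> (Suc i) = measure M (?f -` {Q (Suc i)})" by (simp add: \<mu>_def measure_def)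
      also have "\<dots> \<ge> \<mu> i" unfolding \<mu>_def
      proof (rule finite_measure_mono)
        show "{Q i} \<subseteq> ?f -` {Q (Suc i)}" by (simp add: QS)
        have "?f -` {Q (Suc i)} \<inter> space M \<in> sets M"
          using measurable_sets[OF fm[of 1], of "{Q (Suc i)}"] by simp
        then show "?f -` {Q (Suc i)} \<in> sets M" by (simp add: spM)
      qed
      finally show ?thesis .
    qed
    have mono': "\<mu> i \<le> \<mu> j" if "i \<le> j" for i j using mono that by (rule lift_Suc_mono_le)
    have const: "\<mu> i = \<mu> 0" if "i < P" for i
      using mono'[of 0 i] mono'[of i P] that Qper by (simp add: \<mu>_def)
    have Am: "measure M A = card {i. i < P \<and> Q i \<in> A} * \<mu> 0" if A: "A \<in> sets borel" for A
    proof -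
      let ?I = "{i. i < P \<and> Q i \<in> A}"
      have "measure M A = measure M (A \<inter> Q ` {..<P})"
        using inQ A sM sQ[OF fin] by (intro measure_eq_AE) auto
      also have "A \<inter> Q ` {..<P} = (\<Union>i\<in>?I. {Q i})" by auto
      also have "measure M \<dots> = (\<Sum>i\<in>?I. \<mu> i)"
        unfolding \<mu>_def
      proof (rule finite_measure_finite_Union)
        show "disjoint_family_on (\<lambda>i. {Q i}) ?I"
          using Qinj by (auto simp: disjoint_family_on_def inj_on_def)
        show "(\<lambda>i. {Q i}) ` ?I \<subseteq> events" using sQ by auto
      qed simp
      also have "\<dots> = (\<Sum>i\<in>?I. \<mu> 0)" by (rule sum.cong) (auto intro: const)
      finally show ?thesis by simp
    qed
    have "{i. i < P \<and> Q i \<in> Q ` {..<P}} = {..<P}" by auto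
    then have "1 = P * \<mu> 0" using Am[of "Q ` {..<P}"] Q1 sQ[OF fin] sM by (simp add: emeasure_eq_measure)
    then have "\<mu> 0 = 1 / P" using P by (simp add: field_simps)
    then show ?thesis using Q1 Am by (auto simp: emeasure_eq_measure)
  qed
  have "lyap_minimizing F M0" using inv0 lyap0 alpha by (simp add: lyap_minimizing_def)
  moreover have "M = M0" if M: "lyap_minimizing F M" for M
  proof (rule measure_eqI)
    show "sets M = sets M0" using M inv0 by (simp add: lyap_minimizing_def invariant_prob_def)
    fix A assume "A \<in> sets M"
    then have "A \<in> sets borel" using M by (simp add: lyap_minimizing_def invariant_prob_def)
    then show "emeasure M A = emeasure M0 A" using form[OF M] e0 by simp
  qed
  moreover have "supported_on_periodic_orbit F M" if M: "lyap_minimizing F M" for M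
    unfolding supported_on_periodic_orbit_def
  proof (intro exI conjI)
    show "0 \<le> frac q" "frac q < 1" by (simp_all add: frac_lt_1)
    show "1 \<le> P" by (fact P)
    show "(?f ^^ P) (frac q) = frac q" using Qper by (simp add: Q_def)
    have "{(?f ^^ k) (frac q) | k. k < P} = Q ` {..<P}" by (auto simp: Q_def)
    then show "emeasure M {(?f ^^ k) (frac q) | k. k < P} = 1" using form[OF M] by simp
  qed
  ultimately show ?thesis unfolding uniquely_locked_def by blast
qed

end

subsection \<open>Perturbations\<close>

lemma antiderivative_exists:
  fixes f :: "real \<Rightarrow> real"
  assumes "continuous_on UNIV f"
  shows "\<exists>g. g 0 = 0 \<and> (\<forall>x. (g has_real_derivative f x) (at x))"
proof -
  have "\<exists>F. \<forall>x::real. -\<infinity> < ereal x \<longrightarrow> ereal x < \<infinity> \<longrightarrow> (F has_vector_derivative f x) (at x)"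
    by (rule einterval_antiderivative) (use assms in \<open>simp_all add: continuous_on_eq_continuous_at\<close>)
  then obtain F where F: "\<And>x. (F has_real_derivative f x) (at x)"
    by (auto simp: has_real_derivative_iff_has_vector_derivative)
  have "((\<lambda>x. F x - F 0) has_real_derivative f x) (at x)" for x
    using DERIV_diff[OF F[of x] DERIV_const[of "F 0"]] by simp
  then show ?thesis by (intro exI[of _ "\<lambda>x. F x - F 0"]) auto
qed

lemma equal_deriv_diff_const:
  fixes f g h :: "real \<Rightarrow> real"
  assumes "\<And>x. (f has_real_derivative h x) (at x)" "\<And>x. (g has_real_derivative h x) (at x)"
  shows "f x - g x = f y - g y"
proof -
  have "((\<lambda>x. f x - g x) has_real_derivative 0) (at x)" for x
    using DERIV_diff[OF assms(1)[of x] assms(2)[of x]] by simp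
  then show ?thesis using DERIV_isconst_all[of "\<lambda>x. f x - g x" x y] by blast
qed

lemma antideriv_increment:
  fixes f :: "real \<Rightarrow> real"
  assumes "\<And>x. (g has_real_derivative f x) (at x)" "x \<le> y" "\<And>z. x \<le> z \<Longrightarrow> z \<le> y \<Longrightarrow> lo \<le> f z \<and> f z \<le> hi"
  shows "lo * (y - x) \<le> g y - g x \<and> g y - g x \<le> hi * (y - x)"
proof (cases "x = y")
  case False
  then have xy: "x < y" using assms by simp
  obtain z where z: "x < z" "z < y" "g y - g x = (y - x) * f z" using MVT2[OF xy assms(1)] by blast
  then show ?thesis using assms(3)[of z] xy by (simp add: mult.commute mult_right_mono)
qed simp

lemma infdist_periodic:
  assumes "\<And>a. a \<in> S \<longleftrightarrow> a + 1 \<in> S"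
  shows "infdist (x + 1) S = infdist (x::real) S"
proof -
  have "S = (\<lambda>a. a + 1) ` S"
  proof
    show "S \<subseteq> (\<lambda>a. a + 1) ` S"
    proof
      fix a assume "a \<in> S"
      then have "a - 1 \<in> S" using assms[of "a - 1"] by simp
      then show "a \<in> (\<lambda>a. a + 1) ` S" by (rule rev_image_eqI) simp
    qed
    show "(\<lambda>a. a + 1) ` S \<subseteq> S" using assms by blast
  qed
  moreover have "infdist (x + 1) ((\<lambda>a. a + 1) ` S) = infdist x S"
    by (simp add: infdist_def image_image dist_real_def)
  ultimately show ?thesis by simp
qed

lemma infdist_lipschitz: "\<bar>infdist x S - infdist y S\<bar> \<le> \<bar>x - (y::real)\<bar>"
  using infdist_triangle_abs[of x S y] by (simp add: dist_real_def)

text \<open>A periodic bump centred at the integers. It serves as a derivative: being Lipschitz, it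
  gives primitives with the regularity of \<open>E11\<close>.\<close>

definition tent :: "real \<Rightarrow> real \<Rightarrow> real" where
  "tent w x = max 0 (1 - infdist x \<int> / w)"

lemma tent_periodic: "periodic1 (tent w)"
proof -
  have "a \<in> \<int> \<longleftrightarrow> a + 1 \<in> \<int>" for a :: real
    by (metis Ints_1 Ints_add Ints_diff add_diff_cancel_right')
  then show ?thesis using infdist_periodic[of \<int>] by (simp add: periodic1_def tent_def)
qed

lemma tent_bounds: "0 \<le> tent w x" "0 < w \<Longrightarrow> tent w x \<le> 1"
  by (simp_all add: tent_def infdist_nonneg)

lemma tent_zero: "tent w 0 = 1"
  by (simp add: tent_def)

lemma tent_lipschitz:
  assumes "0 < w" shows "(1 / w)-lipschitz_on UNIV (tent w)"
proof (rule lipschitz_realI)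
  fix x y
  have "\<bar>tent w x - tent w y\<bar> \<le> \<bar>infdist x \<int> / w - infdist y \<int> / w\<bar>" by (auto simp: tent_def)
  also have "\<dots> = \<bar>infdist x \<int> - infdist y \<int>\<bar> / w" using assms by (simp add: diff_divide_distrib[symmetric])
  also have "\<dots> \<le> \<bar>x - y\<bar> / w" using assms infdist_lipschitz by (intro divide_right_mono) auto
  finally show "\<bar>tent w x - tent w y\<bar> \<le> 1 / w * \<bar>x - y\<bar>" by simp
qed (use assms in simp)

lemma tent_vanish:
  assumes "0 < w" "w \<le> infdist x \<int>" shows "tent w x = 0"
  using assms by (simp add: tent_def field_simps)

lemma infdist_Ints_ge:
  assumes "\<And>k. w \<le> \<bar>x - of_int k\<bar>" shows "w \<le> infdist x \<int>"
  unfolding infdist_def using assms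
  by (auto intro!: cINF_greatest simp: dist_real_def elim!: Ints_cases)

lemma infdist_Ints_between:
  assumes "w \<le> x" "x \<le> 1 - w" shows "w \<le> infdist (x::real) \<int>"
proof (rule infdist_Ints_ge)
  fix k :: int
  consider "k \<le> 0" | "k \<ge> 1" by linarith
  then show "w \<le> \<bar>x - of_int k\<bar>"
  proof cases
    case 1 then have "real_of_int k \<le> 0" by simp
    then show ?thesis using assms by linarith
  next
    case 2 then have "real_of_int k \<ge> 1" by simp
    then show ?thesis using assms by linarith
  qed
qed

lemma infdist_Ints_uminus: "infdist (- x) \<int> = infdist (x::real) \<int>"
proof -
  have "(\<int> :: real set) = uminus ` \<int>"
  proof (intro equalityI subsetI)
    fix a :: real assume "a \<in> \<int>"
    then have "- a \<in> \<int>" by simp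
    then show "a \<in> uminus ` \<int>" by (rule rev_image_eqI) simp
  qed auto
  moreover have "infdist (- x) (uminus ` \<int>) = infdist x \<int>"
    by (simp add: infdist_def image_image dist_real_def abs_minus_commute)
  ultimately show ?thesis by simp
qed

text \<open>The primitive is an odd staircase, rising by \<open>2 * T w\<close> around each integer
  and flat in between. The bound \<open>w / 4\<close> comes from the part of the tent above
  1/2.\<close>

lemma tent_primitive:
  assumes w: "0 < w" "w < 1/2"
  obtains T where "\<And>x. (T has_real_derivative tent w x) (at x)" "T 0 = 0" "\<And>x. T (- x) = - T x"
    "\<And>x. w \<le> x \<Longrightarrow> x \<le> 1 - w \<Longrightarrow> T x = T w" "\<And>x. T (x + 1) = T x + 2 * T w" "w / 4 \<le> T w" "mono T"
proof -
  obtain T where T: "T 0 = 0" "\<And>x. (T has_real_derivative tent w x) (at x)"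
    using antiderivative_exists[OF lipschitz_on_continuous_on[OF tent_lipschitz[OF w(1)]]] by blast
  have even: "tent w (- x) = tent w x" for x by (simp add: tent_def infdist_Ints_uminus)
  have odd: "T (- x) = - T x" for x
  proof -
    have "((\<lambda>x. - T (- x)) has_real_derivative tent w x) (at x)" for x
    proof -
      have "((\<lambda>x. T (- x)) has_real_derivative tent w (- x) * (- 1)) (at x)"
        by (rule DERIV_chain2[OF T(2)]) (auto intro!: derivative_eq_intros)
      from DERIV_minus[OF this] show ?thesis by (simp add: even)
    qed
    from equal_deriv_diff_const[OF this T(2), of x 0] show ?thesis using T(1) by simp
  qed
  have const: "T x = T w" if "w \<le> x" "x \<le> 1 - w" for x
  proof -
    have "0 * (x - w) \<le> T x - T w \<and> T x - T w \<le> 0 * (x - w)"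
    proof (rule antideriv_increment[OF T(2)])
      fix z assume "w \<le> z" "z \<le> x"
      then have "tent w z = 0" using that w by (intro tent_vanish infdist_Ints_between) auto
      then show "0 \<le> tent w z \<and> tent w z \<le> 0" by simp
    qed (use that in auto)
    then show ?thesis by simp
  qed
  have "T (x + 1) = T x + 2 * T w" for x
  proof -
    have "((\<lambda>x. T (x + 1)) has_real_derivative tent w x) (at x)" for x
      using T(2)[of "x + 1"] tent_periodic by (simp add: DERIV_shift[symmetric] periodic1_def)
    from equal_deriv_diff_const[OF this T(2), of x "- w"] show ?thesis
      using odd[of w] const[of "1 - w"] w by (simp add: add.commute)
  qed
  moreover have m: "T x \<le> T y" if "x \<le> y" for x y
    using antideriv_increment[OF T(2) that, of 0 1] tent_bounds w that by fastforce
  moreover have "w / 4 \<le> T w"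
  proof -
    have "1/2 * (w / 2 - 0) \<le> T (w / 2) - T 0 \<and> T (w / 2) - T 0 \<le> 1 * (w / 2 - 0)"
    proof (rule antideriv_increment[OF T(2)])
      fix z assume z: "0 \<le> z" "z \<le> w / 2"
      have "infdist z \<int> \<le> dist z 0" by (rule infdist_le) simp
      then have "infdist z \<int> / w \<le> 1 / 2" using z w by (simp add: dist_real_def field_simps)
      then have "1 / 2 \<le> tent w z" unfolding tent_def by linarith
      then show "1 / 2 \<le> tent w z \<and> tent w z \<le> 1" using tent_bounds(2)[OF w(1)] by simp
    qed (use w in simp)
    then show ?thesis using m[of "w / 2" w] w T(1) by simp
  qed
  ultimately show thesis using that[OF T(2) T(1) odd const] by (auto simp: mono_def)
qed

lemma DERIV_sum_shift:
  fixes T t :: "real \<Rightarrow> real"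
  assumes "\<And>x. (T has_real_derivative t x) (at x)"
  shows "((\<lambda>x. \<Sum>j<R. \<kappa> j * T (x - c j)) has_real_derivative (\<Sum>j<R. \<kappa> j * t (x - c j))) (at x)"
proof -
  have "((\<lambda>x. T (x - b)) has_real_derivative t (x - b)) (at x)" for b
    using DERIV_shift[of T "t (x - b)" x "- b"] assms[of "x - b"] by simp
  then show ?thesis by (intro DERIV_sum DERIV_cmult)
qed

text \<open>Around each of the points \<^term>\<open>c j\<close>, one in each of the \<^term>\<open>R\<close> cells of the circle,
  the function drops by what it has gained in the cell; this keeps it of size \<^term>\<open>e * D / (8 * R)\<close>
  although its derivative is nonnegative elsewhere.\<close>

lemma sawtooth_exists:
  fixes c :: "nat \<Rightarrow> real" and R :: nat and e D l :: real
  assumes R: "1 \<le> R" and l: "0 < l" "l \<le> 1 / (4 * R)" and e: "0 < e" and D: "0 < D" "D \<le> 4 * l\<^sup>2"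
    and S: "\<And>a. a \<in> S \<longleftrightarrow> a + 1 \<in> S"
    and c: "\<And>j. j < R \<Longrightarrow> (j + 1/4) / R \<le> c j \<and> c j \<le> (j + 3/4) / R"
  shows "\<exists>g g' \<xi>. (\<forall>x. (g has_real_derivative g' x) (at x)) \<and> periodic1 g \<and> (2 * e)-lipschitz_on UNIV g'
    \<and> (\<forall>x. \<bar>g x\<bar> \<le> e * D / (8 * R)) \<and> (\<forall>x. g' x = e * min (infdist x S) (D / 8) - \<xi> x)
    \<and> (\<forall>x. 0 \<le> \<xi> x \<and> \<xi> x \<le> e * D / (4 * l))
    \<and> (\<forall>x. (\<forall>j<R. l \<le> infdist (x - c j) \<int>) \<longrightarrow> \<xi> x = 0)"
proof -
  have R0: "0 < real R" using R by simp
  have lhalf: "l < 1/2"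
  proof -
    have "1 / (4 * real R) \<le> 1 / 4" using R by (simp add: field_simps)
    then show ?thesis using l by linarith
  qed
  obtain T where T: "\<And>x. (T has_real_derivative tent l x) (at x)" "T 0 = 0" "\<And>x. T (- x) = - T x"
    "\<And>x. l \<le> x \<Longrightarrow> x \<le> 1 - l \<Longrightarrow> T x = T l" "\<And>x. T (x + 1) = T x + 2 * T l" "l / 4 \<le> T l" "mono T"
    using tent_primitive[OF l(1) lhalf] by blast
  define \<rho> where "\<rho> x = e * min (infdist x S) (D / 8)" for x
  have \<rho>0: "0 \<le> \<rho> x" "\<rho> x \<le> e * (D / 8)" for x
    using e D by (auto simp: \<rho>_def infdist_nonneg intro!: mult_nonneg_nonneg mult_left_mono)
  have \<rho>lip: "e-lipschitz_on UNIV \<rho>"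
  proof (rule lipschitz_realI)
    fix x y
    have "\<bar>\<rho> x - \<rho> y\<bar> = e * \<bar>min (infdist x S) (D / 8) - min (infdist y S) (D / 8)\<bar>"
      using e by (simp add: \<rho>_def abs_mult right_diff_distrib[symmetric])
    also have "\<dots> \<le> e * \<bar>x - y\<bar>"
      using e infdist_lipschitz[of x S y] by (intro mult_left_mono) (auto simp: min_def)
    finally show "\<bar>\<rho> x - \<rho> y\<bar> \<le> e * \<bar>x - y\<bar>" .
  qed (use e in simp)
  obtain A where A: "A 0 = 0" "\<And>x. (A has_real_derivative \<rho> x) (at x)"
    using antiderivative_exists[OF lipschitz_on_continuous_on[OF \<rho>lip]] by blast
  have Aper: "A (x + 1) = A x + A 1" for x
  proof -
    have "((\<lambda>x. A (x + 1)) has_real_derivative \<rho> x) (at x)" for x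
      using A(2)[of "x + 1"] infdist_periodic[OF S, of x] by (simp add: DERIV_shift[symmetric] \<rho>_def)
    from equal_deriv_diff_const[OF this A(2), of x 0] show ?thesis using A(1) by simp
  qed
  have Ainc: "0 \<le> A y - A x \<and> A y - A x \<le> e * (D / 8) * (y - x)" if "x \<le> y" for x y
    using antideriv_increment[OF A(2) that, of 0 "e * (D / 8)"] \<rho>0 by auto
  define r where "r = 1 / real R"
  \<comment> \<open>A bump has total mass \<open>2 * T l\<close>, so with this coefficient bump
    \<open>j\<close> undoes exactly what \<open>A\<close> gains over cell \<open>j\<close>.\<close>
  define \<kappa> where "\<kappa> j = (A (Suc j * r) - A (j * r)) / (2 * T l)" for j :: nat
  have T0: "0 < T l" using T(6) l by linarith
  have cell: "0 \<le> A (Suc j * r) - A (j * r) \<and> A (Suc j * r) - A (j * r) \<le> e * D / (8 * R)" for j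
  proof -
    have "real j * r \<le> real (Suc j) * r" using R0 by (simp add: r_def field_simps)
    moreover have "real (Suc j) * r - j * r = r" by (simp add: algebra_simps)
    ultimately show ?thesis using Ainc[of "j * r" "Suc j * r"] by (simp add: r_def)
  qed
  have \<kappa>: "0 \<le> \<kappa> j \<and> \<kappa> j \<le> e * D / (4 * R * l)" for j
  proof -
    have "\<kappa> j \<le> (e * D / (8 * R)) / (2 * (l / 4))"
      unfolding \<kappa>_def using cell[of j] T(6) l e D by (intro frac_le) auto
    also have "\<dots> = e * D / (4 * R * l)" by simp
    finally show ?thesis using cell[of j] T0 by (simp add: \<kappa>_def)
  qed
  define \<xi> where "\<xi> x = (\<Sum>j<R. \<kappa> j * tent l (x - c j))" for x
  define cm where "cm x = (\<Sum>j<R. \<kappa> j * T (x - c j)) - (\<Sum>j<R. \<kappa> j * T (0 - c j))" for x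
  have cmD: "(cm has_real_derivative \<xi> x) (at x)" for x
    unfolding cm_def \<xi>_def using DERIV_diff[OF DERIV_sum_shift[OF T(1)] DERIV_const] by simp
  have telsum: "(\<Sum>j<i. \<kappa> j * (2 * T l)) = A (i * r)" for i
  proof -
    have "(\<Sum>j<i. \<kappa> j * (2 * T l)) = (\<Sum>j<i. A (Suc j * r) - A (j * r))"
      using T0 by (intro sum.cong) (auto simp: \<kappa>_def)
    also have "\<dots> = A (i * r) - A (0 * r)"
      using sum_lessThan_telescope[of "\<lambda>j. A (real j * r)" i] by simp
    finally show ?thesis using A(1) by simp
  qed
  have cmper: "cm (x + 1) = cm x + A 1" for x
  proof -
    have "T (x + 1 - c j) = T (x - c j) + 2 * T l" for j using T(5)[of "x - c j"] by (simp add: algebra_simps)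
    then have "cm (x + 1) = cm x + (\<Sum>j<R. \<kappa> j * (2 * T l))" unfolding cm_def by (simp add: distrib_left sum.distrib)
    then show ?thesis using telsum[of R] R0 by (simp add: r_def)
  qed
  define g where "g x = A x - cm x" for x
  have gper: "periodic1 g" unfolding periodic1_def g_def by (simp add: Aper cmper)
  have gD: "(g has_real_derivative (\<rho> x - \<xi> x)) (at x)" for x
    unfolding g_def by (rule DERIV_diff[OF A(2) cmD])
  \<comment> \<open>The points \<open>c j\<close> lie in the middle halves of their cells and
    \<open>l\<close> is at most a quarter of a cell. Hence for \<open>x\<close> in cell
    \<open>i\<close> the bumps of earlier cells are complete and those of later cells have not
    begun; only the gain within one cell is left.\<close>
  have unit: "\<bar>g x\<bar> \<le> e * D / (8 * R)" if x: "0 \<le> x" "x < 1" for x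
  proof -
    define i where "i = nat \<lfloor>x * R\<rfloor>"
    have fl: "real i \<le> x * R" "x * R < real i + 1" using x by (auto simp: i_def)
    have "x * R < 1 * real R" using x R0 by (intro mult_strict_right_mono) auto
    then have iR: "i < R" using fl(1) by linarith
    have ix: "i * r \<le> x" "x \<le> Suc i * r" using fl R0 by (auto simp: r_def field_simps)
    have rl: "l \<le> r / 4" using l by (simp add: r_def)
    have cj: "(j + 1/4) * r \<le> c j \<and> c j \<le> (j + 3/4) * r" if "j < R" for j using c[OF that] by (simp add: r_def)
    have cin: "l \<le> c j \<and> c j \<le> 1 - l" if "j < R" for j
    proof -
      have r0: "0 < r" using R0 by (simp add: r_def)
      have "1/4 * r \<le> (j + 1/4) * r" using r0 by (intro mult_right_mono) auto
      moreover have "(j + 3/4) * r \<le> (R - 1/4) * r" using r0 that by (intro mult_right_mono) linarith+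
      moreover have "(R - 1/4) * r = 1 - r / 4" using R0 by (simp add: r_def field_simps)
      ultimately show ?thesis using cj[OF that] rl by linarith
    qed
    have Tneg: "T (0 - c j) = - T l" if "j < R" for j
      using T(3)[of "c j"] T(4)[of "c j"] cin[OF that] by simp
    have r0: "0 < r" using R0 by (simp add: r_def)
    have below: "T (x - c j) - T (0 - c j) = 2 * T l" if "j < i" for j
    proof -
      have jR: "j < R" using that iR by simp
      have "(j + 1) * r \<le> i * r" using that r0 by (intro mult_right_mono) auto
      then have "l \<le> x - c j" using cj[OF jR] ix rl by (simp add: algebra_simps)
      moreover have "x - c j \<le> 1 - l" using x cin[OF jR] by linarith
      ultimately have "T (x - c j) = T l" by (rule T(4))
      then show ?thesis using Tneg[OF jR] by simp
    qed
    have above: "T (x - c j) - T (0 - c j) = 0" if "i < j" "j < R" for j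
    proof -
      have "Suc i * r \<le> j * r" using that r0 by (intro mult_right_mono) auto
      then have "l \<le> c j - x" using cj[OF that(2)] ix rl by (simp add: algebra_simps)
      moreover have "c j - x \<le> 1 - l" using x cin[OF that(2)] by linarith
      ultimately have "T (c j - x) = T l" by (rule T(4))
      then show ?thesis using Tneg[OF that(2)] T(3)[of "c j - x"] by simp
    qed
    have mid: "0 \<le> T (x - c i) - T (0 - c i)" "T (x - c i) - T (0 - c i) \<le> 2 * T l"
    proof -
      show "0 \<le> T (x - c i) - T (0 - c i)" using T(7) x by (simp add: mono_def)
      have "T (x - c i) \<le> T (1 + (- c i))" using T(7) x by (simp add: mono_def)
      also have "\<dots> = T (0 - c i) + 2 * T l" using T(5)[of "- c i"] by (simp add: add.commute)
      finally show "T (x - c i) - T (0 - c i) \<le> 2 * T l" by simp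
    qed
    have "cm x = (\<Sum>j<R. \<kappa> j * (T (x - c j) - T (0 - c j)))"
      unfolding cm_def by (simp add: right_diff_distrib sum_subtractf)
    also have "\<dots> = (\<Sum>j<Suc i. \<kappa> j * (T (x - c j) - T (0 - c j)))"
      using iR above by (intro sum.mono_neutral_right) auto
    also have "\<dots> = (\<Sum>j<i. \<kappa> j * (2 * T l)) + \<kappa> i * (T (x - c i) - T (0 - c i))"
      using below by simp
    finally have cmx: "cm x = A (i * r) + \<kappa> i * (T (x - c i) - T (0 - c i))" unfolding telsum .
    have "0 \<le> \<kappa> i * (T (x - c i) - T (0 - c i))" using \<kappa>[of i] mid by simp
    moreover have "\<kappa> i * (T (x - c i) - T (0 - c i)) \<le> \<kappa> i * (2 * T l)"
      using \<kappa>[of i] mid by (intro mult_left_mono) auto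
    moreover have "\<kappa> i * (2 * T l) = A (Suc i * r) - A (i * r)" using T0 by (simp add: \<kappa>_def)
    ultimately show ?thesis
      using cmx Ainc[OF ix(1)] Ainc[OF ix(2)] cell[of i] unfolding g_def by linarith
  qed
  have gb: "\<bar>g x\<bar> \<le> e * D / (8 * R)" for x
    using unit[of "frac x"] periodic1_frac[OF gper, of x] frac_lt_1[of x] by simp
  have \<xi>lip: "e-lipschitz_on UNIV \<xi>"
  proof (rule lipschitz_realI)
    fix x y
    have "\<bar>\<xi> x - \<xi> y\<bar> \<le> (\<Sum>j<R. \<bar>\<kappa> j * tent l (x - c j) - \<kappa> j * tent l (y - c j)\<bar>)"
      unfolding \<xi>_def sum_subtractf[symmetric] by (rule sum_abs)
    also have "\<dots> \<le> (\<Sum>j<R. e * D / (4 * R * l) * (1 / l * \<bar>x - y\<bar>))"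
    proof (rule sum_mono)
      fix j
      have "\<bar>\<kappa> j * tent l (x - c j) - \<kappa> j * tent l (y - c j)\<bar> = \<kappa> j * \<bar>tent l (x - c j) - tent l (y - c j)\<bar>"
        using \<kappa>[of j] by (simp add: right_diff_distrib[symmetric] abs_mult)
      also have "\<dots> \<le> e * D / (4 * R * l) * (1 / l * \<bar>x - y\<bar>)"
        using \<kappa>[of j] lipschitz_realD[OF tent_lipschitz[OF l(1)], of "x - c j" "y - c j"] by (intro mult_mono) auto
      finally show "\<bar>\<kappa> j * tent l (x - c j) - \<kappa> j * tent l (y - c j)\<bar> \<le> e * D / (4 * R * l) * (1 / l * \<bar>x - y\<bar>)" .
    qed
    \<comment> \<open>The coefficients carry a factor \<open>D / l\<close> and the tents have slope
      \<open>1 / l\<close>; this is the use of \<open>D \<le> 4 * l\<^sup>2\<close>.\<close>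
    also have "\<dots> = e * (D / (4 * l\<^sup>2)) * \<bar>x - y\<bar>" using R0 by (simp add: power2_eq_square)
    also have "\<dots> \<le> e * 1 * \<bar>x - y\<bar>"
      using D l e by (intro mult_right_mono mult_left_mono) (auto simp: divide_le_eq_1)
    finally show "\<bar>\<xi> x - \<xi> y\<bar> \<le> e * \<bar>x - y\<bar>" by simp
  qed (use e in simp)
  have "(2 * e)-lipschitz_on UNIV (\<lambda>x. \<rho> x - \<xi> x)"
  proof (rule lipschitz_realI)
    show "\<bar>(\<rho> x - \<xi> x) - (\<rho> y - \<xi> y)\<bar> \<le> 2 * e * \<bar>x - y\<bar>" for x y
      using lipschitz_realD[OF \<rho>lip, of x y] lipschitz_realD[OF \<xi>lip, of x y] by linarith
  qed (use e in simp)
  moreover have "0 \<le> \<xi> x \<and> \<xi> x \<le> e * D / (4 * l)" for x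
  proof
    show "0 \<le> \<xi> x" unfolding \<xi>_def using \<kappa> tent_bounds by (intro sum_nonneg mult_nonneg_nonneg) auto
    have "\<xi> x \<le> (\<Sum>j<R. e * D / (4 * R * l) * 1)" unfolding \<xi>_def
      using \<kappa> tent_bounds l by (intro sum_mono mult_mono) (auto intro: order_trans)
    also have "\<dots> = e * D / (4 * l)" using R0 by simp
    finally show "\<xi> x \<le> e * D / (4 * l)" .
  qed
  moreover have "\<xi> x = 0" if "\<forall>j<R. l \<le> infdist (x - c j) \<int>" for x
    unfolding \<xi>_def using that tent_vanish[OF l(1)] by (intro sum.neutral) auto
  ultimately show ?thesis using gD gper gb
    by (intro exI[of _ g] exI[of _ "\<lambda>x. \<rho> x - \<xi> x"] exI[of _ \<xi>]) (auto simp: \<rho>_def)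
qed

text \<open>Each bump has value 0 and a prescribed slope at its centre. Subtracting half of two
  neighbouring tents from the central tent makes the total mass 0, so the primitive is locally
  supported modulo 1. Derivatives along an orbit can thus be changed without moving it.\<close>

lemma bump_sum_exists:
  fixes q \<kappa> :: "nat \<Rightarrow> real" and P :: nat and D km :: real
  assumes P: "1 \<le> P" and D: "0 < D" "D \<le> 1" and \<kappa>: "\<And>i. i < P \<Longrightarrow> \<bar>\<kappa> i\<bar> \<le> km"
    and sep: "\<And>i j k. i < P \<Longrightarrow> j < P \<Longrightarrow> i \<noteq> j \<Longrightarrow> 3 * D / 4 \<le> \<bar>q i - q j - of_int k\<bar>"
  shows "\<exists>g g'. (\<forall>x. (g has_real_derivative g' x) (at x)) \<and> periodic1 g \<and> (128 * km / D)-lipschitz_on UNIV g'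
    \<and> (\<forall>x. \<bar>g' x\<bar> \<le> km) \<and> (\<forall>x. \<bar>g x\<bar> \<le> km) \<and> (\<forall>i<P. g (q i) = 0 \<and> g' (q i) = \<kappa> i)"
proof -
  \<comment> \<open>The bumps have radius \<open>3 * w = 3 * D / 32\<close>, well below half the
    separation \<open>3 * D / 4\<close>, so at most one is active at a point.\<close>
  define w where "w = D / 32"
  have w: "0 < w" "w < 1/2" "32 * w \<le> 1" using D by (auto simp: w_def)
  have km0: "0 \<le> km" using \<kappa>[of 0] P by force
  obtain T where T: "\<And>x. (T has_real_derivative tent w x) (at x)" "T 0 = 0" "\<And>x. T (- x) = - T x"
    "\<And>x. w \<le> x \<Longrightarrow> x \<le> 1 - w \<Longrightarrow> T x = T w" "\<And>x. T (x + 1) = T x + 2 * T w"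
    using tent_primitive[OF w(1,2)] by metis
  define \<beta> where "\<beta> x = T x - (T (x - 2 * w) + T (x + 2 * w)) / 2" for x
  define \<beta>' where "\<beta>' x = tent w x - (tent w (x - 2 * w) + tent w (x + 2 * w)) / 2" for x
  have \<beta>D: "(\<beta> has_real_derivative \<beta>' x) (at x)" for x
  proof -
    have "((\<lambda>x. T (x + b)) has_real_derivative tent w (x + b)) (at x)" for b
      using T(1)[of "x + b"] by (simp add: DERIV_shift)
    from DERIV_diff[OF T(1)[of x] DERIV_cdivide[OF DERIV_add[OF this[of "- (2 * w)"] this[of "2 * w"]], of 2]]
    show ?thesis unfolding \<beta>_def \<beta>'_def by simp
  qed
  have \<beta>per: "periodic1 \<beta>"
    unfolding periodic1_def \<beta>_def
  proof
    fix x
    have "T (x + 1 - 2 * w) = T (x - 2 * w) + 2 * T w" "T (x + 1 + 2 * w) = T (x + 2 * w) + 2 * T w"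
      using T(5)[of "x - 2 * w"] T(5)[of "x + 2 * w"] by (simp_all add: algebra_simps)
    then show "T (x + 1) - (T (x + 1 - 2 * w) + T (x + 1 + 2 * w)) / 2 = T x - (T (x - 2 * w) + T (x + 2 * w)) / 2"
      using T(5)[of x] by argo
  qed
  have \<beta>0: "\<beta> 0 = 0" using T(2) T(3)[of "2 * w"] by (simp add: \<beta>_def)
  have "tent w (2 * w) = 0" using w by (intro tent_vanish infdist_Ints_between) auto
  moreover have "tent w (- (2 * w)) = tent w (2 * w)" unfolding tent_def infdist_Ints_uminus ..
  ultimately have \<beta>'0: "\<beta>' 0 = 1" by (simp add: \<beta>'_def tent_zero)
  have vanish': "\<beta>' x = 0" if "3 * w \<le> infdist x \<int>" for x
  proof -
    have "w \<le> infdist (x - 2 * w) \<int>" "w \<le> infdist (x + 2 * w) \<int>" "w \<le> infdist x \<int>"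
      using infdist_lipschitz[of x \<int> "x - 2 * w"] infdist_lipschitz[of x \<int> "x + 2 * w"] that w by auto
    then show ?thesis by (simp add: \<beta>'_def tent_vanish[OF w(1)])
  qed
  have vanish: "\<beta> x = 0" if "3 * w \<le> infdist x \<int>" for x
  proof -
    have "infdist x \<int> \<le> dist x (of_int \<lfloor>x\<rfloor>)" "infdist x \<int> \<le> dist x (of_int (\<lfloor>x\<rfloor> + 1))"
      by (intro infdist_le; simp)+
    then have "3 * w \<le> frac x" "frac x \<le> 1 - 3 * w"
      using that frac_lt_1[of x] by (auto simp: dist_real_def frac_def)
    then have "\<beta> (frac x) = 0"
      using T(4)[of "frac x"] T(4)[of "frac x - 2 * w"] T(4)[of "frac x + 2 * w"] w by (simp add: \<beta>_def)
    then show ?thesis using periodic1_frac[OF \<beta>per] by simp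
  qed
  have \<beta>'1: "\<bar>\<beta>' x\<bar> \<le> 1" for x
    unfolding \<beta>'_def using tent_bounds(1)[of w x] tent_bounds(1)[of w "x - 2 * w"] tent_bounds(1)[of w "x + 2 * w"]
      tent_bounds(2)[OF w(1), of x] tent_bounds(2)[OF w(1), of "x - 2 * w"] tent_bounds(2)[OF w(1), of "x + 2 * w"]
    by (simp add: abs_le_iff field_simps)
  have \<beta>'lip: "\<bar>\<beta>' x - \<beta>' y\<bar> \<le> 2 / w * \<bar>x - y\<bar>" for x y
  proof -
    have t: "\<bar>tent w a - tent w b\<bar> \<le> 1 / w * \<bar>a - b\<bar>" for a b by (rule lipschitz_realD[OF tent_lipschitz[OF w(1)]])
    define t0 where "t0 = 1 / w * \<bar>x - y\<bar>"
    have 1: "\<bar>tent w x - tent w y\<bar> \<le> t0" unfolding t0_def by (rule t)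
    have 2: "\<bar>tent w (x - 2 * w) - tent w (y - 2 * w)\<bar> \<le> t0"
      using t[of "x - 2 * w" "y - 2 * w"] by (simp add: t0_def)
    have 3: "\<bar>tent w (x + 2 * w) - tent w (y + 2 * w)\<bar> \<le> t0"
      using t[of "x + 2 * w" "y + 2 * w"] by (simp add: t0_def)
    have "2 / w * \<bar>x - y\<bar> = t0 + t0" by (simp add: t0_def)
    then show ?thesis unfolding \<beta>'_def using 1 2 3 by argo
  qed
  define g where "g x = (\<Sum>i<P. \<kappa> i * \<beta> (x - q i))" for x
  define g' where "g' x = (\<Sum>i<P. \<kappa> i * \<beta>' (x - q i))" for x
  have gD: "(g has_real_derivative g' x) (at x)" for x
    unfolding g_def g'_def by (rule DERIV_sum_shift[OF \<beta>D])
  have gper: "periodic1 g"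
    unfolding periodic1_def g_def
  proof (intro allI sum.cong refl)
    fix x i
    have "\<beta> (x + 1 - q i) = \<beta> ((x - q i) + 1)" by (simp add: algebra_simps)
    then show "\<kappa> i * \<beta> (x + 1 - q i) = \<kappa> i * \<beta> (x - q i)" using \<beta>per by (simp add: periodic1_def)
  qed
  have one: "\<exists>i<P. \<forall>j<P. j \<noteq> i \<longrightarrow> 3 * w \<le> infdist (x - q j) \<int>" for x
  proof (cases "\<exists>i<P. infdist (x - q i) \<int> < 3 * w")
    case False then show ?thesis using P by (intro exI[of _ 0]) force
  next
    case True
    then obtain i where i: "i < P" "infdist (x - q i) \<int> < 3 * w" by blast
    have "3 * w \<le> infdist (x - q j) \<int>" if "j < P" "j \<noteq> i" for j
    proof (rule ccontr)
      assume "\<not> ?thesis"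
      then obtain a b where ab: "a \<in> \<int>" "b \<in> \<int>" "\<bar>x - q i - a\<bar> < 3 * w" "\<bar>x - q j - b\<bar> < 3 * w"
        using infdist_lessD[OF i(2)] infdist_lessD[of "x - q j" \<int> "3 * w"] by (auto simp: not_le)
      then obtain k l where kl: "a = of_int k" "b = of_int l" by (auto elim!: Ints_cases)
      have "\<bar>q i - q j - of_int (l - k)\<bar> < 6 * w" using ab kl by simp
      then show False using sep[OF i(1) that(1), of "l - k"] that(2) w(1) by (simp add: w_def)
    qed
    then show ?thesis using i(1) by blast
  qed
  have single: "g x = \<kappa> i * \<beta> (x - q i) \<and> g' x = \<kappa> i * \<beta>' (x - q i)"
    if "i < P" "\<forall>j<P. j \<noteq> i \<longrightarrow> 3 * w \<le> infdist (x - q j) \<int>" for i x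
  proof
    have "(\<Sum>j\<in>{..<P} - {i}. \<kappa> j * \<beta> (x - q j)) = 0" using that vanish by (intro sum.neutral) auto
    then show "g x = \<kappa> i * \<beta> (x - q i)" using that(1) by (simp add: g_def sum.remove[of _ i])
    have "(\<Sum>j\<in>{..<P} - {i}. \<kappa> j * \<beta>' (x - q j)) = 0" using that vanish' by (intro sum.neutral) auto
    then show "g' x = \<kappa> i * \<beta>' (x - q i)" using that(1) by (simp add: g'_def sum.remove[of _ i])
  qed
  have g'b: "\<bar>g' x\<bar> \<le> km" for x
  proof -
    obtain i where i: "i < P" "\<forall>j<P. j \<noteq> i \<longrightarrow> 3 * w \<le> infdist (x - q j) \<int>" using one by blast
    then have "\<bar>g' x\<bar> = \<bar>\<kappa> i\<bar> * \<bar>\<beta>' (x - q i)\<bar>" using single[OF i] by (simp add: abs_mult)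
    also have "\<dots> \<le> km * 1" using \<kappa>[OF i(1)] \<beta>'1 by (intro mult_mono) auto
    finally show ?thesis by simp
  qed
  have each: "\<bar>\<kappa> i * \<beta>' (x - q i) - \<kappa> i * \<beta>' (y - q i)\<bar> \<le> 64 * km / D * \<bar>x - y\<bar>" if "i < P" for i x y
  proof -
    have "\<bar>\<kappa> i * \<beta>' (x - q i) - \<kappa> i * \<beta>' (y - q i)\<bar> = \<bar>\<kappa> i\<bar> * \<bar>\<beta>' (x - q i) - \<beta>' (y - q i)\<bar>"
      by (simp add: right_diff_distrib[symmetric] abs_mult)
    also have "\<dots> \<le> km * (2 / w * \<bar>x - y\<bar>)"
      using \<kappa>[OF that] \<beta>'lip[of "x - q i" "y - q i"] by (intro mult_mono) auto
    finally show ?thesis by (simp add: w_def mult_ac)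
  qed
  have "(128 * km / D)-lipschitz_on UNIV g'"
  proof (rule lipschitz_realI)
    fix x y
    obtain i where i: "i < P" "\<forall>j<P. j \<noteq> i \<longrightarrow> 3 * w \<le> infdist (x - q j) \<int>" using one by blast
    obtain j where j: "j < P" "\<forall>l<P. l \<noteq> j \<longrightarrow> 3 * w \<le> infdist (y - q l) \<int>" using one by blast
    \<comment> \<open>The two points may lie in different bumps, each contributing up to
      \<open>64 * km / D\<close>; hence the constant 128.\<close>
    have dd: "128 * km / D * \<bar>x - y\<bar> = 64 * km / D * \<bar>x - y\<bar> + 64 * km / D * \<bar>x - y\<bar>" by simp
    have nn: "0 \<le> 64 * km / D * \<bar>x - y\<bar>" using km0 D by simp
    show "\<bar>g' x - g' y\<bar> \<le> 128 * km / D * \<bar>x - y\<bar>"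
    proof (cases "i = j")
      case True
      then show ?thesis using single[OF i] single[OF j] each[OF i(1), of x y] dd nn by simp
    next
      case False
      then have "\<beta>' (y - q i) = 0" "\<beta>' (x - q j) = 0" using i j vanish' by auto
      then show ?thesis using single[OF i] single[OF j] each[OF i(1), of x y] each[OF j(1), of x y] dd by simp
    qed
  qed (use km0 D in simp)
  moreover have gq: "g (q i) = 0 \<and> g' (q i) = \<kappa> i" if "i < P" for i
  proof -
    have "\<forall>j<P. j \<noteq> i \<longrightarrow> 3 * w \<le> infdist (q i - q j) \<int>"
    proof (intro allI impI infdist_Ints_ge)
      fix j k assume "j < P" "j \<noteq> i"
      then show "3 * w \<le> \<bar>q i - q j - of_int k\<bar>" using sep[OF that, of j k] D by (simp add: w_def)
    qed
    from single[OF that this] show ?thesis using \<beta>0 \<beta>'0 by simp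
  qed
  moreover have "\<bar>g x\<bar> \<le> km" for x
  proof -
    \<comment> \<open>\<open>g\<close> vanishes at \<open>q 0\<close>, and an integer shift brings
      every point within 1 of \<open>q 0\<close>.\<close>
    define k where "k = \<lfloor>x - q 0\<rfloor>"
    have "g x = g ((x - of_int k) + of_int k)" by simp
    also have "\<dots> = g (x - of_int k)" by (rule periodic1_int[OF gper])
    finally have "\<bar>g x\<bar> = \<bar>g (x - of_int k) - g (q 0)\<bar>" using gq[of 0] P by simp
    also have "\<dots> \<le> km * \<bar>x - of_int k - q 0\<bar>" by (rule lipschitz_realD[OF lipschitz_from_deriv[OF gD g'b]])
    also have "\<dots> \<le> km * 1" using km0 unfolding k_def by (intro mult_left_mono) linarith+
    finally show ?thesis by simp
  qed
  ultimately show ?thesis using gD gper g'b by (intro exI[of _ g] exI[of _ g']) auto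
qed

text \<open>First raise \<open>A\<close> by \<open>x1\<close>, where ln t \<le> t - 1 gives a gain
  linear in \<open>x1\<close>, then lower by \<open>x2\<close>, which cannot lead below
  \<open>m / 2\<close>. The bound \<open>x1 \<le> 1\<close> replaces the denominator
  \<open>A + x1\<close> by \<open>M + 1\<close>.\<close>

lemma ln_perturb_lower:
  fixes m A M B x1 x2 :: real
  assumes "0 < m" "m \<le> A" "A \<le> M" "0 \<le> x1" "x1 \<le> 1" "0 \<le> x2" "x2 \<le> m / 2" "A + x1 - x2 \<le> B"
  shows "x1 / (M + 1) - 2 * x2 / m \<le> ln B - ln A"
proof -
  have "ln (A / (A + x1)) \<le> A / (A + x1) - 1" using assms by (intro ln_le_minus_one) auto
  then have "1 - A / (A + x1) \<le> ln (A + x1) - ln A" using assms by (simp add: ln_div)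
  moreover have "x1 / (M + 1) \<le> 1 - A / (A + x1)"
  proof -
    have "1 - A / (A + x1) = x1 / (A + x1)" using assms by (simp add: field_simps)
    moreover have "x1 / (M + 1) \<le> x1 / (A + x1)" using assms by (intro divide_left_mono) auto
    ultimately show ?thesis by simp
  qed
  moreover have "- (2 * x2 / m) \<le> ln (A + x1 - x2) - ln (A + x1)"
    using ln_diff_le[of "m / 2" "A + x1 - x2" "A + x1"] assms by (simp add: abs_le_iff field_simps)
  moreover have "ln (A + x1 - x2) \<le> ln B" using assms by simp
  ultimately show ?thesis by linarith
qed

section \<open>Stability of expansion, and the perturbation with its constants\<close>

context expanding_lift begin

text \<open>Chosen so that \<open>(1 + L * KS) * stab\<close> is the drop from the minimal slope
  \<open>C * lam\<close> to \<open>C * lam / sqrt lam\<close>.\<close>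

definition stab :: real where "stab = C * lam * (1 - 1 / sqrt lam) / (1 + L * KS)"

lemma stab_pos: "0 < stab"
  using C_pos lam L_nonneg KS_pos by (simp add: stab_def add_pos_nonneg)

text \<open>Every orbit of \<open>H\<close> is shadowed by an orbit of \<open>F\<close>, and factor
  by factor the derivative shrinks by at most \<open>sqrt lam\<close>. So \<open>C\<close> is kept,
  and the resulting constants are the same for all nearby maps.\<close>

lemma nearby_expanding:
  assumes "\<And>x. H differentiable at x" "(L + 1)-lipschitz_on UNIV (deriv H)" "\<And>x. H (x + 1) = H x + of_int d"
    and a: "\<And>x. \<bar>H x - F x\<bar> \<le> stab" and b: "\<And>x. \<bar>deriv H x - deriv F x\<bar> \<le> stab"
  shows "expanding_lift H d (L + 1) C (sqrt lam)"
proof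
  show "1 < sqrt lam" using lam by simp
  fix n z
  obtain x where x: "\<And>i. \<bar>(F ^^ i) x - (H ^^ i) z\<bar> \<le> KS * stab"
  proof -
    have "\<bar>F ((H ^^ i) z) - (H ^^ Suc i) z\<bar> \<le> stab" for i using a[of "(H ^^ i) z"] by (simp add: abs_minus_commute)
    then show ?thesis using shadow_exists[of "\<lambda>i. (H ^^ i) z" stab] that by blast
  qed
  have sl: "0 < sqrt lam" using lam by simp
  have step: "\<bar>deriv F ((F ^^ i) x)\<bar> / sqrt lam \<le> \<bar>deriv H ((H ^^ i) z)\<bar>" for i
  proof -
    have "\<bar>deriv F ((F ^^ i) x) - deriv F ((H ^^ i) z)\<bar> \<le> L * \<bar>(F ^^ i) x - (H ^^ i) z\<bar>"
      by (rule lipschitz_realD[OF lip])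
    also have "\<dots> \<le> L * (KS * stab)" using x L_nonneg by (intro mult_left_mono) auto
    finally have "\<bar>deriv F ((F ^^ i) x)\<bar> - (1 + L * KS) * stab \<le> \<bar>deriv H ((H ^^ i) z)\<bar>"
      using b[of "(H ^^ i) z"] by (simp add: algebra_simps)
    moreover have "(1 + L * KS) * stab = C * lam * (1 - 1 / sqrt lam)"
    proof -
      have "0 < 1 + L * KS" using L_nonneg KS_pos by (simp add: add_pos_nonneg)
      then show ?thesis by (simp add: stab_def)
    qed
    moreover have "C * lam * (1 - 1 / sqrt lam) \<le> \<bar>deriv F ((F ^^ i) x)\<bar> * (1 - 1 / sqrt lam)"
      using deriv_lower lam by (intro mult_right_mono) auto
    ultimately show ?thesis by (simp add: algebra_simps)
  qed
  have "lam ^ n = sqrt lam ^ n * sqrt lam ^ n" using lam by (simp add: power_mult_distrib[symmetric])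
  then have "C * sqrt lam ^ n = C * lam ^ n / sqrt lam ^ n" using sl by simp
  also have "\<dots> \<le> (\<Prod>i<n. \<bar>deriv F ((F ^^ i) x)\<bar>) / sqrt lam ^ n"
    using exp_prod sl by (intro divide_right_mono) auto
  also have "\<dots> = (\<Prod>i<n. \<bar>deriv F ((F ^^ i) x)\<bar> / sqrt lam)" by (simp add: prod_dividef)
  also have "\<dots> \<le> (\<Prod>i<n. \<bar>deriv H ((H ^^ i) z)\<bar>)" using step sl by (intro prod_mono) auto
  finally show "C * sqrt lam ^ n \<le> (\<Prod>i<n. \<bar>deriv H ((H ^^ i) z)\<bar>)" .
qed (use assms C_pos C_le in auto)

end

text \<open>Packages a finite list of smallness requirements, so that a constant can be picked in
  one go.\<close>

lemma small_enough:
  fixes xs :: "(real \<times> real) list"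
  assumes "\<And>k v. (k, v) \<in> set xs \<Longrightarrow> 0 < v"
  shows "\<exists>e>0. \<forall>t. 0 < t \<longrightarrow> t \<le> e \<longrightarrow> (\<forall>(k, v)\<in>set xs. k * t \<le> v)"
  using assms
proof (induction xs)
  case Nil then show ?case by (intro exI[of _ 1]) auto
next
  case (Cons p xs)
  obtain k v where p: "p = (k, v)" by (cases p)
  have v: "0 < v" using Cons.prems[of k v] p by simp
  obtain e where e: "0 < e" "\<And>t k v. 0 < t \<Longrightarrow> t \<le> e \<Longrightarrow> (k, v) \<in> set xs \<Longrightarrow> k * t \<le> v"
    using Cons by force
  have "k * t \<le> v" if "0 < t" "t \<le> v / (\<bar>k\<bar> + 1)" for t
  proof -
    have "k * t \<le> (\<bar>k\<bar> + 1) * t" using that by (intro mult_right_mono) auto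
    also have "\<dots> \<le> v" using that(2) by (simp add: field_simps)
    finally show ?thesis .
  qed
  then show ?case using e v by (intro exI[of _ "min e (v / (\<bar>k\<bar> + 1))"]) (auto simp: p)
qed

context expanding_lift begin

lemma orbit_set_shift: "a \<in> orbit_set y \<longleftrightarrow> a + 1 \<in> orbit_set y"
proof
  assume "a \<in> orbit_set y"
  then obtain i k where "a = (F ^^ i) y + of_int k" by (auto simp: orbit_set_def)
  then have "a + 1 = (F ^^ i) y + of_int (k + 1)" by simp
  then show "a + 1 \<in> orbit_set y" unfolding orbit_set_def by blast
next
  assume "a + 1 \<in> orbit_set y"
  then obtain i k where "a + 1 = (F ^^ i) y + of_int k" by (auto simp: orbit_set_def)
  then have "a = (F ^^ i) y + of_int (k - 1)" by simp
  then show "a \<in> orbit_set y" unfolding orbit_set_def by blast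
qed

lemma orbit_set_separated:
  assumes P: "1 \<le> P" "(F ^^ P) y - y \<in> \<int>" and D: "D \<le> 1"
    and sep: "\<And>i j. i < j \<Longrightarrow> j < P \<Longrightarrow> D \<le> cdist ((F ^^ i) y) ((F ^^ j) y)"
    and o12: "o1 \<in> orbit_set y" "o2 \<in> orbit_set y" "o1 \<noteq> o2"
  shows "D \<le> \<bar>o1 - o2\<bar>"
proof -
  have red: "\<exists>i<P. \<exists>k. pp = (F ^^ i) y + of_int k" if po: "pp \<in> orbit_set y" for pp
  proof -
    obtain i k where pp: "pp = (F ^^ i) y + of_int k" using po by (auto simp: orbit_set_def)
    have "(F ^^ i) y - (F ^^ (i mod P)) y \<in> \<int>"
      using periodic_orbit_mult[OF P(2), of "i mod P" "i div P"] by simp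
    then obtain l where "(F ^^ i) y = (F ^^ (i mod P)) y + of_int l" by (metis Ints_cases add.commute diff_add_cancel)
    then have "pp = (F ^^ (i mod P)) y + of_int (l + k)" using pp by simp
    moreover have "i mod P < P" using P(1) by simp
    ultimately show ?thesis by blast
  qed
  obtain i k where i: "i < P" "o1 = (F ^^ i) y + of_int k" using red[OF o12(1)] by blast
  obtain j l where j: "j < P" "o2 = (F ^^ j) y + of_int l" using red[OF o12(2)] by blast
  have e: "\<bar>o1 - o2\<bar> = \<bar>(F ^^ i) y - (F ^^ j) y - of_int (l - k)\<bar>" using i j by simp
  consider "i < j" | "j < i" | "i = j" by linarith
  then show ?thesis
  proof cases
    case 1 then show ?thesis using sep[OF 1 j(1)] cdist_le[of "(F ^^ i) y" "(F ^^ j) y" "l - k"] e by linarith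
  next
    case 2 then show ?thesis using sep[OF 2 i(1)] cdist_commute_le[of "(F ^^ j) y" "(F ^^ i) y" "l - k"] e by linarith
  next
    case 3
    then have "\<bar>o1 - o2\<bar> = of_int \<bar>k - l\<bar>" "k \<noteq> l" using i j o12(3) by auto
    moreover from this have "1 \<le> \<bar>k - l\<bar>" by linarith
    then have "1 \<le> real_of_int \<bar>k - l\<bar>" by (metis of_int_1 of_int_le_iff)
    ultimately show ?thesis using D by linarith
  qed
qed

text \<open>The image of the interval under \<open>F ^^ m\<close> has length at least 1 and
  therefore meets every class modulo 1.\<close>

lemma cover_point:
  assumes "a \<le> b" "1 \<le> C * lam ^ m * (b - a)"
  shows "\<exists>c. a \<le> c \<and> c \<le> b \<and> (F ^^ m) c - x \<in> \<int>"
proof -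
  have ex: "1 \<le> \<bar>(F ^^ m) a - (F ^^ m) b\<bar>" using expand[of m a b] assms by (simp add: abs_minus_commute)
  define lo hi where "lo = min ((F ^^ m) a) ((F ^^ m) b)" and "hi = max ((F ^^ m) a) ((F ^^ m) b)"
  define k where "k = \<lceil>lo - x\<rceil>"
  have k: "lo \<le> x + of_int k" "x + of_int k \<le> hi" using ex unfolding k_def lo_def hi_def by linarith+
  have "is_interval ((F ^^ m) ` {a..b})"
    unfolding is_interval_connected_1 by (intro connected_continuous_image cont_pow) simp
  moreover have "lo \<in> (F ^^ m) ` {a..b}" "hi \<in> (F ^^ m) ` {a..b}"
    using assms(1) by (auto simp: lo_def hi_def min_def max_def)
  ultimately have "x + of_int k \<in> (F ^^ m) ` {a..b}" using k unfolding is_interval_1 by blast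
  then obtain c where "c \<in> {a..b}" "(F ^^ m) c = x + of_int k" by auto
  then show ?thesis by (intro exI[of _ c]) auto
qed

end

context nearby_lifts begin

text \<open>\<open>W\<close> is the complement of a neighbourhood of the orbit. A point whose orbit
  never enters \<open>W\<close> follows one orbit point forever by \<open>tracking\<close>, and
  expansivity of \<open>H\<close> then places it on the continued orbit.\<close>

lemma locking_unique:
  assumes u: "periodic1 u" "Lu-lipschitz_on UNIV u"
    and Gdef: "\<And>x. G x = F.phi x - \<alpha> + u x - u (F x)"
    and G: "periodic1 G" "LG-lipschitz_on UNIV G" "\<And>x. 0 \<le> G x"
    and P: "1 \<le> P" and y: "(F ^^ P) y - y \<in> \<int>" and D: "0 < D" "D \<le> 1"
    and cd: "\<And>i j. i < j \<Longrightarrow> j < P \<Longrightarrow> D \<le> cdist ((F ^^ i) y) ((F ^^ j) y)"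
    and a: "\<And>x. \<bar>H x - F x\<bar> \<le> a"
    and q: "\<And>i. \<bar>(H ^^ i) q - (F ^^ i) y\<bar> \<le> aq" "2 * aq < D"
    and \<delta>: "\<And>i. \<bar>H.phi ((H ^^ i) q) - F.phi ((F ^^ i) y)\<bar> \<le> \<delta>"
    and J: "\<And>z x. z \<in> J \<Longrightarrow> \<bar>x - z\<bar> \<le> F.KS * a \<Longrightarrow> \<eta> \<le> G ((F ^^ m) x)"
    and off: "\<And>z. z \<notin> J \<Longrightarrow> b * min (infdist z (F.orbit_set y)) (D / 8) - c1 * a \<le> H.phi z - F.phi z"
    and on: "\<And>z. z \<in> J \<Longrightarrow> - (\<eta> / 4) \<le> H.phi z - F.phi z"
    and far: "\<And>z. infdist z (F.orbit_set y) < D / 8 \<Longrightarrow> z \<notin> J"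
    and b: "0 < b" and K1: "8 \<le> K1" "a + F.MD * D / K1 + D / K1 < D"
    and c2: "c2 = c1 + F.Lphi * F.KS + 1" "0 \<le> c1"
    and \<xi>: "\<xi> = bsum F G P y" "\<xi> + \<delta> \<le> a"
    and \<gamma>: "\<gamma> = b * D / (2 * K1)" "c2 * a \<le> \<gamma>" "\<gamma> \<le> \<eta> / 4 - c2 * a"
    and n2: "\<xi> + LG * (F.KS * a + D / K1) < \<eta>"
    and \<theta>: "\<theta> = c2 * a / b" "\<theta>2 = H.MD * (\<theta> + aq)"
    and n3: "H.Lphi * H.KK * \<theta>2 + \<xi> + 2 * P * \<delta> + Lu * (F.KS * a + a + F.MD * \<theta>)
      + Lu * (F.KS * a + H.KK * \<theta>2 + aq) \<le> \<gamma> / 2"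
  shows "uniquely_locked H"
proof -
  have sep: "\<And>o1 o2. o1 \<in> F.orbit_set y \<Longrightarrow> o2 \<in> F.orbit_set y \<Longrightarrow> o1 \<noteq> o2 \<Longrightarrow> D \<le> \<bar>o1 - o2\<bar>"
    by (rule F.orbit_set_separated[OF P y D(2) cd])
  obtain B where B: "\<And>n z. \<gamma> / 2 * card {i. i < n \<and> D / K1 \<le> infdist ((H ^^ i) z) (F.orbit_set y)} - B
    \<le> bsum H H.phi n z - n * (bsum H H.phi P q / P)"
  proof -
    have "\<exists>B. \<forall>n z. \<gamma> / 2 * card {i. i < n \<and> D / K1 \<le> infdist ((H ^^ i) z) (F.orbit_set y)} - B
      \<le> bsum H H.phi n z - n * (bsum H H.phi P q / P)"
      by (rule locking[where J=J and m=m, OF u Gdef G P y D(1) _ a q(1) \<delta> _ _ _ _ b K1 c2 \<xi> \<gamma> n2 \<theta> n3 refl])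
        (fact sep J off on far)+
    then show ?thesis using that by blast
  qed
  define W where "W = {z. D / K1 \<le> infdist z (F.orbit_set y)}"
  show ?thesis
  proof (rule H.uniquely_lockedI[where W=W and P=P and q=q and c="\<gamma> / 2" and B=B])
    show "1 \<le> P" by (fact P)
    show "(H ^^ P) q - q \<in> \<int>" by (rule continued_orbit_periodic[OF y q(1)])
    show "(H ^^ i) q - (H ^^ j) q \<notin> \<int>" if ij: "i < j" "j < P" for i j
    proof
      assume "(H ^^ i) q - (H ^^ j) q \<in> \<int>"
      then obtain k where k: "(H ^^ i) q - (H ^^ j) q = of_int k" by (auto elim: Ints_cases)
      have "cdist ((F ^^ i) y) ((F ^^ j) y) \<le> \<bar>(F ^^ i) y - (F ^^ j) y - of_int k\<bar>" by (rule cdist_le)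
      also have "\<dots> \<le> 2 * aq" using q(1)[of i] q(1)[of j] k by linarith
      finally show False using cd[OF ij] q(2) by linarith
    qed
    have "closed W" unfolding W_def by (intro closed_Collect_le continuous_intros)
    then show "W \<in> sets borel" by simp
    show "periodic1 (\<lambda>z. z \<in> W)" unfolding periodic1_def W_def
      using infdist_periodic[of "F.orbit_set y"] F.orbit_set_shift by simp
    show "0 < \<gamma> / 2" unfolding \<gamma>(1) using b D K1 by simp
    show "\<gamma> / 2 * card {i. i < n \<and> (H ^^ i) z \<in> W} - B \<le> bsum H H.phi n z - n * (bsum H H.phi P q / P)" for n z
      using B[of n z] by (simp add: W_def)
    show "\<exists>j. z - (H ^^ j) q \<in> \<int>" if z: "\<And>i. (H ^^ i) z \<notin> W" for z
    proof -
      have close: "infdist ((H ^^ l) z) (F.orbit_set y) < D / K1" for l using z[of l] by (simp add: W_def not_le)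
      obtain p where p: "p \<in> F.orbit_set y" "\<bar>z - p\<bar> < D / K1"
        using infdist_lessD[OF close[of 0] F.orbit_set_ne] by auto
      obtain j k where jk: "p = (F ^^ j) y + of_int k" using p(1) by (auto simp: F.orbit_set_def)
      have "z = (H ^^ j) q + of_int k"
      proof (rule H.expansive)
        fix i
        have "\<bar>(H ^^ i) z - (F ^^ i) p\<bar> < D / K1"
        proof (rule tracking[where D=D and a=a and y=y and N="Suc i"])
          show "a + F.MD * (D / K1) + D / K1 < D" using K1(2) by simp
        qed (fact sep a p | rule close | simp)+
        moreover have "\<bar>(H ^^ i) ((H ^^ j) q + of_int k) - (F ^^ i) p\<bar> \<le> aq"
          using q(1)[of "i + j"] unfolding jk H.deg_pow F.deg_pow by (simp add: funpow_add)
        ultimately show "\<bar>(H ^^ i) z - (H ^^ i) ((H ^^ j) q + of_int k)\<bar> \<le> D / K1 + aq" by linarith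
      qed
      then show ?thesis by (intro exI[of _ j]) simp
    qed
  qed
qed

end

context expanding_lift begin

text \<open>The constants are chosen in the order \<open>\<epsilon>1\<close>, \<mu>,
  \<open>R\<close>, \<open>m\<close>, \<open>l\<close>, then the bounds \<open>D0\<close> and
  \<tau>, then the orbit with its \<open>P\<close> and \<open>D\<close>, and finally \<delta>. So
  the fineness \<open>R\<close> of the sawtooth is fixed before \<open>D\<close>, while the
  tolerance \<delta> may depend on the period.\<close>

theorem locking_perturbation:
  assumes u: "periodic1 u" "Lu-lipschitz_on UNIV u"
    and Gdef: "\<And>x. G x = phi x - \<alpha> + u x - u (F x)"
    and G: "periodic1 G" "LG-lipschitz_on UNIV G" "\<And>x. 0 \<le> G x"
    and z: "z \<in> {0..<1}" "\<And>i. G ((F ^^ i) z) = 0" and xs: "0 < G xs" and \<epsilon>: "0 < \<epsilon>"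
  shows "\<exists>g g' \<delta>. 0 < \<delta> \<and> (\<forall>x. (g has_real_derivative g' x) (at x)) \<and> periodic1 g \<and> \<epsilon>-lipschitz_on UNIV g'
    \<and> (\<forall>x. \<bar>g x\<bar> \<le> \<epsilon> \<and> \<bar>g' x\<bar> \<le> \<epsilon>)
    \<and> (\<forall>H. (\<forall>x. H differentiable at x) \<longrightarrow> (L + 1)-lipschitz_on UNIV (deriv H) \<longrightarrow> (\<forall>x. H (x + 1) = H x + of_int d)
      \<longrightarrow> (\<forall>x. \<bar>H x - (F x + g x)\<bar> \<le> \<delta> \<and> \<bar>deriv H x - (deriv F x + g' x)\<bar> \<le> \<delta>) \<longrightarrow> uniquely_locked H)"
proof -
  have LG: "0 \<le> LG" using G(2) by (rule lipschitz_on_nonneg)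
  have Lu: "0 \<le> Lu" using u(2) by (rule lipschitz_on_nonneg)
  have Lp: "0 \<le> Lphi" using phi_lip by (rule lipschitz_on_nonneg)
  have lipF1: "(L + 1)-lipschitz_on UNIV (deriv F)" by (rule lipschitz_on_le[OF lip]) simp
  \<comment> \<open>\<open>F\<close> is read with the weaker constants \<open>L + 1\<close>,
    \<open>C\<close>, \<open>sqrt lam\<close> in order to name the shadowing and distortion
    constants common to all nearby maps.\<close>
  interpret Fw: expanding_lift F d "L + 1" C "sqrt lam"
    by (rule nearby_expanding) (use diff lipF1 deg stab_pos in auto)
  define hK where "hK = Fw.KK"
  define hS where "hS = Fw.KS"
  define hL where "hL = Fw.Lphi"
  have hK: "0 < hK" and hS: "0 < hS" and hL: "0 \<le> hL"
    unfolding hK_def hS_def hL_def using Fw.KK_pos Fw.KS_pos lipschitz_on_nonneg[OF Fw.phi_lip] by auto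
  define \<epsilon>1 where "\<epsilon>1 = min (\<epsilon> / 4) (min (1 / 4) (stab / 4))"
  have \<epsilon>1: "0 < \<epsilon>1" "4 * \<epsilon>1 \<le> \<epsilon>" "4 * \<epsilon>1 \<le> 1" "4 * \<epsilon>1 \<le> stab" using \<epsilon> stab_pos by (auto simp: \<epsilon>1_def)
  define c1 where "c1 = 2 / (C * lam)"
  define c2 where "c2 = c1 + Lphi * KS + 1"
  have c1: "0 < c1" using Clam_pos by (simp add: c1_def)
  have c2: "0 < c2" using c1 Lp KS_pos by (simp add: c2_def add_pos_nonneg add_nonneg_pos)
  \<comment> \<open>\<open>a = A * a1\<close> has to cover the sawtooth, of size \<open>a1\<close>,
    the second correction \<open>km = (L + 1) * hS * a1\<close> and the tolerance \<delta>, at most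
    \<open>a1\<close>.\<close>
  define A where "A = 2 + (L + 1) * hS"
  have A: "2 \<le> A" "hS \<le> A" "(L + 1) * hS + 1 \<le> A"
    using L_nonneg hS mult_nonneg_nonneg[of L hS] unfolding A_def by (auto simp: algebra_simps)
  \<comment> \<open>The rate at which \<phi> gains with the distance: the slope
    \<open>\<epsilon>1\<close> of the sawtooth, divided as in
    \<open>ln_perturb_lower\<close>.\<close>
  define b where "b = \<epsilon>1 / (MD + 1)"
  have b: "0 < b" "b \<le> 1" using \<epsilon>1 MD_pos by (auto simp: b_def divide_le_eq_1)
  \<comment> \<open>Makes \<open>(MD + 2) * D / K1\<close> equal to \<open>D / 8\<close>, so that
    one step cannot carry a nearby point over to another orbit point.\<close>
  define K1 where "K1 = 8 * (MD + 2)"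
  have K1: "8 \<le> K1" "0 < K1" using MD_pos by (auto simp: K1_def)
  \<comment> \<open>\<open>X\<close> and \<open>Kst\<close> bound \<open>\<theta>2\<close> and the
    comparison losses of \<open>locking\<close> in units of \<open>a / b\<close>.\<close>
  define X where "X = (MD + 2) * (c2 + 2 * hS)"
  have X: "0 \<le> X" using MD_pos c2 hS by (simp add: X_def)
  define Kst where "Kst = hL * hK * X + Lu * (KS + 1 + MD * c2) + Lu * (KS + hK * X + 2 * hS)"
  have Kst: "0 \<le> Kst" unfolding Kst_def using hL hK X Lu KS_pos MD_pos c2 hS by (intro add_nonneg_nonneg mult_nonneg_nonneg) auto
  \<comment> \<open>\<mu> is the ratio to be reached in \<open>a \<le> \<mu> * D\<close>. The
    requirement with \<open>b * b\<close> is decisive: it puts the losses \<open>Kst * a / b\<close>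
    at no more than half of \<open>\<gamma> / 2\<close>.\<close>
  obtain \<mu> where \<mu>: "0 < \<mu>" "Kst * \<mu> \<le> b * b / (8 * K1)" "c2 * \<mu> \<le> b / (2 * K1)" "16 * \<mu> \<le> 1"
      "128 * \<mu> \<le> \<epsilon>1" "2 * \<mu> \<le> C * lam" "2 * \<mu> \<le> stab"
  proof -
    have "\<exists>e>0. \<forall>t. 0 < t \<longrightarrow> t \<le> e \<longrightarrow> (\<forall>(k, v)\<in>set [(Kst, b * b / (8 * K1)), (c2, b / (2 * K1)), (16, 1),
        (128, \<epsilon>1), (2, C * lam), (2, stab)]. k * t \<le> v)"
      by (rule small_enough) (use b K1 \<epsilon>1 Clam_pos stab_pos in auto)
    then show ?thesis using that by auto
  qed
  \<comment> \<open>With \<open>R\<close> teeth the perturbation has size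
    \<open>a = A * \<epsilon>1 * D / (8 * R)\<close>; finer teeth make it small against
    \<open>D\<close> without lowering the slope.\<close>
  obtain R :: nat where R: "1 \<le> R" "A \<le> \<mu> * R"
  proof -
    obtain n :: nat where "A / \<mu> < n" using reals_Archimedean2 by blast
    then have "A \<le> \<mu> * n" using \<mu>(1) by (simp add: field_simps)
    also have "\<dots> \<le> \<mu> * real (Suc n)" using \<mu>(1) by (intro mult_left_mono) auto
    finally show ?thesis by (intro that[of "Suc n"]) auto
  qed
  have R0: "0 < real R" using R by simp
  \<comment> \<open>Under \<open>F ^^ m\<close> half a cell already covers the circle, so every cell
    contains a point in its middle half that is mapped over \<open>xs\<close>.\<close>
  obtain m where m: "1 \<le> C * lam ^ m * (1 / (2 * R))"
  proof -
    obtain m where "2 * R / C < lam ^ m" using real_arch_pow[OF lam] by blast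
    then have "1 \<le> C * lam ^ m * (1 / (2 * R))" using C_pos R0 by (simp add: field_simps)
    then show ?thesis by (rule that)
  qed
  define \<eta> where "\<eta> = G xs / 2"
  have \<eta>: "0 < \<eta>" using xs by (simp add: \<eta>_def)
  \<comment> \<open>Within \<open>2 * l\<close> of such a point \<open>G\<close> after
    \<open>m\<close> steps is still at least \<eta>, half of \<open>G xs\<close>. One
    \<open>l\<close> is the half-width of the teeth, the other is room for shadowing.\<close>
  obtain l where l: "0 < l" "l \<le> 1 / (4 * R)" "LG * MD ^ m * 2 * l \<le> \<eta>"
  proof -
    have "\<exists>e>0. \<forall>t. 0 < t \<longrightarrow> t \<le> e \<longrightarrow> (\<forall>(k, v)\<in>set [(1, 1 / (4 * R)), (LG * MD ^ m * 2, \<eta>)]. k * t \<le> v)"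
      by (rule small_enough) (use R0 \<eta> in auto)
    then show ?thesis using that by auto
  qed
  have "\<exists>c. \<forall>j::nat. (j + 1/4) / R \<le> c j \<and> c j \<le> (j + 3/4) / R \<and> (F ^^ m) (c j) - xs \<in> \<int>"
  proof (rule choice, rule allI)
    fix j :: nat
    have e: "(j + 3/4) / R - (j + 1/4) / R = 1 / (2 * R)" by (simp add: diff_divide_distrib[symmetric])
    show "\<exists>c. (j + 1/4) / R \<le> c \<and> c \<le> (j + 3/4) / R \<and> (F ^^ m) c - xs \<in> \<int>"
      by (rule cover_point) (use m R0 in \<open>auto simp: e divide_right_mono\<close>)
  qed
  then obtain c :: "nat \<Rightarrow> real" where c: "\<And>j. (j + 1/4) / R \<le> c j \<and> c j \<le> (j + 3/4) / R" "\<And>j. (F ^^ m) (c j) - xs \<in> \<int>"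
    by blast
  define v7 v8 where "v7 = \<eta> * (C * lam) / 8" and "v8 = C * lam / 2"
  have v78: "0 < v7" "0 < v8" unfolding v7_def v8_def using \<eta> Clam_pos by auto
  obtain D0 where D0: "0 < D0" and D0': "\<And>D. 0 < D \<Longrightarrow> D \<le> D0 \<Longrightarrow> D \<le> 1 \<and> D \<le> 4 * l\<^sup>2 \<and> KS * D \<le> l
      \<and> (1 + c2) * D \<le> \<eta> / 4 \<and> (1 + LG * (KS + 1)) * D \<le> \<eta> / 2 \<and> (1 + LG * MD ^ m) * D \<le> \<eta> / 2
      \<and> (1 / l + 1) * D \<le> v7 \<and> (1 / l + 1) * D \<le> v8 \<and> D \<le> l"
  proof -
    have "\<exists>e>0. \<forall>t. 0 < t \<longrightarrow> t \<le> e \<longrightarrow> (\<forall>(k, v)\<in>set [(1, 1), (1, 4 * l\<^sup>2), (KS, l), (1 + c2, \<eta> / 4),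
        (1 + LG * (KS + 1), \<eta> / 2), (1 + LG * MD ^ m, \<eta> / 2), (1 / l + 1, v7), (1 / l + 1, v8), (1, l)]. k * t \<le> v)"
      by (rule small_enough) (use \<eta> l v78 in auto)
    then show ?thesis using that by auto
  qed
  \<comment> \<open>The action will be at most \<open>a / 2\<close> and at most a quarter of
    \<open>\<gamma> / 2\<close>.\<close>
  obtain \<tau> where \<tau>: "0 < \<tau>" "\<tau> \<le> 1" "\<tau> \<le> A * \<epsilon>1 / (16 * R)" "\<tau> \<le> b / (16 * K1)"
  proof -
    have "\<exists>e>0. \<forall>t. 0 < t \<longrightarrow> t \<le> e \<longrightarrow> (\<forall>(k, v)\<in>set [(1, 1), (1, A * \<epsilon>1 / (16 * R)), (1, b / (16 * K1))]. k * t \<le> v)"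
      by (rule small_enough) (use A \<epsilon>1 R0 b K1 in auto)
    then show ?thesis using that by auto
  qed
  obtain P y D where P: "1 \<le> P" and D: "0 < D" "D \<le> D0" and y: "(F ^^ P) y - y \<in> \<int>"
    and cd: "\<And>i j. i < j \<Longrightarrow> j < P \<Longrightarrow> D \<le> cdist ((F ^^ i) y) ((F ^^ j) y)" and By: "bsum F G P y \<le> \<tau> * D"
    using separated_periodic_orbit[OF G z \<tau>(1) D0] by blast
  note D' = D0'[OF D]
  have D1: "D \<le> 1" using D' by blast
  let ?Os = "orbit_set y"
  define a1 where "a1 = \<epsilon>1 * D / (8 * R)"
  have a1: "0 < a1" using \<epsilon>1 D R0 by (simp add: a1_def)
  define a where "a = A * a1"
  have a0: "0 < a" using a1 A by (simp add: a_def)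
  have a\<mu>: "a \<le> \<mu> * D"
  proof -
    have "a = (A / R) * (\<epsilon>1 * D / 8)" by (simp add: a_def a1_def)
    also have "\<dots> \<le> \<mu> * (\<epsilon>1 * D / 8)" using R R0 \<epsilon>1 D by (intro mult_right_mono) (auto simp: field_simps)
    also have "\<dots> \<le> \<mu> * D" using \<epsilon>1 D \<mu>(1) by (intro mult_left_mono) auto
    finally show ?thesis .
  qed
  have a\<mu>1: "a \<le> \<mu>" using a\<mu> mult_left_mono[OF D1, of \<mu>] \<mu>(1) by linarith
  have aD: "16 * a \<le> D" using a\<mu> mult_right_mono[OF \<mu>(4), of D] D by linarith
  have hSa: "hS * a1 \<le> a" unfolding a_def using A a1 by (intro mult_right_mono) auto
  have a1a: "2 * a1 \<le> a" unfolding a_def using A a1 by (intro mult_right_mono) auto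
  define \<xi> where "\<xi> = bsum F G P y"
  have \<xi>0: "0 \<le> \<xi>" unfolding \<xi>_def bsum_def using G(3) by (intro sum_nonneg) auto
  have \<xi>a: "\<xi> \<le> a / 2"
  proof -
    have "\<xi> \<le> \<tau> * D" using By by (simp add: \<xi>_def)
    also have "\<dots> \<le> A * \<epsilon>1 / (16 * R) * D" using \<tau> D by (intro mult_right_mono) auto
    also have "\<dots> = a / 2" by (simp add: a_def a1_def)
    finally show ?thesis .
  qed
  have \<xi>b: "\<xi> \<le> b * D / (16 * K1)"
  proof -
    have "\<xi> \<le> \<tau> * D" using By by (simp add: \<xi>_def)
    also have "\<dots> \<le> b / (16 * K1) * D" using \<tau> D by (intro mult_right_mono) auto
    finally show ?thesis by simp
  qed
  have \<xi>D: "\<xi> \<le> D" using \<xi>a aD a0 by linarith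
  define J where "J = {t. \<exists>j<R. infdist (t - c j) \<int> < l}"
  have Jprop: "\<eta> \<le> G ((F ^^ m) x)" if tJ: "t \<in> J" and xt: "\<bar>x - t\<bar> \<le> KS * a" for t x
  proof -
    obtain j where j: "j < R" "infdist (t - c j) \<int> < l" using tJ by (auto simp: J_def)
    obtain s where s: "s \<in> \<int>" "\<bar>t - c j - s\<bar> < l" using infdist_lessD[OF j(2)] by auto
    obtain k where k: "s = of_int k" using s(1) by (auto elim: Ints_cases)
    have "(F ^^ m) (c j + of_int k) - xs \<in> \<int>" unfolding deg_pow using Ints_add[OF c(2)[of j] Ints_of_int[of "d ^ m * k"]]
      by (simp add: algebra_simps)
    then have g: "G ((F ^^ m) (c j + of_int k)) = G xs" by (rule periodic1_diff_int[OF G(1)])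
    have KSa: "KS * a \<le> l"
    proof -
      have "KS * a \<le> KS * D" using aD a0 KS_pos by (intro mult_left_mono) auto
      then show ?thesis using D' by linarith
    qed
    have "\<bar>x - (c j + of_int k)\<bar> \<le> 2 * l" using s(2) xt KSa k by linarith
    then have "MD ^ m * \<bar>x - (c j + of_int k)\<bar> \<le> MD ^ m * (2 * l)" using MD_pos by (intro mult_left_mono) auto
    then have "\<bar>(F ^^ m) x - (F ^^ m) (c j + of_int k)\<bar> \<le> MD ^ m * (2 * l)"
      using F_pow_lip[of m x "c j + of_int k"] by linarith
    then have "LG * \<bar>(F ^^ m) x - (F ^^ m) (c j + of_int k)\<bar> \<le> LG * (MD ^ m * (2 * l))" using LG by (intro mult_left_mono)
    also have "\<dots> \<le> \<eta>" using l(3) by (simp add: mult_ac)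
    finally show ?thesis
      using lipschitz_realD[OF G(2), of "(F ^^ m) x" "(F ^^ m) (c j + of_int k)"] g by (simp add: \<eta>_def)
  qed
  \<comment> \<open>On \<open>J\<close> the value of \<open>G\<close> after \<open>m\<close> steps
    is at least \<eta>, whereas near the orbit it is close to the value at an orbit point, which is
    at most the action.\<close>
  have far: "t \<notin> J" if inf: "infdist t ?Os < D / 8" for t
  proof
    assume "t \<in> J"
    then have 1: "\<eta> \<le> G ((F ^^ m) t)" using Jprop[of t t] KS_pos a0 by simp
    obtain p where p: "p \<in> ?Os" "\<bar>t - p\<bar> < D / 8" using infdist_lessD[OF inf orbit_set_ne] by blast
    have "G ((F ^^ m) p) \<le> \<xi>" unfolding \<xi>_def by (rule orbit_G_le[OF y P G(1,3) orbit_set_pow[OF p(1)]])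
    moreover have "LG * \<bar>(F ^^ m) t - (F ^^ m) p\<bar> \<le> LG * (MD ^ m * D)"
    proof (intro mult_left_mono LG)
      have "MD ^ m * \<bar>t - p\<bar> \<le> MD ^ m * D" using p(2) D MD_pos by (intro mult_left_mono) auto
      then show "\<bar>(F ^^ m) t - (F ^^ m) p\<bar> \<le> MD ^ m * D" using F_pow_lip[of m t p] by linarith
    qed
    moreover have "D + LG * (MD ^ m * D) \<le> \<eta> / 2" using D' by (simp add: algebra_simps)
    ultimately show False using 1 \<xi>D \<eta> lipschitz_realD[OF G(2), of "(F ^^ m) t" "(F ^^ m) p"] by linarith
  qed
  \<comment> \<open>The constant sign of the derivative; adding \<open>s * g1\<close> raises the
    modulus of the derivative where \<open>g1'\<close> is positive, whether or not \<open>F\<close>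
    preserves orientation.\<close>
  obtain s :: real where s: "s = 1 \<or> s = - 1" "\<And>x. \<bar>deriv F x\<bar> = s * deriv F x"
  proof (cases "\<forall>x. 0 < deriv F x")
    case True then show ?thesis by (intro that[of 1]) (auto simp: less_imp_le)
  next
    case False
    then have "\<forall>x. deriv F x < 0" using sgn_const by blast
    then show ?thesis by (intro that[of "-1"]) (auto simp: abs_of_neg)
  qed
  have ss: "s * s = 1" "\<bar>s\<bar> = 1" using s(1) by auto
  obtain g1 g1' \<sigma> where g1: "\<And>x. (g1 has_real_derivative g1' x) (at x)" "periodic1 g1" "(2 * \<epsilon>1)-lipschitz_on UNIV g1'"
    "\<And>x. \<bar>g1 x\<bar> \<le> a1" "\<And>x. g1' x = \<epsilon>1 * min (infdist x ?Os) (D / 8) - \<sigma> x"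
    "\<And>x. 0 \<le> \<sigma> x \<and> \<sigma> x \<le> \<epsilon>1 * D / (4 * l)" "\<And>x. x \<notin> J \<Longrightarrow> \<sigma> x = 0"
  proof -
    have "\<exists>g g' \<xi>. (\<forall>x. (g has_real_derivative g' x) (at x)) \<and> periodic1 g \<and> (2 * \<epsilon>1)-lipschitz_on UNIV g'
      \<and> (\<forall>x. \<bar>g x\<bar> \<le> \<epsilon>1 * D / (8 * R)) \<and> (\<forall>x. g' x = \<epsilon>1 * min (infdist x ?Os) (D / 8) - \<xi> x)
      \<and> (\<forall>x. 0 \<le> \<xi> x \<and> \<xi> x \<le> \<epsilon>1 * D / (4 * l))
      \<and> (\<forall>x. (\<forall>j<R. l \<le> infdist (x - c j) \<int>) \<longrightarrow> \<xi> x = 0)"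
      by (rule sawtooth_exists[OF R(1) l(1,2) \<epsilon>1(1) D(1) _ orbit_set_shift c(1)]) (use D' in blast)
    then obtain f f' \<xi> where f: "\<And>x. (f has_real_derivative f' x) (at x)" "periodic1 f" "(2 * \<epsilon>1)-lipschitz_on UNIV f'"
      "\<And>x. \<bar>f x\<bar> \<le> \<epsilon>1 * D / (8 * R)" "\<And>x. f' x = \<epsilon>1 * min (infdist x ?Os) (D / 8) - \<xi> x"
      "\<And>x. 0 \<le> \<xi> x \<and> \<xi> x \<le> \<epsilon>1 * D / (4 * l)" "\<And>x. (\<forall>j<R. l \<le> infdist (x - c j) \<int>) \<Longrightarrow> \<xi> x = 0"
      by blast
    have "\<xi> x = 0" if "x \<notin> J" for x
    proof (rule f(7), intro allI impI, rule ccontr)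
      fix j assume "j < R" "\<not> l \<le> infdist (x - c j) \<int>"
      then have "x \<in> J" unfolding J_def by (intro CollectI exI[of _ j]) simp
      then show False using that by simp
    qed
    then show ?thesis by (rule that[OF f(1-3) f(4)[folded a1_def] f(5,6)])
  qed
  have g1'b: "\<bar>g1' x\<bar> \<le> \<epsilon>1" for x
  proof -
    have "0 \<le> \<epsilon>1 * min (infdist x ?Os) (D / 8)" using \<epsilon>1 D by (simp add: infdist_nonneg)
    moreover have "\<epsilon>1 * min (infdist x ?Os) (D / 8) \<le> \<epsilon>1 * 1" using \<epsilon>1 D1 D by (intro mult_left_mono) auto
    moreover have "\<epsilon>1 * D / (4 * l) \<le> \<epsilon>1"
    proof -
      have "\<epsilon>1 * D \<le> \<epsilon>1 * (4 * l)" using D' \<epsilon>1 l by (intro mult_left_mono) auto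
      then show ?thesis using l by (simp add: divide_le_eq mult_ac)
    qed
    ultimately show ?thesis using g1(5)[of x] g1(6)[of x] by (simp add: abs_le_iff)
  qed
  \<comment> \<open>The second correction must be centred on the orbit as moved by the first, so the
    intermediate map is treated on its own.\<close>
  define F1 where "F1 x = F x + s * g1 x" for x
  have F1D: "(F1 has_real_derivative (deriv F x + s * g1' x)) (at x)" for x
    unfolding F1_def by (intro DERIV_add DERIV DERIV_cmult g1)
  have F1d: "deriv F1 x = deriv F x + s * g1' x" for x by (rule DERIV_imp_deriv[OF F1D])
  interpret F1: expanding_lift F1 d "L + 1" C "sqrt lam"
  proof (rule nearby_expanding)
    show "F1 differentiable at x" for x using F1D real_differentiable_def by blast
    show "(L + 1)-lipschitz_on UNIV (deriv F1)"
    proof (rule lipschitz_realI)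
      fix x t
      have "\<bar>s * g1' x - s * g1' t\<bar> = \<bar>g1' x - g1' t\<bar>" using s(1) by auto
      also have "\<dots> \<le> 2 * \<epsilon>1 * \<bar>x - t\<bar>" by (rule lipschitz_realD[OF g1(3)])
      also have "\<dots> \<le> 1 * \<bar>x - t\<bar>" using \<epsilon>1 by (intro mult_right_mono) auto
      finally show "\<bar>deriv F1 x - deriv F1 t\<bar> \<le> (L + 1) * \<bar>x - t\<bar>"
        unfolding F1d using lipschitz_realD[OF lip, of x t] by (simp add: algebra_simps)
    qed (use L_nonneg in simp)
    show "F1 (x + 1) = F1 x + of_int d" for x using deg[of x] g1(2) by (simp add: F1_def periodic1_def)
    show "\<bar>F1 x - F x\<bar> \<le> stab" for x
      using g1(4)[of x] ss a1a a1 a\<mu>1 \<mu>(1,7) by (simp add: F1_def abs_mult)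
    show "\<bar>deriv F1 x - deriv F x\<bar> \<le> stab" for x
      unfolding F1d using g1'b[of x] ss \<epsilon>1 by (simp add: abs_mult)
  qed
  interpret N1: nearby_lifts F F1 d L C lam "L + 1" C "sqrt lam" by unfold_locales
  obtain q1 where q1: "\<And>i. \<bar>(F1 ^^ i) q1 - (F ^^ i) y\<bar> \<le> hS * a1"
  proof -
    have "\<bar>F1 ((F ^^ i) y) - (F ^^ Suc i) y\<bar> \<le> a1" for i
      using g1(4)[of "(F ^^ i) y"] ss by (simp add: F1_def abs_mult)
    then show ?thesis using F1.shadow_exists[of "\<lambda>i. (F ^^ i) y" a1] that by (auto simp: hS_def)
  qed
  have q1per: "(F1 ^^ P) q1 - q1 \<in> \<int>" by (rule N1.continued_orbit_periodic[OF y q1])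
  define q where "q i = (F1 ^^ i) q1" for i
  \<comment> \<open>Adding \<open>\<kappa> i\<close> to the slope at \<open>q i\<close> restores the
    slope of \<open>F\<close> at the corresponding point of the old orbit.\<close>
  define \<kappa> where "\<kappa> i = deriv F ((F ^^ i) y) - deriv F1 (q i)" for i
  \<comment> \<open>\<open>L * hS * a1\<close> is due to the displacement of the orbit,
    \<open>hS * a1\<close> to \<open>g1'\<close>, which near the orbit is at most the distance to
    it.\<close>
  define km where "km = (L + 1) * hS * a1"
  have km0: "0 \<le> km" using L_nonneg hS a1 by (simp add: km_def)
  have kma: "km + a1 \<le> a" unfolding km_def a_def using A(3) a1 mult_right_mono[OF A(3), of a1] by (simp add: algebra_simps)
  have infq: "infdist (q i) ?Os \<le> hS * a1" for i
  proof -
    have "(F ^^ i) y = (F ^^ i) y + of_int 0" by simp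
    then have "(F ^^ i) y \<in> ?Os" unfolding orbit_set_def by blast
    then have "infdist (q i) ?Os \<le> dist (q i) ((F ^^ i) y)" by (rule infdist_le)
    then show ?thesis using q1[of i] by (simp add: q_def dist_real_def)
  qed
  have \<kappa>b: "\<bar>\<kappa> i\<bar> \<le> km" for i
  proof -
    have "infdist (q i) ?Os < D / 8" using infq[of i] hSa aD a0 by linarith
    then have "\<sigma> (q i) = 0" using far g1(7) by blast
    then have "g1' (q i) = \<epsilon>1 * min (infdist (q i) ?Os) (D / 8)" using g1(5) by simp
    moreover have "0 \<le> \<epsilon>1 * min (infdist (q i) ?Os) (D / 8)" using \<epsilon>1 D by (simp add: infdist_nonneg)
    moreover have "\<epsilon>1 * min (infdist (q i) ?Os) (D / 8) \<le> 1 * (hS * a1)"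
      using infq[of i] \<epsilon>1 hS a1 D by (intro mult_mono) (auto simp: infdist_nonneg)
    ultimately have g: "\<bar>g1' (q i)\<bar> \<le> hS * a1" by simp
    have "\<bar>deriv F ((F ^^ i) y) - deriv F (q i)\<bar> \<le> L * \<bar>(F ^^ i) y - q i\<bar>" by (rule lipschitz_realD[OF lip])
    also have "\<dots> \<le> L * (hS * a1)" using q1[of i] L_nonneg by (intro mult_left_mono) (auto simp: q_def abs_minus_commute)
    finally have "\<bar>\<kappa> i\<bar> \<le> L * (hS * a1) + \<bar>s * g1' (q i)\<bar>" unfolding \<kappa>_def F1d by linarith
    then show ?thesis using g ss by (simp add: km_def abs_mult algebra_simps)
  qed
  have qsep: "3 * D / 4 \<le> \<bar>q i - q j - of_int k\<bar>" if ij: "i < P" "j < P" "i \<noteq> j" for i j k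
  proof -
    have "D \<le> \<bar>(F ^^ i) y - (F ^^ j) y - of_int k\<bar>"
    proof (cases "i < j")
      case True
      then show ?thesis using cd[OF True ij(2)] cdist_le[of "(F ^^ i) y" "(F ^^ j) y" k] by linarith
    next
      case False
      then have "j < i" using ij by simp
      then show ?thesis using cd[OF _ ij(1)] cdist_commute_le[of "(F ^^ j) y" "(F ^^ i) y" k] by fastforce
    qed
    then show ?thesis using q1[of i] q1[of j] hSa aD unfolding q_def by linarith
  qed
  obtain g2 g2' where g2: "\<And>x. (g2 has_real_derivative g2' x) (at x)" "periodic1 g2" "(128 * km / D)-lipschitz_on UNIV g2'"
    "\<And>x. \<bar>g2' x\<bar> \<le> km" "\<And>x. \<bar>g2 x\<bar> \<le> km" "\<And>i. i < P \<Longrightarrow> g2 (q i) = 0 \<and> g2' (q i) = \<kappa> i"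
    using bump_sum_exists[where q=q and \<kappa>=\<kappa> and km=km, OF P D(1) D1 \<kappa>b qsep] by blast
  define g where "g x = s * g1 x + g2 x" for x
  define g' where "g' x = s * g1' x + g2' x" for x
  have gD: "(g has_real_derivative g' x) (at x)" for x
    unfolding g_def g'_def by (intro DERIV_add DERIV_cmult g1 g2)
  have gper: "periodic1 g" using g1(2) g2(2) by (simp add: periodic1_def g_def)
  have gb: "\<bar>g x\<bar> \<le> a1 + km" for x
    using g1(4)[of x] g2(5)[of x] ss abs_triangle_ineq[of "s * g1 x" "g2 x"] by (simp add: g_def abs_mult)
  have g'b: "\<bar>g' x\<bar> \<le> \<epsilon>1 + km" for x
    using g1'b[of x] g2(4)[of x] ss abs_triangle_ineq[of "s * g1' x" "g2' x"] by (simp add: g'_def abs_mult)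
  have a\<epsilon>: "128 * a \<le> \<epsilon>1 * D" 
  proof -
    have "128 * a \<le> 128 * \<mu> * D" using a\<mu> by simp
    also have "\<dots> \<le> \<epsilon>1 * D" using \<mu>(5) D by (intro mult_right_mono) auto
    finally show ?thesis .
  qed
  have a\<epsilon>1: "128 * a \<le> \<epsilon>1" using a\<epsilon> mult_left_mono[OF D1, of \<epsilon>1] \<epsilon>1 by linarith
  have g'lip: "(3 * \<epsilon>1)-lipschitz_on UNIV g'"
  proof (rule lipschitz_realI)
    fix x t
    have "128 * km / D \<le> \<epsilon>1" using a\<epsilon> kma a1 D by (simp add: divide_le_eq)
    then have "128 * km / D * \<bar>x - t\<bar> \<le> \<epsilon>1 * \<bar>x - t\<bar>" by (intro mult_right_mono) auto
    moreover have "\<bar>s * g1' x - s * g1' t\<bar> = \<bar>g1' x - g1' t\<bar>" using s(1) by auto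
    ultimately show "\<bar>g' x - g' t\<bar> \<le> 3 * \<epsilon>1 * \<bar>x - t\<bar>"
      using lipschitz_realD[OF g1(3), of x t] lipschitz_realD[OF g2(3), of x t] unfolding g'_def by linarith
  qed (use \<epsilon>1 in simp)
  define dc where "dc = ((L + 1) * hS + 1) / (C * sqrt lam)"
  have dc: "0 < dc" using L_nonneg hS C_pos lam by (simp add: dc_def add_nonneg_pos)
  \<comment> \<open>Only now is \<open>P\<close> known; the last condition absorbs the phase error,
    which is multiplied by \<open>P\<close>.\<close>
  obtain \<delta> where \<delta>: "0 < \<delta>" "\<delta> \<le> a1" "dc * \<delta> \<le> a / 2" "2 * P * dc * \<delta> \<le> b * D / (16 * K1)"
  proof -
    have "\<exists>e>0. \<forall>t. 0 < t \<longrightarrow> t \<le> e \<longrightarrow> (\<forall>(k, v)\<in>set [(1, a1), (dc, a / 2), (2 * P * dc, b * D / (16 * K1))]. k * t \<le> v)"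
      by (rule small_enough) (use a1 a0 b D K1 in auto)
    then show ?thesis using that by auto
  qed
  have main: "uniquely_locked H"
    if H: "\<And>x. H differentiable at x" "(L + 1)-lipschitz_on UNIV (deriv H)" "\<And>x. H (x + 1) = H x + of_int d"
      and near: "\<And>x. \<bar>H x - (F x + g x)\<bar> \<le> \<delta>" "\<And>x. \<bar>deriv H x - (deriv F x + g' x)\<bar> \<le> \<delta>" for H
  proof -
    have HF: "\<bar>H x - F x\<bar> \<le> a" for x
    proof -
      have "a1 + km + a1 \<le> a" unfolding a_def A_def km_def by (simp add: algebra_simps)
      then show ?thesis using near(1)[of x] gb[of x] \<delta>(2) by linarith
    qed
    have HF1: "\<bar>deriv H x - deriv F x\<bar> \<le> 2 * \<epsilon>1" for x
      using near(2)[of x] g'b[of x] \<delta>(2) kma a\<epsilon>1 \<epsilon>1 a0 a1 by linarith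
    have HF': "\<bar>deriv H x - deriv F x\<bar> \<le> stab" for x using HF1[of x] \<epsilon>1 by linarith
    have HFs: "\<bar>H x - F x\<bar> \<le> stab" for x using HF[of x] a\<mu>1 \<mu>(1,7) by linarith
    interpret H: expanding_lift H d "L + 1" C "sqrt lam"
      by (rule nearby_expanding[OF H HFs HF'])
    interpret N: nearby_lifts F H d L C lam "L + 1" C "sqrt lam" by unfold_locales
    \<comment> \<open>These constants depend only on \<open>L + 1\<close>, \<open>C\<close> and
      \<open>sqrt lam\<close>, so they are those of \<open>Fw\<close>.\<close>
    have const: "H.KK = hK" "H.KS = hS" "H.Lphi = hL" by (simp_all add: hK_def hS_def hL_def)
    \<comment> \<open>Multiplying by \<open>s\<close> turns the moduli into signed quantities: the
      sawtooth then enters with its own sign, and \<open>g2'\<close> and the tolerance as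
      errors.\<close>
    have low: "\<bar>deriv F x\<bar> + \<epsilon>1 * min (infdist x ?Os) (D / 8) - (\<sigma> x + (km + \<delta>)) \<le> \<bar>deriv H x\<bar>" for x
    proof -
      define e where "e = deriv H x - (deriv F x + g' x)"
      have e: "\<bar>e\<bar> \<le> \<delta>" using near(2)[of x] by (simp add: e_def)
      have "s * deriv H x = s * deriv F x + (s * s) * g1' x + s * g2' x + s * e"
        by (simp add: e_def g'_def algebra_simps)
      also have "\<dots> = \<bar>deriv F x\<bar> + g1' x + s * g2' x + s * e" using s(2) ss by simp
      finally have 1: "s * deriv H x = \<bar>deriv F x\<bar> + g1' x + s * g2' x + s * e" .
      have "s * deriv H x \<le> \<bar>deriv H x\<bar>" "- km \<le> s * g2' x" "- \<delta> \<le> s * e"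
        using s(1) g2(4)[of x] e by (auto simp: abs_le_iff)
      then show ?thesis using 1 g1(5)[of x] by linarith
    qed
    have x1: "0 \<le> \<epsilon>1 * min (infdist x ?Os) (D / 8)" "\<epsilon>1 * min (infdist x ?Os) (D / 8) \<le> 1" for x
    proof -
      show "0 \<le> \<epsilon>1 * min (infdist x ?Os) (D / 8)" using \<epsilon>1 D by (simp add: infdist_nonneg)
      have "\<epsilon>1 * min (infdist x ?Os) (D / 8) \<le> 1 * 1" using \<epsilon>1 D D1 by (intro mult_mono) (auto simp: infdist_nonneg)
      then show "\<epsilon>1 * min (infdist x ?Os) (D / 8) \<le> 1" by simp
    qed
    have k\<delta>: "0 \<le> km + \<delta>" "km + \<delta> \<le> a" using km0 \<delta> kma by auto
    have off: "b * min (infdist t ?Os) (D / 8) - c1 * a \<le> H.phi t - phi t" if "t \<notin> J" for t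
    proof -
      have "\<epsilon>1 * min (infdist t ?Os) (D / 8) / (MD + 1) - 2 * (km + \<delta>) / (C * lam) \<le> ln \<bar>deriv H t\<bar> - ln \<bar>deriv F t\<bar>"
        by (rule ln_perturb_lower[OF Clam_pos deriv_lower deriv_upper x1 k\<delta>(1)])
          (use low[of t] g1(7)[OF that] k\<delta> a\<mu>1 \<mu>(6) in auto)
      moreover have "2 * (km + \<delta>) / (C * lam) \<le> c1 * a"
        unfolding c1_def using k\<delta> Clam_pos by (simp add: divide_right_mono)
      moreover have "b * min (infdist t ?Os) (D / 8) = \<epsilon>1 * min (infdist t ?Os) (D / 8) / (MD + 1)" by (simp add: b_def)
      ultimately show ?thesis unfolding H.phi_def phi_def by linarith
    qed
    have on: "- (\<eta> / 4) \<le> H.phi t - phi t" if "t \<in> J" for t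
    proof -
      define x2 where "x2 = \<sigma> t + (km + \<delta>)"
      have "\<epsilon>1 * D / (4 * l) \<le> D / l"
      proof -
        have "\<epsilon>1 / 4 * (D / l) \<le> 1 * (D / l)" using \<epsilon>1 D l by (intro mult_right_mono) auto
        then show ?thesis by simp
      qed
      then have x2b: "0 \<le> x2" "x2 \<le> (1 / l + 1) * D"
        using g1(6)[of t] k\<delta> aD a0 unfolding x2_def by (auto simp: algebra_simps)
      have x2c: "x2 \<le> C * lam / 2" "x2 \<le> \<eta> * (C * lam) / 8" using x2b D' unfolding v7_def v8_def by linarith+
      have "\<epsilon>1 * min (infdist t ?Os) (D / 8) / (MD + 1) - 2 * x2 / (C * lam) \<le> ln \<bar>deriv H t\<bar> - ln \<bar>deriv F t\<bar>"
        by (rule ln_perturb_lower[OF Clam_pos deriv_lower deriv_upper x1 x2b(1) x2c(1)])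
          (use low[of t] in \<open>simp add: x2_def\<close>)
      moreover have "0 \<le> \<epsilon>1 * min (infdist t ?Os) (D / 8) / (MD + 1)" using x1(1)[of t] MD_pos by simp
      moreover have "2 * x2 / (C * lam) \<le> \<eta> / 4" using x2c(2) Clam_pos by (simp add: divide_le_eq)
      ultimately show ?thesis unfolding H.phi_def phi_def by linarith
    qed
    \<comment> \<open>\<open>g2\<close> vanishes along \<open>q\<close>, so \<open>q\<close> remains
      an orbit after the second correction, now with exactly the derivatives of \<open>F\<close>
      along the orbit of \<open>y\<close>.\<close>
    have Sq: "F (q i) + g (q i) = q (Suc i) \<and> deriv F (q i) + g' (q i) = deriv F ((F ^^ i) y)" for i
    proof -
      define r where "r = i mod P"
      have r: "r < P" using P by (simp add: r_def)
      have qi: "q i - q r \<in> \<int>" unfolding q_def r_def using F1.periodic_orbit_mult[OF q1per, of "i mod P" "i div P"] by simp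
      have yi: "(F ^^ i) y - (F ^^ r) y \<in> \<int>" unfolding r_def using periodic_orbit_mult[OF y, of "i mod P" "i div P"] by simp
      have "g2 (q i) = 0" using periodic1_diff_int[OF g2(2) qi] g2(6)[OF r] by simp
      moreover have "g2' (q i) = \<kappa> r" using periodic1_diff_int[OF periodic1_deriv[OF g2(1,2)] qi] g2(6)[OF r] by simp
      moreover have "deriv F1 (q i) = deriv F1 (q r)" by (rule periodic1_diff_int[OF F1.deriv_periodic qi])
      moreover have "deriv F ((F ^^ i) y) = deriv F ((F ^^ r) y)" by (rule periodic1_diff_int[OF deriv_periodic yi])
      moreover have "deriv F (q i) + g' (q i) = deriv F1 (q i) + g2' (q i)" unfolding g'_def F1d by simp
      moreover have "F (q i) + g (q i) = F1 (q i) + g2 (q i)" unfolding g_def F1_def by simp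
      ultimately show ?thesis by (simp add: \<kappa>_def q_def)
    qed
    obtain qH where qH: "\<And>i. \<bar>(H ^^ i) qH - q i\<bar> \<le> hS * \<delta>"
    proof -
      have "\<bar>H (q i) - q (Suc i)\<bar> \<le> \<delta>" for i using near(1)[of "q i"] Sq[of i] by simp
      then show ?thesis using H.shadow_exists[of q \<delta>] that by (auto simp: hS_def)
    qed
    define aq where "aq = hS * (a1 + \<delta>)"
    have qHy: "\<bar>(H ^^ i) qH - (F ^^ i) y\<bar> \<le> aq" for i
      using qH[of i] q1[of i] unfolding q_def aq_def distrib_left by linarith
    have aqa: "0 \<le> aq" "aq \<le> 2 * hS * a"
    proof -
      show "0 \<le> aq" using hS a1 \<delta> by (simp add: aq_def)
      have "aq \<le> hS * (2 * a)" unfolding aq_def using hS \<delta> a1a a1 by (intro mult_left_mono) auto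
      then show "aq \<le> 2 * hS * a" by simp
    qed
    have aqD: "2 * aq < D"
    proof -
      have "aq \<le> hS * (2 * a1)" unfolding aq_def using hS \<delta> by (intro mult_left_mono) auto
      then show ?thesis using hSa aD a0 by linarith
    qed
    have dphi: "\<bar>H.phi ((H ^^ i) qH) - phi ((F ^^ i) y)\<bar> \<le> dc * \<delta>" for i
    proof -
      let ?w = "(H ^^ i) qH"
      have Cs: "0 < C * sqrt lam" using C_pos lam by simp
      have "\<bar>deriv H ?w - deriv H (q i)\<bar> \<le> (L + 1) * \<bar>?w - q i\<bar>" by (rule lipschitz_realD[OF H(2)])
      also have "\<dots> \<le> (L + 1) * (hS * \<delta>)" using qH[of i] L_nonneg by (intro mult_left_mono) auto
      finally have "\<bar>deriv H ?w - deriv F ((F ^^ i) y)\<bar> \<le> ((L + 1) * hS + 1) * \<delta>"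
        using near(2)[of "q i"] Sq[of i] by (simp add: algebra_simps)
      then have 1: "\<bar>\<bar>deriv H ?w\<bar> - \<bar>deriv F ((F ^^ i) y)\<bar>\<bar> \<le> ((L + 1) * hS + 1) * \<delta>" by linarith
      have "\<bar>H.phi ?w - phi ((F ^^ i) y)\<bar> \<le> \<bar>\<bar>deriv H ?w\<bar> - \<bar>deriv F ((F ^^ i) y)\<bar>\<bar> / (C * sqrt lam)"
        unfolding H.phi_def phi_def by (rule ln_diff_le[OF Cs H.deriv_lower Fw.deriv_lower])
      also have "\<dots> \<le> ((L + 1) * hS + 1) * \<delta> / (C * sqrt lam)" using 1 Cs by (intro divide_right_mono) auto
      finally show ?thesis by (simp add: dc_def)
    qed
    have k1: "a + MD * D / K1 + D / K1 < D"
    proof -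
      have "MD * D / K1 + D / K1 = (MD + 1) * D / K1" by (simp add: add_divide_distrib distrib_right)
      also have "\<dots> \<le> (MD + 2) * D / K1" using D K1 by (intro divide_right_mono mult_right_mono) auto
      also have "\<dots> = D / 8" using MD_pos unfolding K1_def by (simp add: field_simps)
      finally show ?thesis using aD D by linarith
    qed
    define \<gamma> where "\<gamma> = b * D / (2 * K1)"
    have \<gamma>1: "c2 * a \<le> \<gamma>"
    proof -
      have "c2 * a \<le> c2 * (\<mu> * D)" using c2 a\<mu> by (intro mult_left_mono) auto
      also have "\<dots> = (c2 * \<mu>) * D" by simp
      also have "\<dots> \<le> b / (2 * K1) * D" using \<mu>(3) D by (intro mult_right_mono) auto
      finally show ?thesis by (simp add: \<gamma>_def)
    qed
    have \<gamma>2: "\<gamma> \<le> \<eta> / 4 - c2 * a"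
    proof -
      have "b * D / (2 * K1) \<le> 1 * D / 1" using b K1 D by (intro frac_le mult_right_mono) auto
      moreover have "c2 * a \<le> c2 * D" using c2 aD a0 by (intro mult_left_mono) auto
      moreover have "D + c2 * D \<le> \<eta> / 4" using D' by (simp add: algebra_simps)
      ultimately show ?thesis unfolding \<gamma>_def by linarith
    qed
    have n2: "\<xi> + LG * (KS * a + D / K1) < \<eta>"
    proof -
      have "D / K1 \<le> D / 1" using K1 D by (intro divide_left_mono) auto
      moreover have "KS * a \<le> KS * D" using aD a0 KS_pos by (intro mult_left_mono) auto
      ultimately have "LG * (KS * a + D / K1) \<le> LG * (KS * D + D)" using LG by (intro mult_left_mono) auto
      then have "\<xi> + LG * (KS * a + D / K1) \<le> (1 + LG * (KS + 1)) * D" using \<xi>D by (simp add: algebra_simps)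
      then show ?thesis using D' \<eta> by linarith
    qed
    define \<theta> where "\<theta> = c2 * a / b"
    define \<theta>2 where "\<theta>2 = H.MD * (\<theta> + aq)"
    have n3: "H.Lphi * H.KK * \<theta>2 + \<xi> + 2 * real P * (dc * \<delta>) + Lu * (KS * a + a + MD * \<theta>)
      + Lu * (KS * a + H.KK * \<theta>2 + aq) \<le> \<gamma> / 2"
    proof -
      \<comment> \<open>The unit \<open>a / b\<close> dominates \<open>a\<close> because
        \<open>b \<le> 1\<close>, so all comparison losses become multiples of
        \<open>t\<close>.\<close>
      define t where "t = a / b"
      have t: "a \<le> t" "0 \<le> t" using b a0 unfolding t_def by (auto simp: le_divide_eq mult_left_le)
      have \<theta>t: "\<theta> = c2 * t" by (simp add: \<theta>_def t_def)
      have aqt: "aq \<le> 2 * hS * t"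
        using aqa(2) mult_left_mono[OF t(1), of "2 * hS"] hS by linarith
      have HMD: "H.MD \<le> MD + 2" using HF1[of 0] \<epsilon>1 unfolding H.MD_def MD_def by linarith
      have "\<theta>2 \<le> (MD + 2) * (c2 * t + 2 * hS * t)"
        unfolding \<theta>2_def \<theta>t using HMD aqt MD_pos c2 t aqa by (intro mult_mono) auto
      also have "\<dots> = X * t" by (simp add: X_def algebra_simps)
      finally have \<theta>2: "\<theta>2 \<le> X * t" .
      have e1: "hL * hK * \<theta>2 \<le> hL * hK * (X * t)" using \<theta>2 hL hK by (intro mult_left_mono) auto
      have KSt: "KS * a \<le> KS * t" using KS_pos t by (intro mult_left_mono) auto
      have e2: "Lu * (KS * a + a + MD * \<theta>) \<le> Lu * (KS * t + t + MD * (c2 * t))"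
        unfolding \<theta>t using KSt t Lu by (intro mult_left_mono) auto
      have "hK * \<theta>2 \<le> hK * (X * t)" using \<theta>2 hK by (intro mult_left_mono) auto
      then have e3: "Lu * (KS * a + hK * \<theta>2 + aq) \<le> Lu * (KS * t + hK * (X * t) + 2 * hS * t)"
        using KSt aqt Lu by (intro mult_left_mono) auto
      have sum: "hL * hK * (X * t) + Lu * (KS * t + t + MD * (c2 * t)) + Lu * (KS * t + hK * (X * t) + 2 * hS * t) = Kst * t"
        by (simp add: Kst_def algebra_simps)
      have "Kst * t \<le> b * D / (8 * K1)"
      proof -
        have "b * (Kst * t) = Kst * a" using b by (simp add: t_def)
        also have "\<dots> \<le> Kst * (\<mu> * D)" using Kst a\<mu> by (intro mult_left_mono) auto
        also have "\<dots> = (Kst * \<mu>) * D" by simp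
        also have "\<dots> \<le> b * b / (8 * K1) * D" using \<mu>(2) D by (intro mult_right_mono) auto
        also have "\<dots> = b * (b * D / (8 * K1))" by simp
        finally show ?thesis using b by (simp only: mult_le_cancel_left_pos)
      qed
      \<comment> \<open>The budget: with \<open>e = b * D / (16 * K1)\<close>,
        \<open>\<gamma> / 2\<close> is \<open>4 * e\<close>, of which \<open>2 * e\<close> go to the
        comparison losses, \<open>e\<close> to the action and \<open>e\<close> to the phase
        error.\<close>
      then have comb: "p1 + \<xi> + p4 + p2 + p3 \<le> \<gamma> / 2"
        if "p1 \<le> r1" "p2 \<le> r2" "p3 \<le> r3" "r1 + r2 + r3 = Kst * t" "p4 \<le> b * D / (16 * K1)" for p1 p2 p3 p4 r1 r2 r3
      proof -
        define e where "e = b * D / (16 * K1)"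
        have "\<gamma> / 2 = 4 * e" "b * D / (8 * K1) = 2 * e" by (simp_all add: \<gamma>_def e_def)
        moreover from this have "Kst * t \<le> 2 * e" using \<open>Kst * t \<le> b * D / (8 * K1)\<close> by simp
        moreover have "\<xi> \<le> e" "p4 \<le> e" using \<xi>b that by (simp_all add: e_def)
        ultimately show ?thesis using that(1-4) by linarith
      qed
      have "2 * real P * (dc * \<delta>) \<le> b * D / (16 * K1)" using \<delta>(4) by (simp add: mult.assoc)
      then show ?thesis unfolding const by (rule comb[OF e1 e2 e3 sum])
    qed
    show ?thesis
    proof (rule N.locking_unique[where J=J and m=m and q=qH and \<xi>=\<xi> and P=P and y=y and D=D and a=a and aq=aq
        and \<delta>="dc * \<delta>" and b=b and \<gamma>=\<gamma> and \<theta>=\<theta> and G=G and u=u and Lu=Lu and LG=LG and \<alpha>=\<alpha> and \<eta>=\<eta>])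
      show "G x = phi x - \<alpha> + u x - u (F x)" for x by (rule Gdef)
      show "c2 = c1 + Lphi * KS + 1" by (rule c2_def)
      show "0 \<le> c1" using c1 by simp
      show "\<xi> + dc * \<delta> \<le> a" using \<xi>a \<delta>(3) by linarith
      show "\<theta>2 = H.MD * (\<theta> + aq)" by (rule \<theta>2_def)
      show "a + MD * D / K1 + D / K1 < D" by (rule k1)
    qed (fact u G P y D(1) D1 cd HF qHy aqD dphi Jprop off on far b(1) K1(1) \<xi>_def \<gamma>_def \<gamma>1 \<gamma>2 n2 \<theta>_def n3)+
  qed
  have "\<epsilon>-lipschitz_on UNIV g'" by (rule lipschitz_on_le[OF g'lip]) (use \<epsilon>1 in simp)
  moreover have "\<bar>g x\<bar> \<le> \<epsilon> \<and> \<bar>g' x\<bar> \<le> \<epsilon>" for x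
    using gb[of x] g'b[of x] kma a\<epsilon>1 \<epsilon>1 a0 a1 by (intro conjI) linarith+
  ultimately show ?thesis using gD gper \<delta>(1) main by (intro exI[of _ g] exI[of _ g'] exI[of _ \<delta>]) blast
qed

end

subsection \<open>Density and openness\<close>

text \<open>The integer accounts for the normalisation of lifts: maps that are close on the circle may have
  normalised lifts that differ by nearly 1.\<close>

definition lift_near :: "real \<Rightarrow> (real \<Rightarrow> real) \<Rightarrow> (real \<Rightarrow> real) \<Rightarrow> bool" where
  "lift_near e S T \<longleftrightarrow> (\<exists>m::int. \<forall>x. \<bar>S x - T x - of_int m\<bar> \<le> e) \<and> (\<forall>x. \<bar>deriv S x - deriv T x\<bar> \<le> e)
     \<and> e-lipschitz_on UNIV (\<lambda>x. deriv S x - deriv T x)"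

lemma lift_near_trans:
  assumes "lift_near e R S" "lift_near f S T" shows "lift_near (e + f) R T"
proof -
  obtain m k :: int where m: "\<And>x. \<bar>R x - S x - of_int m\<bar> \<le> e" and k: "\<And>x. \<bar>S x - T x - of_int k\<bar> \<le> f"
    using assms unfolding lift_near_def by blast
  have "\<bar>R x - T x - of_int (m + k)\<bar> \<le> e + f" for x using m[of x] k[of x] by simp
  then have "\<exists>m::int. \<forall>x. \<bar>R x - T x - of_int m\<bar> \<le> e + f" by blast
  moreover have "\<bar>deriv R x - deriv T x\<bar> \<le> e + f" for x
  proof -
    have "\<bar>deriv R x - deriv S x\<bar> \<le> e" "\<bar>deriv S x - deriv T x\<bar> \<le> f" using assms by (simp_all add: lift_near_def)
    then show ?thesis by linarith
  qed
  moreover have "(e + f)-lipschitz_on UNIV (\<lambda>x. (deriv R x - deriv S x) + (deriv S x - deriv T x))"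
    using assms unfolding lift_near_def by (intro lipschitz_on_add) auto
  ultimately show ?thesis unfolding lift_near_def by auto
qed

lemma lift_near_mono: "lift_near e S T \<Longrightarrow> e \<le> f \<Longrightarrow> lift_near f S T"
  unfolding lift_near_def by (meson lipschitz_on_le order_trans)

lemma uniquely_locked_cong:
  assumes "circ_map F = circ_map G" "\<And>x. deriv F x = deriv G x"
  shows "uniquely_locked F \<longleftrightarrow> uniquely_locked G"
proof -
  have l: "lyap F = lyap G" unfolding lyap_def[abs_def] assms(2) ..
  have i: "invariant_prob F = invariant_prob G" unfolding invariant_prob_def[abs_def] assms(1) ..
  have "alpha F = alpha G" unfolding alpha_def l i ..
  then have m: "lyap_minimizing F = lyap_minimizing G" unfolding lyap_minimizing_def[abs_def] l i by simp
  have s: "supported_on_periodic_orbit F = supported_on_periodic_orbit G"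
    unfolding supported_on_periodic_orbit_def[abs_def] assms(1) ..
  show ?thesis unfolding uniquely_locked_def m s ..
qed

context expanding_lift begin

lemma shift_lift: "expanding_lift (\<lambda>x. F x + of_int m) d L C lam"
  and deriv_shift_lift: "deriv (\<lambda>x. F x + of_int m) = deriv F"
proof -
  let ?H = "\<lambda>x. F x + of_int m"
  have HD: "(?H has_real_derivative deriv F x) (at x)" for x
    using DERIV_add[OF DERIV[of x] DERIV_const[of "of_int m"]] by simp
  then show dH: "deriv ?H = deriv F" by (intro ext DERIV_imp_deriv)
  show "expanding_lift ?H d L C lam"
  proof
    show "?H differentiable at x" for x using HD real_differentiable_def by blast
    show "L-lipschitz_on UNIV (deriv ?H)" unfolding dH by (rule lip)
    show "?H (x + 1) = ?H x + of_int d" for x by (simp add: deg)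
    fix n x
    have "\<exists>k. (?H ^^ i) x = (F ^^ i) x + of_int k" for i
    proof (induction i)
      case (Suc i)
      then obtain k where "(?H ^^ i) x = (F ^^ i) x + of_int k" by blast
      then have "(?H ^^ Suc i) x = (F ^^ Suc i) x + of_int (d * k + m)" by (simp add: deg_int)
      then show ?case by blast
    qed (auto intro: exI[of _ 0])
    then have "deriv F ((?H ^^ i) x) = deriv F ((F ^^ i) x)" for i using periodic1_int[OF deriv_periodic] by metis
    then show "C * lam ^ n \<le> (\<Prod>i<n. \<bar>deriv ?H ((?H ^^ i) x)\<bar>)" unfolding dH using exp_prod by simp
  qed (fact C_pos C_le lam)+
qed

text \<open>\<open>G\<close> differs from \<open>phi - \<alpha>\<close> by the coboundary of a
  bounded function, so its minimal Birkhoff sums are bounded and \<open>zero_orbit_exists\<close>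
  applies.\<close>

lemma calibrated_cocycle:
  obtains \<alpha> u Lu G LG z where "periodic1 u" "Lu-lipschitz_on UNIV u" "\<And>x. G x = phi x - \<alpha> + u x - u (F x)"
    "periodic1 G" "LG-lipschitz_on UNIV G" "\<And>x. 0 \<le> G x" "z \<in> {0..<1}" "\<And>i. G ((F ^^ i) z) = 0"
proof -
  obtain \<alpha> u Lu where u: "periodic1 u" "Lu-lipschitz_on UNIV u" "\<And>x. u (F x) \<le> u x + phi x - \<alpha>"
    "\<And>n. \<exists>x. bsum F phi n x \<le> n * \<alpha> + 1"
    using subaction_exists[OF phi_periodic phi_lip] by blast
  define G where "G x = phi x - \<alpha> + u x - u (F x)" for x
  have Gper: "periodic1 G" unfolding periodic1_def G_def
    using phi_periodic u(1) deg periodic1_int[OF u(1)] by (simp add: periodic1_def)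
  have Glip: "(Lphi + Lu + Lu * MD)-lipschitz_on UNIV G"
  proof (rule lipschitz_realI)
    fix x y
    have "\<bar>u (F x) - u (F y)\<bar> \<le> Lu * \<bar>F x - F y\<bar>" by (rule lipschitz_realD[OF u(2)])
    also have "\<dots> \<le> Lu * (MD * \<bar>x - y\<bar>)"
      using lipschitz_realD[OF F_lip] lipschitz_on_nonneg[OF u(2)] by (intro mult_left_mono) auto
    finally have "\<bar>G x - G y\<bar> \<le> Lphi * \<bar>x - y\<bar> + Lu * \<bar>x - y\<bar> + Lu * (MD * \<bar>x - y\<bar>)"
      using lipschitz_realD[OF phi_lip, of x y] lipschitz_realD[OF u(2), of x y]
      unfolding G_def by linarith
    then show "\<bar>G x - G y\<bar> \<le> (Lphi + Lu + Lu * MD) * \<bar>x - y\<bar>" by (simp add: algebra_simps)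
  qed (use lipschitz_on_nonneg[OF phi_lip] lipschitz_on_nonneg[OF u(2)] MD_pos in simp)
  have G0: "0 \<le> G x" for x using u(3)[of x] by (simp add: G_def)
  obtain Bu where Bu: "\<And>x. \<bar>u x\<bar> \<le> Bu"
    using periodic1_bounded[OF u(1) lipschitz_on_continuous_on[OF u(2)]] by blast
  have "\<exists>x. bsum F G n x \<le> 1 + 2 * Bu" for n
  proof -
    obtain x where x: "bsum F phi n x \<le> n * \<alpha> + 1" using u(4) by blast
    have "bsum F phi n x = n * \<alpha> + bsum F G n x + u ((F ^^ n) x) - u x" by (rule bsum_coboundary) (simp add: G_def)
    then show ?thesis using x Bu[of x] Bu[of "(F ^^ n) x"] by (intro exI[of _ x]) linarith
  qed
  then obtain z where "z \<in> {0..<1}" "\<And>i. G ((F ^^ i) z) = 0"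
    using zero_orbit_exists[OF Gper lipschitz_on_continuous_on[OF Glip] G0] by blast
  then show thesis using that[OF u(1,2) G_def Gper Glip G0] by blast
qed

lemma perturbed_lift:
  assumes g: "\<And>x. (g has_real_derivative g' x) (at x)" "periodic1 g" "e-lipschitz_on UNIV g'"
    "\<And>x. \<bar>g x\<bar> \<le> e \<and> \<bar>g' x\<bar> \<le> e" and e: "e \<le> 1" "e \<le> stab"
  shows "expanding_lift (\<lambda>x. F x + g x) d (L + 1) C (sqrt lam)" "lift_near e (\<lambda>x. F x + g x) F"
    "deriv (\<lambda>x. F x + g x) x = deriv F x + g' x"
proof -
  have HD: "((\<lambda>x. F x + g x) has_real_derivative (deriv F x + g' x)) (at x)" for x by (intro DERIV_add DERIV g)
  have dH: "deriv (\<lambda>x. F x + g x) x = deriv F x + g' x" for x by (rule DERIV_imp_deriv[OF HD])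
  then show "deriv (\<lambda>x. F x + g x) x = deriv F x + g' x" .
  have "(L + e)-lipschitz_on UNIV (\<lambda>x. deriv F x + g' x)" by (rule lipschitz_on_add[OF lip g(3)])
  then have l1: "(L + 1)-lipschitz_on UNIV (\<lambda>x. deriv F x + g' x)" by (rule lipschitz_on_le) (use e in simp)
  show "expanding_lift (\<lambda>x. F x + g x) d (L + 1) C (sqrt lam)"
  proof (rule nearby_expanding)
    show "(\<lambda>x. F x + g x) differentiable at x" for x using HD real_differentiable_def by blast
    show "(L + 1)-lipschitz_on UNIV (deriv (\<lambda>x. F x + g x))" unfolding dH[abs_def] by (rule l1)
    show "F (x + 1) + g (x + 1) = F x + g x + of_int d" for x using g(2) by (simp add: deg periodic1_def)
    show "\<bar>F x + g x - F x\<bar> \<le> stab" for x using g(4)[of x] e by simp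
    show "\<bar>deriv (\<lambda>x. F x + g x) x - deriv F x\<bar> \<le> stab" for x unfolding dH using g(4)[of x] e by simp
  qed
  show "lift_near e (\<lambda>x. F x + g x) F" unfolding lift_near_def dH
    using g(3,4) by (auto intro!: exI[of _ 0])
qed

lemma robust_locking_of_noncoboundary:
  assumes u: "periodic1 u" "Lu-lipschitz_on UNIV u"
    and Gdef: "\<And>x. G x = phi x - \<alpha> + u x - u (F x)"
    and G: "periodic1 G" "LG-lipschitz_on UNIV G" "\<And>x. 0 \<le> G x"
    and z: "z \<in> {0..<1}" "\<And>i. G ((F ^^ i) z) = 0" and xs: "0 < G xs" and \<epsilon>: "0 < \<epsilon>"
  shows "\<exists>S L0 C0 lam0 \<delta>. expanding_lift S d L0 C0 lam0 \<and> lift_near \<epsilon> S F \<and> 0 < \<delta>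
    \<and> (\<forall>H dH LH CH lamH. expanding_lift H dH LH CH lamH \<longrightarrow> lift_near \<delta> H S \<longrightarrow> uniquely_locked H)"
proof -
  define e where "e = min \<epsilon> (min (1/2) stab)"
  have e: "0 < e" "e \<le> \<epsilon>" "e \<le> 1/2" "e \<le> stab" using \<epsilon> stab_pos by (auto simp: e_def)
  obtain g g' \<delta> where g: "0 < \<delta>" "\<And>x. (g has_real_derivative g' x) (at x)" "periodic1 g" "e-lipschitz_on UNIV g'"
    "\<And>x. \<bar>g x\<bar> \<le> e \<and> \<bar>g' x\<bar> \<le> e"
    and lock: "\<And>H. (\<forall>x. H differentiable at x) \<longrightarrow> (L + 1)-lipschitz_on UNIV (deriv H) \<longrightarrow> (\<forall>x. H (x + 1) = H x + of_int d)
      \<longrightarrow> (\<forall>x. \<bar>H x - (F x + g x)\<bar> \<le> \<delta> \<and> \<bar>deriv H x - (deriv F x + g' x)\<bar> \<le> \<delta>) \<longrightarrow> uniquely_locked H"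
    using locking_perturbation[OF u Gdef G z xs e(1)] by metis
  define S where "S = (\<lambda>x. F x + g x)"
  have S: "expanding_lift S d (L + 1) C (sqrt lam)" "lift_near e S F" "\<And>x. deriv S x = deriv F x + g' x"
    unfolding S_def using perturbed_lift[OF g(2-5)] e by auto
  interpret S: expanding_lift S d "L + 1" C "sqrt lam" by (rule S)
  define \<delta>1 where "\<delta>1 = min \<delta> (1/4)"
  have \<delta>1: "0 < \<delta>1" "\<delta>1 \<le> \<delta>" "\<delta>1 \<le> 1/4" using g(1) by (auto simp: \<delta>1_def)
  have "uniquely_locked H" if H: "expanding_lift H dH LH CH lamH" and near: "lift_near \<delta>1 H S" for H dH LH CH lamH
  proof -
    interpret H: expanding_lift H dH LH CH lamH by (rule H)
    obtain m :: int where m: "\<And>x. \<bar>H x - S x - of_int m\<bar> \<le> \<delta>1" using near by (auto simp: lift_near_def)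
    \<comment> \<open>Lifts within 1/4 of each other, up to one integer, have degrees differing by
      at most 1/2, hence equal.\<close>
    have "\<bar>real_of_int dH - real_of_int d\<bar> \<le> 2 * \<delta>1" using m[of 0] m[of 1] H.deg[of 0] S.deg[of 0] by simp
    then have dd: "dH = d" using \<delta>1 by linarith
    let ?K = "\<lambda>x. H x + of_int (- m)"
    have dK: "deriv ?K = deriv H" by (rule H.deriv_shift_lift)
    interpret K: expanding_lift ?K dH LH CH lamH by (rule H.shift_lift)
    have "uniquely_locked ?K"
    proof (rule lock[rule_format])
      show "?K differentiable at x" for x by (rule K.diff)
      have "(\<delta>1 + (L + e))-lipschitz_on UNIV (\<lambda>x. (deriv H x - deriv S x) + (deriv F x + g' x))"
        using near by (intro lipschitz_on_add lip g(4)) (simp add: lift_near_def)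
      then have "(\<delta>1 + (L + e))-lipschitz_on UNIV (deriv H)" unfolding S(3) by simp
      then show "(L + 1)-lipschitz_on UNIV (deriv ?K)" unfolding dK by (rule lipschitz_on_le) (use \<delta>1 e in simp)
      show "?K (x + 1) = ?K x + of_int d" for x using K.deg[of x] dd by simp
      fix x
      have "\<bar>deriv H x - (deriv F x + g' x)\<bar> \<le> \<delta>1"
        using near unfolding lift_near_def S(3) by blast
      moreover have "\<bar>H x - (F x + g x) - of_int m\<bar> \<le> \<delta>1" using m[of x] by (simp add: S_def)
      ultimately show "\<bar>?K x - (F x + g x)\<bar> \<le> \<delta> \<and> \<bar>deriv ?K x - (deriv F x + g' x)\<bar> \<le> \<delta>"
        using \<delta>1 unfolding dK by simp
    qed
    moreover have "circ_map ?K = circ_map H"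
    proof
      fix x
      have "frac (H x + of_int (- m)) = frac (H x)" by (simp add: frac_def)
      then show "circ_map ?K x = circ_map H x" by (simp add: circ_map_def)
    qed
    ultimately show ?thesis using uniquely_locked_cong[of ?K H] dK by simp
  qed
  then show ?thesis using S \<delta>1(1) lift_near_mono[OF S(2) e(2)] by blast
qed

text \<open>\<open>F ^^ n\<close> stretches a period to the length |d|^n, which expansion forces
  above 1.\<close>

lemma degree_ge_2: "2 \<le> \<bar>d\<bar>"
proof (rule ccontr)
  assume "\<not> ?thesis"
  then have d1: "\<bar>real_of_int d\<bar> \<le> 1" by linarith
  obtain n where "1 / C < lam ^ n" using real_arch_pow[OF lam] by blast
  then have 1: "1 < C * lam ^ n" using C_pos by (simp add: field_simps)
  have "(F ^^ n) (0 + of_int 1) = (F ^^ n) 0 + of_int (d ^ n * 1)" by (rule deg_pow)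
  then have "\<bar>(F ^^ n) 1 - (F ^^ n) 0\<bar> = \<bar>real_of_int d\<bar> ^ n" by (simp add: power_abs)
  also have "\<dots> \<le> 1" using d1 by (intro power_le_one) auto
  finally show False using expand[of n 1 0] 1 by simp
qed

text \<open>In degree 2 the circle map has a single fixed point, so the second orbit is sought among
  the points fixed by the second iterate. \<open>F (F x) - x\<close> grows by d^2 - 1 \<ge> 3 over a
  period, so strictly inside the period it takes its value at \<open>p\<close> plus 1.\<close>

lemma two_periodic_orbits:
  obtains p r where "F p - p \<in> \<int>" "F (F r) - r \<in> \<int>" "r - p \<notin> \<int>" "F r - p \<notin> \<int>"
proof -
  \<comment> \<open>A fixed point on the circle arises by closing up a one-point
    pseudo-orbit.\<close>
  obtain p where "(F ^^ 1) p - p \<in> \<int>"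
    using periodic_shadow[of 1 "\<lambda>_. 0" 0 "\<lambda>_. 0" "\<lambda>_. 0" "\<lambda>_. \<bar>F 0\<bar>"] by (auto simp: periodic1_def lipschitz_on_constant)
  then have p: "F p - p \<in> \<int>" by simp
  have pp: "F (F p) - p \<in> \<int>"
    using Ints_add[OF deg_pow_diff[OF p, of 1] p] by simp
  define h where "h x = F (F x) - x" for x
  have conth: "continuous_on A h" for A
    unfolding h_def by (intro continuous_intros continuous_on_compose2[OF cont[of UNIV] cont]) auto
  have "F (F (p + of_int 1)) = F (F p) + of_int (d * (d * 1))" by (simp only: deg_int)
  then have "h (p + 1) - h p = real_of_int (d * d) - 1" by (simp add: h_def)
  moreover have "4 \<le> d * d"
    using mult_mono[OF degree_ge_2 degree_ge_2] by (simp add: abs_mult_self_eq)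
  then have "4 \<le> real_of_int (d * d)" by linarith
  ultimately have hp: "h p \<le> h p + 1" "h p + 1 < h (p + 1)" by auto
  obtain r where r: "p \<le> r" "r \<le> p + 1" "h r = h p + 1"
    using IVT'[of h p "h p + 1" "p + 1"] hp conth by auto
  have "r \<noteq> p" "r \<noteq> p + 1" using r(3) hp by auto
  then have rp: "0 < r - p" "r - p < 1" using r by auto
  have r1: "r - p \<notin> \<int>"
  proof
    assume "r - p \<in> \<int>"
    then obtain k where "r - p = of_int k" by (auto elim: Ints_cases)
    then show False using rp by simp
  qed
  have "F (F r) - r = (F (F p) - p) + 1" using r(3) by (simp add: h_def)
  then have r2: "F (F r) - r \<in> \<int>" using pp by simp
  have "F r - p \<notin> \<int>"
  proof
    assume "F r - p \<in> \<int>"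
    from deg_pow_diff[OF this, of 1] have "F (F r) - F p \<in> \<int>" by simp
    from Ints_diff[OF Ints_add[OF this p] r2] have "r - p \<in> \<int>" by simp
    then show False using r1 by simp
  qed
  then show thesis using that p r1 r2 by blast
qed

text \<open>If \<phi> is a constant plus a coboundary, all periodic orbits have the same average.
  Changing the derivative at the fixed point \<open>p\<close> and keeping it along the orbit of
  \<open>r\<close> destroys this for every choice of constant and function.\<close>

lemma noncoboundary_perturbation:
  assumes u: "periodic1 u" and cob: "\<And>x. phi x = \<alpha> + u (F x) - u x" and \<epsilon>: "0 < \<epsilon>" "\<epsilon> \<le> 1" "\<epsilon> \<le> stab"
  shows "\<exists>S. expanding_lift S d (L + 1) C (sqrt lam) \<and> lift_near \<epsilon> S F \<and>
    (\<forall>\<beta> v. periodic1 v \<longrightarrow> (\<exists>x. ln \<bar>deriv S x\<bar> \<noteq> \<beta> + v (S x) - v x))"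
proof -
  obtain p r where pr: "F p - p \<in> \<int>" "F (F r) - r \<in> \<int>" "r - p \<notin> \<int>" "F r - p \<notin> \<int>"
    by (rule two_periodic_orbits)
  define q where "q i = (if i = 0 then p else if i = 1 then r else F r)" for i :: nat
  \<comment> \<open>If \<open>r\<close> is fixed on the circle, \<open>F r\<close> is the same point
    as \<open>r\<close> and must not be counted twice.\<close>
  define n :: nat where "n = (if F r - r \<in> \<int> then 2 else 3)"
  have nint: "q i - q j \<notin> \<int>" if "i < n" "j < n" "i \<noteq> j" for i j
  proof -
    have sym: "a - b \<notin> \<int>" if "b - a \<notin> \<int>" for a b :: real using that Ints_minus[of "a - b"] by auto
    note f = pr(3,4) sym[OF pr(3)] sym[OF pr(4)]
    show ?thesis
    proof (cases "F r - r \<in> \<int>")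
      case True
      then have "i = 0 \<and> j = 1 \<or> i = 1 \<and> j = 0" using that by (auto simp: n_def)
      then show ?thesis using f by (auto simp: q_def)
    next
      case False
      then have "i < 3" "j < 3" using that by (auto simp: n_def)
      then have "i = 0 \<or> i = 1 \<or> i = 2" "j = 0 \<or> j = 1 \<or> j = 2" by auto
      then show ?thesis using f False sym[OF False] that(3) by (elim disjE) (simp_all add: q_def)
    qed
  qed
  define Dm where "Dm = Min (insert 1 ((\<lambda>(i, j). cdist (q i) (q j)) ` {(i, j). i < n \<and> j < n \<and> i \<noteq> j}))"
  have fin: "finite {(i, j). i < n \<and> j < n \<and> i \<noteq> j}"
    by (rule finite_subset[of _ "{..<n} \<times> {..<n}"]) auto
  have Dm: "0 < Dm" "Dm \<le> 1" unfolding Dm_def using fin nint cdist_pos by auto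
  have sep: "3 * Dm / 4 \<le> \<bar>q i - q j - of_int k\<bar>" if "i < n" "j < n" "i \<noteq> j" for i j k
  proof -
    have "Dm \<le> cdist (q i) (q j)" unfolding Dm_def using fin that by (intro Min_le) auto
    then show ?thesis using cdist_le[of "q i" "q j" k] Dm by linarith
  qed
  \<comment> \<open>\<open>2 * \<kappa> \<le> C * lam\<close> excludes a change of sign at
    \<open>p\<close>, so adding \<kappa> does change the modulus; the condition with 128 bounds the
    Lipschitz constant of the bump.\<close>
  obtain \<kappa> where \<kappa>: "0 < \<kappa>" "128 * \<kappa> \<le> \<epsilon> * Dm" "2 * \<kappa> \<le> C * lam"
  proof -
    have "\<exists>e>0. \<forall>t. 0 < t \<longrightarrow> t \<le> e \<longrightarrow> (\<forall>(k, v)\<in>set [(128, \<epsilon> * Dm), (2, C * lam)]. k * t \<le> v)"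
      by (rule small_enough) (use \<epsilon> Dm Clam_pos in auto)
    then show ?thesis using that by auto
  qed
  have n1: "1 \<le> n" by (simp add: n_def)
  define \<kappa>s where "\<kappa>s i = (if i = 0 then \<kappa> else 0)" for i :: nat
  have \<kappa>s: "\<bar>\<kappa>s i\<bar> \<le> \<kappa>" for i using \<kappa> by (simp add: \<kappa>s_def)
  obtain g g' where g: "\<And>x. (g has_real_derivative g' x) (at x)" "periodic1 g" "(128 * \<kappa> / Dm)-lipschitz_on UNIV g'"
    "\<And>x. \<bar>g' x\<bar> \<le> \<kappa>" "\<And>x. \<bar>g x\<bar> \<le> \<kappa>" "\<And>i. i < n \<Longrightarrow> g (q i) = 0 \<and> g' (q i) = \<kappa>s i"
    using bump_sum_exists[where q=q and \<kappa>=\<kappa>s and km=\<kappa>, OF n1 Dm \<kappa>s sep] by blast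
  have \<kappa>\<epsilon>: "\<kappa> \<le> \<epsilon>" using \<kappa> Dm \<epsilon> mult_left_mono[OF Dm(2), of \<epsilon>] by linarith
  have glip: "\<epsilon>-lipschitz_on UNIV g'"
    by (rule lipschitz_on_le[OF g(3)]) (use \<kappa> Dm in \<open>simp add: divide_le_eq\<close>)
  have gb: "\<bar>g x\<bar> \<le> \<epsilon> \<and> \<bar>g' x\<bar> \<le> \<epsilon>" for x using g(4)[of x] g(5)[of x] \<kappa>\<epsilon> by linarith
  define S where "S = (\<lambda>x. F x + g x)"
  have S: "expanding_lift S d (L + 1) C (sqrt lam)" "lift_near \<epsilon> S F" "\<And>x. deriv S x = deriv F x + g' x"
    unfolding S_def using perturbed_lift[OF g(1,2) glip gb \<epsilon>(2,3)] by auto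
  have gp: "g p = 0" "g' p = \<kappa>" using g(6)[of 0] n1 by (auto simp: q_def \<kappa>s_def)
  have gr: "g r = 0" "g' r = 0" using g(6)[of 1] by (auto simp: q_def \<kappa>s_def n_def split: if_splits)
  have gFr: "g (F r) = 0" "g' (F r) = 0"
  proof -
    show "g (F r) = 0"
    proof (cases "F r - r \<in> \<int>")
      case True then show ?thesis using periodic1_diff_int[OF g(2) True] gr by simp
    next
      case False then show ?thesis using g(6)[of 2] by (simp add: q_def n_def)
    qed
    show "g' (F r) = 0"
    proof (cases "F r - r \<in> \<int>")
      case True then show ?thesis using periodic1_diff_int[OF periodic1_deriv[OF g(1,2)] True] gr by simp
    next
      case False then show ?thesis using g(6)[of 2] by (simp add: q_def n_def \<kappa>s_def)
    qed
  qed
  have "\<exists>x. ln \<bar>deriv S x\<bar> \<noteq> \<beta> + v (S x) - v x" if v: "periodic1 v" for \<beta> v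
  proof (rule ccontr)
    assume "\<not> ?thesis"
    then have *: "\<And>x. ln \<bar>deriv S x\<bar> = \<beta> + v (S x) - v x" by blast
    have Sv: "S p = F p" "S r = F r" "S (F r) = F (F r)" using gp gr gFr by (simp_all add: S_def)
    have "v (F p) = v p" "u (F p) = u p" "v (F (F r)) = v r" "u (F (F r)) = u r"
      using periodic1_diff_int[OF v] periodic1_diff_int[OF u] pr by auto
    then have 1: "phi p = \<alpha>" "phi r + phi (F r) = 2 * \<alpha>" "ln \<bar>deriv F p + \<kappa>\<bar> = \<beta>" "phi r + phi (F r) = 2 * \<beta>"
      using cob[of p] cob[of r] cob[of "F r"] *[of p] *[of r] *[of "F r"]
      by (simp_all add: S(3) Sv gp(2) gr(2) gFr(2) phi_def)
    then have "ln \<bar>deriv F p + \<kappa>\<bar> = ln \<bar>deriv F p\<bar>" by (simp add: phi_def)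
    moreover have "0 < \<bar>deriv F p\<bar>" "0 < \<bar>deriv F p + \<kappa>\<bar>" using deriv_lower[of p] \<kappa> Clam_pos by linarith+
    ultimately have "\<bar>deriv F p + \<kappa>\<bar> = \<bar>deriv F p\<bar>" by simp
    then show False using deriv_lower[of p] \<kappa> Clam_pos by linarith
  qed
  then show ?thesis using S by blast
qed

lemma robust_locking_dense:
  assumes \<epsilon>: "0 < \<epsilon>"
  shows "\<exists>S L0 C0 lam0 \<delta>. expanding_lift S d L0 C0 lam0 \<and> lift_near \<epsilon> S F \<and> 0 < \<delta>
    \<and> (\<forall>H dH LH CH lamH. expanding_lift H dH LH CH lamH \<longrightarrow> lift_near \<delta> H S \<longrightarrow> uniquely_locked H)"
proof -
  obtain \<alpha> u Lu G LG z where c: "periodic1 u" "Lu-lipschitz_on UNIV u" "\<And>x. G x = phi x - \<alpha> + u x - u (F x)"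
    "periodic1 G" "LG-lipschitz_on UNIV G" "\<And>x. 0 \<le> G x" "z \<in> {0..<1}" "\<And>i. G ((F ^^ i) z) = 0"
  proof (rule calibrated_cocycle)
  qed (rule that, assumption+)
  show ?thesis
  proof (cases "\<exists>x. 0 < G x")
    case True
    then show ?thesis using robust_locking_of_noncoboundary[OF c _ \<epsilon>] by blast
  next
    case False
    then have "G x = 0" for x using c(6)[of x] by (metis order_le_less)
    then have cob: "phi x = \<alpha> + u (F x) - u x" for x using c(3)[of x] by simp
    define e where "e = min (\<epsilon> / 2) (min 1 stab)"
    have e: "0 < e" "e \<le> \<epsilon> / 2" "e \<le> 1" "e \<le> stab" using \<epsilon> stab_pos by (auto simp: e_def)
    obtain T where T: "expanding_lift T d (L + 1) C (sqrt lam)" "lift_near e T F"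
      "\<And>\<beta> v. periodic1 v \<Longrightarrow> \<exists>x. ln \<bar>deriv T x\<bar> \<noteq> \<beta> + v (T x) - v x"
      using noncoboundary_perturbation[OF c(1) cob e(1,3,4)] by blast
    interpret T: expanding_lift T d "L + 1" C "sqrt lam" by (rule T)
    obtain \<alpha>' u' Lu' G' LG' z' where c': "periodic1 u'" "Lu'-lipschitz_on UNIV u'"
      "\<And>x. G' x = T.phi x - \<alpha>' + u' x - u' (T x)"
      "periodic1 G'" "LG'-lipschitz_on UNIV G'" "\<And>x. 0 \<le> G' x" "z' \<in> {0..<1}" "\<And>i. G' ((T ^^ i) z') = 0"
    proof (rule T.calibrated_cocycle)
    qed (rule that, assumption+)
    obtain x where "ln \<bar>deriv T x\<bar> \<noteq> \<alpha>' + u' (T x) - u' x" using T(3)[OF c'(1)] by blast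
    then have "0 < G' x" using c'(3)[of x] c'(6)[of x] by (simp add: T.phi_def order_le_less)
    then obtain S L0 C0 lam0 \<delta> where S: "expanding_lift S d L0 C0 lam0" "lift_near (\<epsilon> / 2) S T" "0 < \<delta>"
      "\<forall>H dH LH CH lamH. expanding_lift H dH LH CH lamH \<longrightarrow> lift_near \<delta> H S \<longrightarrow> uniquely_locked H"
      using T.robust_locking_of_noncoboundary[OF c', of x "\<epsilon> / 2"] \<epsilon> by auto
    have "lift_near (\<epsilon> / 2 + e) S F" by (rule lift_near_trans[OF S(2) T(2)])
    then have "lift_near \<epsilon> S F" by (rule lift_near_mono) (use e in simp)
    then show ?thesis using S by blast
  qed
qed

end

section \<open>Comparison of \<open>dC11\<close> with nearness of lifts, and the conclusion\<close>

lemma periodic1_lipschitz_cdist: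
  fixes f :: "real \<Rightarrow> real"
  assumes "periodic1 f" "K-lipschitz_on UNIV f"
  shows "\<bar>f x - f y\<bar> \<le> K * cdist x y"
proof -
  have "f (y + of_int (round (x - y))) = f y" by (rule periodic1_int[OF assms(1)])
  then show ?thesis
    using lipschitz_realD[OF assms(2), of x "y + of_int (round (x - y))"] by (simp add: cdist_def algebra_simps)
qed

lemma E11_expanding_lift:
  assumes "F \<in> E11" shows "\<exists>d L C lam. expanding_lift F d L C lam"
proof -
  have C1: "\<And>x. F differentiable at x" "\<exists>d::int. \<forall>x. F (x + 1) = F x + of_int d" and "expanding F"
    and "\<exists>L. \<forall>x y. \<bar>deriv F x - deriv F y\<bar> \<le> L * cdist x y"
    using assms by (auto simp: E11_def C1_lift_def)
  then obtain d :: int and L C lam where d: "\<And>x. F (x + 1) = F x + of_int d" and C: "0 < C" "1 < lam"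
    "\<And>n x. 1 \<le> n \<Longrightarrow> C * lam ^ n \<le> \<bar>deriv (F ^^ n) x\<bar>"
    and L: "\<And>x y. \<bar>deriv F x - deriv F y\<bar> \<le> L * cdist x y"
    unfolding expanding_def by metis
  have D: "(F has_real_derivative deriv F x) (at x)" for x
    using C1(1) DERIV_deriv_iff_real_differentiable by blast
  have "expanding_lift F d \<bar>L\<bar> (min C 1) lam"
  proof
    show "\<bar>L\<bar>-lipschitz_on UNIV (deriv F)"
    proof (rule lipschitz_realI)
      fix x y
      have "L * cdist x y \<le> \<bar>L\<bar> * \<bar>x - y\<bar>" using cdist_le_abs cdist_nonneg by (intro mult_mono) auto
      then show "\<bar>deriv F x - deriv F y\<bar> \<le> \<bar>L\<bar> * \<bar>x - y\<bar>" using L[of x y] by linarith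
    qed simp
    fix n x
    show "min C 1 * lam ^ n \<le> (\<Prod>i<n. \<bar>deriv F ((F ^^ i) x)\<bar>)"
    proof (cases "n = 0")
      case False
      have "min C 1 * lam ^ n \<le> C * lam ^ n" using C by (intro mult_right_mono) auto
      also have "\<dots> \<le> \<bar>deriv (F ^^ n) x\<bar>" using C(3) False by simp
      also have "deriv (F ^^ n) x = (\<Prod>i<n. deriv F ((F ^^ i) x))" by (rule DERIV_imp_deriv[OF DERIV_funpow[OF D]])
      finally show ?thesis by (simp add: abs_prod)
    qed simp
  qed (use C1 d C in auto)
  then show ?thesis by blast
qed

lemma expanding_lift_E11:
  assumes "expanding_lift F d L C lam" "0 \<le> F 0" "F 0 < 1"
  shows "F \<in> E11"
proof -
  interpret expanding_lift F d L C lam by (rule assms)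
  have "C1_lift F" unfolding C1_lift_def
    using diff deg assms lipschitz_on_continuous_on[OF lip] by blast
  moreover have "expanding F" unfolding expanding_def
  proof (intro exI conjI allI impI)
    fix n :: nat and x
    have "deriv (F ^^ n) x = (\<Prod>i<n. deriv F ((F ^^ i) x))" by (rule DERIV_imp_deriv[OF DERIV_pow])
    then show "C * lam ^ n \<le> \<bar>deriv (F ^^ n) x\<bar>" using exp_prod[of n x] by (simp add: abs_prod)
  qed (use C_pos lam in auto)
  moreover have "\<exists>L. \<forall>x y. \<bar>deriv F x - deriv F y\<bar> \<le> L * cdist x y"
    using periodic1_lipschitz_cdist[OF deriv_periodic lip] by blast
  ultimately show ?thesis by (simp add: E11_def)
qed

lemma dC11_le_of_lift_near:
  assumes S: "S \<in> E11" and T: "T \<in> E11" and near: "lift_near e S T"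
  shows "dC11 S T \<le> 3 * e"
proof -
  obtain dS LS CS lS where "expanding_lift S dS LS CS lS" using E11_expanding_lift[OF S] by blast
  then interpret S: expanding_lift S dS LS CS lS .
  obtain dT LT CT lT where "expanding_lift T dT LT CT lT" using E11_expanding_lift[OF T] by blast
  then interpret T: expanding_lift T dT LT CT lT .
  obtain m :: int where m: "\<And>x. \<bar>S x - T x - of_int m\<bar> \<le> e" using near by (auto simp: lift_near_def)
  have e0: "0 \<le> e" using m[of 0] by linarith
  have "(SUP x. cdist (S x) (T x)) \<le> e"
  proof (rule cSUP_least)
    show "cdist (S x) (T x) \<le> e" for x using cdist_le[of "S x" "T x" m] m[of x] by linarith
  qed simp
  moreover have "(SUP x. \<bar>deriv S x - deriv T x\<bar>) \<le> e"
    by (rule cSUP_least) (use near in \<open>auto simp: lift_near_def\<close>)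
  moreover have "(SUP p\<in>{(x, y). cdist x y \<noteq> 0}.
      \<bar>(deriv S (fst p) - deriv T (fst p)) - (deriv S (snd p) - deriv T (snd p))\<bar> / cdist (fst p) (snd p)) \<le> e"
  proof (rule cSUP_least)
    have "cdist 0 (1/2) = 1/2" by (simp add: cdist_def round_def)
    then show "{(x, y). cdist x y \<noteq> 0} \<noteq> {}" by force
    fix p assume "p \<in> {(x, y). cdist x y \<noteq> 0}"
    then have p: "0 < cdist (fst p) (snd p)" using cdist_nonneg[of "fst p" "snd p"] by auto
    have "periodic1 (\<lambda>x. deriv S x - deriv T x)"
      using S.deriv_periodic T.deriv_periodic by (simp add: periodic1_def)
    then have "\<bar>(deriv S (fst p) - deriv T (fst p)) - (deriv S (snd p) - deriv T (snd p))\<bar> \<le> e * cdist (fst p) (snd p)"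
      using near by (intro periodic1_lipschitz_cdist) (auto simp: lift_near_def)
    then show "\<bar>(deriv S (fst p) - deriv T (fst p)) - (deriv S (snd p) - deriv T (snd p))\<bar> / cdist (fst p) (snd p) \<le> e"
      using p by (simp add: divide_le_eq)
  qed
  ultimately show ?thesis unfolding dC11_def by linarith
qed

text \<open>\<open>dC11\<close> sees the values only modulo 1, so the integer is read off at 0 and
  carried over a period by the bound on the derivatives. The three suprema are taken over bounded
  families and are nonnegative, so each of them is below \<open>e\<close>.\<close>

lemma lift_near_of_dC11:
  assumes S: "S \<in> E11" and T: "T \<in> E11" and d: "dC11 S T < e" "e \<le> 1"
  shows "lift_near (2 * e) S T"
proof -
  obtain dS LS CS lS where "expanding_lift S dS LS CS lS" using E11_expanding_lift[OF S] by blast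
  then interpret S: expanding_lift S dS LS CS lS .
  obtain dT LT CT lT where "expanding_lift T dT LT CT lT" using E11_expanding_lift[OF T] by blast
  then interpret T: expanding_lift T dT LT CT lT .
  let ?h = "\<lambda>x. deriv S x - deriv T x"
  have hper: "periodic1 ?h" using S.deriv_periodic T.deriv_periodic by (simp add: periodic1_def)
  have hlip: "(LS + LT)-lipschitz_on UNIV ?h" by (rule lipschitz_on_diff[OF S.lip T.lip])
  let ?Q = "\<lambda>p. \<bar>(deriv S (fst p) - deriv T (fst p)) - (deriv S (snd p) - deriv T (snd p))\<bar> / cdist (fst p) (snd p)"
  have b1: "bdd_above (range (\<lambda>x. cdist (S x) (T x)))" by (rule bdd_aboveI2) (rule cdist_le_half)
  have b2: "bdd_above (range (\<lambda>x. \<bar>?h x\<bar>))"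
  proof -
    obtain B where "\<And>x. \<bar>?h x\<bar> \<le> B" using periodic1_bounded[OF hper lipschitz_on_continuous_on[OF hlip]] by blast
    then show ?thesis by (auto intro!: bdd_aboveI)
  qed
  have b3: "bdd_above (?Q ` {(x, y). cdist x y \<noteq> 0})"
  proof (rule bdd_aboveI2)
    fix p assume "p \<in> {(x, y). cdist x y \<noteq> 0}"
    then have p: "0 < cdist (fst p) (snd p)" using cdist_nonneg[of "fst p" "snd p"] by auto
    show "?Q p \<le> LS + LT"
      using periodic1_lipschitz_cdist[OF hper hlip, of "fst p" "snd p"] p by (simp add: divide_le_eq)
  qed
  define s1 where "s1 = (SUP x. cdist (S x) (T x))"
  define s2 where "s2 = (SUP x. \<bar>?h x\<bar>)"
  define s3 where "s3 = (SUP p\<in>{(x, y). cdist x y \<noteq> 0}. ?Q p)"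
  have u1: "cdist (S x) (T x) \<le> s1" for x unfolding s1_def by (rule cSUP_upper[OF UNIV_I b1])
  have u2: "\<bar>?h x\<bar> \<le> s2" for x unfolding s2_def by (rule cSUP_upper[OF UNIV_I b2])
  have u3: "?Q (x, y) \<le> s3" if "cdist x y \<noteq> 0" for x y
    unfolding s3_def by (rule cSUP_upper[OF _ b3]) (use that in simp)
  \<comment> \<open>The pair \<open>(0, 1/2)\<close> supplies an element of the index set.\<close>
  have s30: "0 \<le> s3"
  proof -
    have c: "cdist 0 (1/2) = 1/2" by (simp add: cdist_def round_def)
    then have "0 \<le> ?Q (0, 1/2)" by simp
    also have "\<dots> \<le> s3" by (rule u3) (simp add: c)
    finally show ?thesis .
  qed
  have sum: "s1 + s2 + s3 < e" using d(1) unfolding dC11_def s1_def s2_def s3_def .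
  have s10: "0 \<le> s1" using u1[of 0] cdist_nonneg[of "S 0" "T 0"] by linarith
  have s20: "0 \<le> s2" using u2[of 0] by linarith
  have dl: "((\<lambda>x. S x - T x) has_real_derivative ?h x) (at x)" for x by (rule DERIV_diff[OF S.DERIV T.DERIV])
  have STl: "s2-lipschitz_on UNIV (\<lambda>x. S x - T x)" by (rule lipschitz_from_deriv[OF dl u2])
  define m where "m = round (S 0 - T 0)"
  have m0: "\<bar>S 0 - T 0 - of_int m\<bar> \<le> s1" using u1[of 0] by (simp add: cdist_def m_def)
  have "\<bar>real_of_int dS - real_of_int dT\<bar> \<le> s2"
    using lipschitz_realD[OF STl, of 1 0] S.deg[of 0] T.deg[of 0] by simp
  then have dd: "dS = dT" using sum d(2) s10 s30 by linarith
  have STper: "periodic1 (\<lambda>x. S x - T x)" unfolding periodic1_def using S.deg T.deg dd by simp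
  have "\<bar>S x - T x - of_int m\<bar> \<le> 2 * e" for x
  proof -
    have "\<bar>(S (frac x) - T (frac x)) - (S 0 - T 0)\<bar> \<le> s2 * \<bar>frac x - 0\<bar>" by (rule lipschitz_realD[OF STl])
    also have "\<dots> \<le> s2 * 1" using s20 frac_lt_1[of x] by (intro mult_left_mono) auto
    finally show ?thesis using m0 periodic1_frac[OF STper, of x] sum s30 s10 s20 by linarith
  qed
  moreover have "\<bar>?h x\<bar> \<le> 2 * e" for x using u2[of x] sum s10 s20 s30 by linarith
  moreover have "(2 * e)-lipschitz_on UNIV ?h"
  proof (rule lipschitz_realI)
    fix x y
    show "\<bar>?h x - ?h y\<bar> \<le> 2 * e * \<bar>x - y\<bar>"
    proof (cases "cdist x y = 0")
      case True
      then show ?thesis using periodic1_lipschitz_cdist[OF hper hlip, of x y] sum s10 s20 s30 by simp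
    next
      case False
      then have p: "0 < cdist x y" using cdist_nonneg[of x y] by simp
      have "\<bar>?h x - ?h y\<bar> \<le> s3 * cdist x y" using u3[OF False] p by (simp add: divide_le_eq)
      also have "\<dots> \<le> (2 * e) * \<bar>x - y\<bar>"
        using cdist_le_abs cdist_nonneg sum s10 s20 s30 by (intro mult_mono) auto
      finally show ?thesis .
    qed
  qed (use sum s10 s20 s30 in simp)
  ultimately show ?thesis unfolding lift_near_def by blast
qed

theorem theoremB:
  shows "\<exists>U. open_E11 U \<and> dense_E11 U \<and>
           (\<forall>F\<in>U. (\<exists>!M. lyap_minimizing F M) \<and>
                    (\<forall>M. lyap_minimizing F M \<longrightarrow> supported_on_periodic_orbit F M))"
proof -
  \<comment> \<open>\<open>U\<close> is the interior, for nearness of lifts, of the uniquely locked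
    maps: openness reduces to comparing the two notions of nearness, and the dynamics enters through
    density.\<close>
  define U where "U = {F \<in> E11. \<exists>e>0. \<forall>S\<in>E11. lift_near e S F \<longrightarrow> uniquely_locked S}"
  have sub: "U \<subseteq> E11" by (auto simp: U_def)
  have "open_E11 U"
    unfolding open_E11_def
  proof (intro conjI ballI sub)
    fix T assume "T \<in> U"
    then obtain e where T: "T \<in> E11" and e: "0 < e" and lock: "\<And>S. S \<in> E11 \<Longrightarrow> lift_near e S T \<Longrightarrow> uniquely_locked S"
      by (auto simp: U_def)
    define e' where "e' = min (e / 4) 1"
    have e': "0 < e'" "4 * e' \<le> e" "e' \<le> 1" using e by (auto simp: e'_def)
    have "S \<in> U" if S: "S \<in> E11" "dC11 S T < e'" for S
    proof -
      have ST: "lift_near (2 * e') S T" by (rule lift_near_of_dC11[OF S(1) T S(2) e'(3)])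
      have "uniquely_locked R" if "R \<in> E11" "lift_near (e / 2) R S" for R
      proof (rule lock[OF that(1)])
        show "lift_near e R T" by (rule lift_near_mono[OF lift_near_trans[OF that(2) ST]]) (use e' in simp)
      qed
      then show ?thesis unfolding U_def using S(1) e by (intro CollectI conjI exI[of _ "e / 2"]) auto
    qed
    then show "\<exists>e>0. \<forall>S\<in>E11. dC11 S T < e \<longrightarrow> S \<in> U" using e'(1) by blast
  qed
  moreover have "dense_E11 U"
    unfolding dense_E11_def
  proof (intro conjI ballI allI impI sub)
    fix T and e :: real assume T: "T \<in> E11" and e: "0 < e"
    obtain d L C lam where "expanding_lift T d L C lam" using E11_expanding_lift[OF T] by blast
    then interpret T: expanding_lift T d L C lam .
    obtain S0 L0 C0 lam0 \<delta> where S0: "expanding_lift S0 d L0 C0 lam0" "lift_near (e / 4) S0 T" "0 < \<delta>"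
      and lock: "\<And>H dH LH CH lamH. expanding_lift H dH LH CH lamH \<Longrightarrow> lift_near \<delta> H S0 \<Longrightarrow> uniquely_locked H"
    proof -
      have "0 < e / 4" using e by simp
      from T.robust_locking_dense[OF this] show ?thesis using that by blast
    qed
    interpret S0: expanding_lift S0 d L0 C0 lam0 by (rule S0)
    \<comment> \<open>This integer shift restores the normalisation of the lift at 0 and leaves the
      circle map unchanged.\<close>
    define k where "k = - \<lfloor>S0 0\<rfloor>"
    define S where "S = (\<lambda>x. S0 x + of_int k)"
    have S: "S \<in> E11"
    proof (rule expanding_lift_E11)
      show "expanding_lift S d L0 C0 lam0" unfolding S_def by (rule S0.shift_lift)
      show "0 \<le> S 0" "S 0 < 1" unfolding S_def k_def by (simp_all, linarith+)
    qed
    have dS: "deriv S = deriv S0" unfolding S_def by (rule S0.deriv_shift_lift)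
    have SS: "lift_near 0 S S0" unfolding lift_near_def dS
      by (auto simp: S_def lipschitz_on_constant intro: exI[of _ k])
    have ST: "lift_near (e / 4) S T" using lift_near_trans[OF SS S0(2)] by simp
    have "dC11 S T \<le> 3 * (e / 4)" by (rule dC11_le_of_lift_near[OF S T ST])
    then have "dC11 S T < e" using e by simp
    moreover have "uniquely_locked R" if R: "R \<in> E11" "lift_near \<delta> R S" for R
    proof -
      obtain dR LR CR lR where "expanding_lift R dR LR CR lR" using E11_expanding_lift[OF R(1)] by blast
      moreover have "lift_near \<delta> R S0" using lift_near_trans[OF R(2) SS] by simp
      ultimately show ?thesis by (rule lock)
    qed
    then have "S \<in> U" unfolding U_def using S S0(3) by blast
    ultimately show "\<exists>S\<in>U. dC11 S T < e" by blast
  qed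
  moreover have "(\<exists>!M. lyap_minimizing F M) \<and> (\<forall>M. lyap_minimizing F M \<longrightarrow> supported_on_periodic_orbit F M)"
    if FU: "F \<in> U" for F
  proof -
    obtain e where F: "F \<in> E11" and e: "0 < e" and lock: "\<And>S. S \<in> E11 \<Longrightarrow> lift_near e S F \<Longrightarrow> uniquely_locked S"
      using FU by (auto simp: U_def)
    have "lift_near e F F"
      unfolding lift_near_def
    proof (intro conjI)
      show "\<exists>m::int. \<forall>x. \<bar>F x - F x - of_int m\<bar> \<le> e" using e by (intro exI[of _ 0]) simp
      show "e-lipschitz_on UNIV (\<lambda>x. deriv F x - deriv F x)" using e by (intro lipschitz_realI) auto
    qed (use e in simp)
    from lock[OF F this] show ?thesis unfolding uniquely_locked_def .
  qed
  ultimately show ?thesis by blast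
qed

end
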